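(* Let $X=(X,\rho,\mu)$ be a complete homogeneous space which supports the weak $p$-Poincaré inequality, $1<p<\infty$, and let $\Omega,\widetilde\Omega$ be bounded domains in $X$. Then a bi-measurable homeomorphism $\varphi:\Omega\to\widetilde\Omega$ generates a bounded composition operator $$\varphi^*:S^{1,p}(\widetilde\Omega)\to S^{1,p}(\Omega),\qquad \varphi^*(f)=f\circ\varphi,$$ if and only if $\varphi$ belongs to the Reshetnyak–Sobolev class $V^{1,p}_{loc}(\Omega;\widetilde\Omega)$ and $$K_p(\varphi;\Omega)=\operatorname*{ess\,sup}_{x\in\Omega}K_p(x)<\infty,\qquad K_p(x)=\left(\frac{|D_{min}\varphi(x)|^p}{J(x,\varphi)}\right)^{1/p}.$$
   Context: A doubling metric measure space is a metric space $(X,\rho)$ with a Borel regular measure $\mu$ for which every ball has positive finite measure and $\mu(B(x,2r))\le C_\mu\mu(B(x,r))$ for all $x\in X$, $r>0$, with a (smallest) constant $C_\mu\ge1$. A homogeneous space is a doubling metric measure space with $\sigma$-finite measure such that there is $c_1\ge1$ with: for all $x_1,x_2\in X$, $r>0$, if $B(x_1,r)\cap B(x_2,r)\ne\emptyset$ then $B(x_2,r)\subset B(x_1,c_1r)$. A domain is a nonempty connected open set. Bounded domains $\Omega\subset X$ are considered as doubling metric measure spaces with the metric and measure induced from $X$. For a family $\Gamma$ of curves, $\mathrm{mod}_p(\Gamma)=\inf\int\eta^p\,d\mu$ over Borel $\eta\ge0$ with $\int_\gamma\eta\,ds\ge1$ for all locally rectifiable $\gamma\in\Gamma$. A Borel function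 $g\ge 0$ is a $p$-weak upper gradient of $f$ if $|f(\gamma(a))-f(\gamma(b))|\le\int_\gamma g\,ds$ for all rectifiable curves $\gamma:[a,b]\to\Omega$ except a family of zero $p$-module; it is an upper gradient if this holds for all rectifiable curves. If there is a $p$-weak upper gradient in $L^p$, $\nabla_{min}f$ denotes the minimal $p$-weak upper gradient in $L^p$ (unique up to measure zero). $N^{1,p}(\Omega)$ is the space of measurable $f:\Omega\to\mathbb R$ with $f\in L^p(\Omega)$ having a $p$-weak upper gradient in $L^p(\Omega)$. $S^{1,p}(\Omega)$, $1<p<\infty$, is the space of measurable $f:\Omega\to\mathbb R$ with $f\in L^1_{loc}(\Omega)$ and $\nabla_{min}f\in L^p(\Omega)$, with seminorm $\|f\|_{S^{1,p}(\Omega)}=\|\nabla_{min}f\|_{L^p(\Omega)}$. Functions in these spaces are considered up to sets of Sobolev $p$-capacity zero (quasicontinuous representatives are used). Weak $p$-Poincaré inequality: there are $\sigma>1$ and $C_p$ such that for all balls $B\subset X$, all $f\in L^1(\sigma B)$ and all $p$-weak upper gradients $g$ of $f$ in $\sigma B$, $\frac1{\mu(B)}\int_B|f-f_B|\,d\mu\le C_p\,\mathrm{diam}(B)\left(\frac1{\mu(\sigma B)}\int_{\sigma B}g^p\,d\mu\right)^{1/p}$, where $f_B$ is the mean of $f$ over $B$. A homeomorphism $\varphi:\Omega\to\widetilde\Omega$ is bi-measurable if images under $\varphi$ of sets of $\mu$-measure zero have $\mu$-measure zero (Luzin $N$-property) and preimages of sets of $\mu$-measure zero have $\mu$-measure zero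 (Luzin $N^{-1}$-property). It generates a bounded composition operator $\varphi^*:S^{1,p}(\widetilde\Omega)\to S^{1,p}(\Omega)$ if $f\circ\varphi\in S^{1,p}(\Omega)$ for every $f\in S^{1,p}(\widetilde\Omega)$ and there is a constant $C_{p,p}<\infty$ with $\|f\circ\varphi\|_{S^{1,p}(\Omega)}\le C_{p,p}\|f\|_{S^{1,p}(\widetilde\Omega)}$ for all such $f$. Reshetnyak–Sobolev class: for open $U\subset\Omega$, $V^{1,p}(U;\widetilde\Omega)$ is the class of bi-measurable mappings $\varphi$ (defined on $U$, with values in $\widetilde\Omega$) such that (1) for every $z\in\widetilde\Omega$ the function $[\varphi]_z(x)=\rho(\varphi(x),z)$ belongs to $N^{1,p}(U)$; (2) there is a function $|D_{up}\varphi|\in L^p(U)$ (an upper gradient of $\varphi$) that is an upper gradient of $[\varphi]_z$ for all $z\in\widetilde\Omega$. If nonempty, the collection of upper gradients of $\varphi$ (understood up to $p$-exceptional curve families, i.e. as $p$-weak upper gradients) contains a function $|D_{min}\varphi|$ of minimal $L^p$-norm, which satisfies $|D_{min}\varphi|\le|D_{up}\varphi|$ a.e. for every upper gradient $|D_{up}\varphi|$ of $\varphi$. $\varphi\in V^{1,p}_{loc}(\Omega;\widetilde\Omega)$ means $\varphi\in V^{1,p}(U;\widetilde\Omega)$ for every open bounded $U$ with $\overline U\subset\Omega$; then $|D_{min}\varphi|$ is defined a.e. in $\Omega$. The metric Jacobian is $J(x,\varphi)=\lim_{r\to0}\mu(\varphi(B(x,r)))/\mu(B(x,r))$; it exists and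 is finite a.e. in $\Omega$. *)

theory Defs
  imports "HOL-Probability.Probability"
begin

text \<open>
  The space \<open>X\<close> is the carrier of a type of class \<open>metric_space\<close>. A Borel regular (outer) measure
  is determined by its restriction to the Borel sets, so \<open>\<mu>\<close> is given as a measure \<open>M\<close> on the Borel
  sets; the \<open>\<mu>\<close>-measurable sets and the sets of \<open>\<mu>\<close>-measure zero are those of \<^term>\<open>completion M\<close>.
  A function on \<open>U \<subseteq> X\<close> is a total function of which only the values on \<open>U\<close> are used.
\<close>

section \<open>Homogeneous spaces\<close>

definition doubling_metric_measure :: "'a::metric_space measure \<Rightarrow> bool" where
  "doubling_metric_measure M \<longleftrightarrow>
     sets M = sets borel \<and>
     (\<forall>x r. 0 < r \<longrightarrow> 0 < emeasure M (ball x r) \<and> emeasure M (ball x r) < \<infinity>) \<and>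
     (\<exists>C\<ge>1. \<forall>x r. 0 < r \<longrightarrow> emeasure M (ball x (2 * r)) \<le> ennreal C * emeasure M (ball x r))"

definition homogeneous_space :: "'a::metric_space measure \<Rightarrow> bool" where
  "homogeneous_space M \<longleftrightarrow>
     doubling_metric_measure M \<and> sigma_finite_measure M \<and>
     (\<exists>c::real\<ge>1. \<forall>(x1::'a) x2 r. 0 < r \<longrightarrow> ball x1 r \<inter> ball x2 r \<noteq> {} \<longrightarrow>
        ball x2 r \<subseteq> ball x1 (c * r))"

definition domain_in :: "'a::topological_space set \<Rightarrow> bool" where
  "domain_in S \<longleftrightarrow> S \<noteq> {} \<and> open S \<and> connected S"


section \<open>Curves and modulus\<close>

text \<open>Compact curves are normalised to the parameter interval \<open>[0,1]\<close>; lengths and line integrals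
  do not change under this reparametrisation. On a compact interval, locally rectifiable
  means rectifiable.\<close>

definition curve_length :: "(real \<Rightarrow> 'a::metric_space) \<Rightarrow> real \<Rightarrow> ennreal" where
  \<comment> \<open>length of \<open>\<gamma>\<close> restricted to \<open>[0,t]\<close>\<close>
  "curve_length \<gamma> t = (SUP xs \<in> {xs. sorted xs \<and> set xs \<subseteq> {0..t}}.
     \<Sum>i<length xs - 1. ennreal (dist (\<gamma> (xs ! i)) (\<gamma> (xs ! Suc i))))"

definition rectifiable_curve :: "'a::metric_space set \<Rightarrow> (real \<Rightarrow> 'a) \<Rightarrow> bool" where
  "rectifiable_curve U \<gamma> \<longleftrightarrow> path \<gamma> \<and> path_image \<gamma> \<subseteq> U \<and> curve_length \<gamma> 1 < \<infinity>"

definition arclength_param :: "(real \<Rightarrow> 'a::metric_space) \<Rightarrow> real \<Rightarrow> 'a" where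
  \<comment> \<open>the value does not depend on the chosen \<open>t\<close>, since \<open>\<gamma>\<close> is constant where its length function is\<close>
  "arclength_param \<gamma> s = \<gamma> (SOME t. t \<in> {0..1} \<and> curve_length \<gamma> t = ennreal s)"

definition curve_integral :: "(real \<Rightarrow> 'a::metric_space) \<Rightarrow> ('a \<Rightarrow> ennreal) \<Rightarrow> ennreal" where
  "curve_integral \<gamma> g = (\<integral>\<^sup>+s\<in>{0..enn2real (curve_length \<gamma> 1)}. g (arclength_param \<gamma> s) \<partial>lborel)"

definition enn_powr :: "ennreal \<Rightarrow> real \<Rightarrow> ennreal" where
  \<comment> \<open>used for positive exponents only\<close>
  "enn_powr x a = (if x = \<infinity> then \<infinity> else ennreal (enn2real x powr a))"

definition modulus :: "'a::metric_space measure \<Rightarrow> real \<Rightarrow> (real \<Rightarrow> 'a) set \<Rightarrow> ennreal" where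
  \<comment> \<open>for curves in an open set \<open>U\<close>, this equals the modulus computed in \<open>U\<close> with the induced measure\<close>
  "modulus M p \<Gamma> =
     (INF \<eta> \<in> {\<eta>. \<eta> \<in> borel_measurable borel \<and>
                  (\<forall>\<gamma>\<in>\<Gamma>. rectifiable_curve UNIV \<gamma> \<longrightarrow> 1 \<le> curve_integral \<gamma> \<eta>)}.
        \<integral>\<^sup>+x. enn_powr (\<eta> x) p \<partial>M)"


section \<open>Upper gradients and Sobolev spaces\<close>

definition Lp_norm :: "'a::metric_space measure \<Rightarrow> real \<Rightarrow> 'a set \<Rightarrow> ('a \<Rightarrow> ennreal) \<Rightarrow> ennreal" where
  "Lp_norm M p U g = enn_powr (\<integral>\<^sup>+x\<in>U. enn_powr (g x) p \<partial>completion M) (1 / p)"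

definition upper_gradient_ineq :: "('a::metric_space \<Rightarrow> real) \<Rightarrow> ('a \<Rightarrow> ennreal) \<Rightarrow> (real \<Rightarrow> 'a) \<Rightarrow> bool" where
  "upper_gradient_ineq f g \<gamma> \<longleftrightarrow>
     ennreal \<bar>f (pathstart \<gamma>) - f (pathfinish \<gamma>)\<bar> \<le> curve_integral \<gamma> g"

definition upper_gradient :: "'a::metric_space set \<Rightarrow> ('a \<Rightarrow> real) \<Rightarrow> ('a \<Rightarrow> ennreal) \<Rightarrow> bool" where
  "upper_gradient U f g \<longleftrightarrow>
     g \<in> borel_measurable (restrict_space borel U) \<and>
     (\<forall>\<gamma>. rectifiable_curve U \<gamma> \<longrightarrow> upper_gradient_ineq f g \<gamma>)"

definition weak_upper_gradient ::
  "'a::metric_space measure \<Rightarrow> real \<Rightarrow> 'a set \<Rightarrow> ('a \<Rightarrow> real) \<Rightarrow> ('a \<Rightarrow> ennreal) \<Rightarrow> bool" where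
  "weak_upper_gradient M p U f g \<longleftrightarrow>
     g \<in> borel_measurable (restrict_space borel U) \<and>
     (\<exists>\<Gamma>. modulus M p \<Gamma> = 0 \<and>
        (\<forall>\<gamma>. rectifiable_curve U \<gamma> \<longrightarrow> \<gamma> \<notin> \<Gamma> \<longrightarrow> upper_gradient_ineq f g \<gamma>))"

definition Lp_weak_upper_gradient ::
  "'a::metric_space measure \<Rightarrow> real \<Rightarrow> 'a set \<Rightarrow> ('a \<Rightarrow> real) \<Rightarrow> ('a \<Rightarrow> ennreal) \<Rightarrow> bool" where
  "Lp_weak_upper_gradient M p U f g \<longleftrightarrow> weak_upper_gradient M p U f g \<and> Lp_norm M p U g < \<infinity>"

definition minimal_weak_upper_gradient ::
  "'a::metric_space measure \<Rightarrow> real \<Rightarrow> 'a set \<Rightarrow> ('a \<Rightarrow> real) \<Rightarrow> ('a \<Rightarrow> ennreal) \<Rightarrow> bool" where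
  "minimal_weak_upper_gradient M p U f g \<longleftrightarrow>
     Lp_weak_upper_gradient M p U f g \<and>
     (\<forall>h. Lp_weak_upper_gradient M p U f h \<longrightarrow> (AE x in M. x \<in> U \<longrightarrow> g x \<le> h x))"

definition grad_min ::
  "'a::metric_space measure \<Rightarrow> real \<Rightarrow> 'a set \<Rightarrow> ('a \<Rightarrow> real) \<Rightarrow> 'a \<Rightarrow> ennreal" where
  "grad_min M p U f = (SOME g. minimal_weak_upper_gradient M p U f g)"

definition locally_L1 :: "'a::metric_space measure \<Rightarrow> 'a set \<Rightarrow> ('a \<Rightarrow> real) \<Rightarrow> bool" where
  "locally_L1 M U f \<longleftrightarrow> (\<forall>K. compact K \<longrightarrow> K \<subseteq> U \<longrightarrow> set_integrable (completion M) K f)"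

definition Sobolev_N :: "'a::metric_space measure \<Rightarrow> real \<Rightarrow> 'a set \<Rightarrow> ('a \<Rightarrow> real) set" where
  "Sobolev_N M p U =
     {f. f \<in> borel_measurable (restrict_space (completion M) U) \<and>
         Lp_norm M p U (\<lambda>x. ennreal \<bar>f x\<bar>) < \<infinity> \<and>
         (\<exists>g. Lp_weak_upper_gradient M p U f g)}"

text \<open>The elements are the pointwise defined representatives: having a \<open>p\<close>-weak upper gradient in
  \<open>L\<^sup>p\<close> is not an invariant of the class of \<open>f\<close> up to null sets, but it is unaffected by
  changes on sets of \<open>p\<close>-capacity zero, since almost no curve meets such a set.\<close>

definition Sobolev_S :: "'a::metric_space measure \<Rightarrow> real \<Rightarrow> 'a set \<Rightarrow> ('a \<Rightarrow> real) set" where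
  "Sobolev_S M p U =
     {f. f \<in> borel_measurable (restrict_space (completion M) U) \<and>
         locally_L1 M U f \<and>
         (\<exists>g. Lp_weak_upper_gradient M p U f g)}"

definition S_norm :: "'a::metric_space measure \<Rightarrow> real \<Rightarrow> 'a set \<Rightarrow> ('a \<Rightarrow> real) \<Rightarrow> ennreal" where
  "S_norm M p U f = Lp_norm M p U (grad_min M p U f)"

definition mean_value :: "'a::metric_space measure \<Rightarrow> 'a set \<Rightarrow> ('a \<Rightarrow> real) \<Rightarrow> real" where
  "mean_value M B f = (LINT x:B|completion M. f x) / measure M B"

definition weak_Poincare :: "'a::metric_space measure \<Rightarrow> real \<Rightarrow> bool" where
  "weak_Poincare M p \<longleftrightarrow>
     (\<exists>\<sigma>>1. \<exists>C>0. \<forall>x r f g. 0 < r \<longrightarrow>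
        set_integrable (completion M) (ball x (\<sigma> * r)) f \<longrightarrow>
        weak_upper_gradient M p (ball x (\<sigma> * r)) f g \<longrightarrow>
        (\<integral>\<^sup>+y\<in>ball x r. ennreal \<bar>f y - mean_value M (ball x r) f\<bar> \<partial>completion M)
            / emeasure M (ball x r)
          \<le> ennreal (C * diameter (ball x r)) *
             enn_powr ((\<integral>\<^sup>+y\<in>ball x (\<sigma> * r). enn_powr (g y) p \<partial>completion M)
                         / emeasure M (ball x (\<sigma> * r))) (1 / p))"


section \<open>Mappings\<close>

definition bi_measurable ::
  "'a::metric_space measure \<Rightarrow> 'a set \<Rightarrow> 'a set \<Rightarrow> ('a \<Rightarrow> 'a) \<Rightarrow> bool" where
  "bi_measurable M U V \<phi> \<longleftrightarrow>
     (\<forall>E. E \<subseteq> U \<longrightarrow> E \<in> null_sets (completion M) \<longrightarrow> \<phi> ` E \<in> null_sets (completion M)) \<and>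
     (\<forall>E. E \<subseteq> V \<longrightarrow> E \<in> null_sets (completion M) \<longrightarrow> \<phi> -` E \<inter> U \<in> null_sets (completion M))"

definition bounded_composition_operator ::
  "'a::metric_space measure \<Rightarrow> real \<Rightarrow> 'a set \<Rightarrow> 'a set \<Rightarrow> ('a \<Rightarrow> 'a) \<Rightarrow> bool" where
  "bounded_composition_operator M p \<Omega> \<Omega>' \<phi> \<longleftrightarrow>
     (\<forall>f\<in>Sobolev_S M p \<Omega>'. f \<circ> \<phi> \<in> Sobolev_S M p \<Omega>) \<and>
     (\<exists>C::real\<ge>0. \<forall>f\<in>Sobolev_S M p \<Omega>'. S_norm M p \<Omega> (f \<circ> \<phi>) \<le> ennreal C * S_norm M p \<Omega>' f)"

definition RS_class ::
  "'a::metric_space measure \<Rightarrow> real \<Rightarrow> 'a set \<Rightarrow> 'a set \<Rightarrow> ('a \<Rightarrow> 'a) set" where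
  "RS_class M p U \<Omega>' =
     {\<phi>. \<phi> ` U \<subseteq> \<Omega>' \<and> bi_measurable M U \<Omega>' \<phi> \<and>
         (\<forall>z\<in>\<Omega>'. (\<lambda>x. dist (\<phi> x) z) \<in> Sobolev_N M p U) \<and>
         (\<exists>g. Lp_norm M p U g < \<infinity> \<and> (\<forall>z\<in>\<Omega>'. upper_gradient U (\<lambda>x. dist (\<phi> x) z) g))}"

definition compactly_inside :: "'a::metric_space set \<Rightarrow> 'a set \<Rightarrow> bool" where
  "compactly_inside U \<Omega> \<longleftrightarrow> open U \<and> bounded U \<and> closure U \<subseteq> \<Omega>"

definition RS_class_loc ::
  "'a::metric_space measure \<Rightarrow> real \<Rightarrow> 'a set \<Rightarrow> 'a set \<Rightarrow> ('a \<Rightarrow> 'a) set" where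
  "RS_class_loc M p \<Omega> \<Omega>' = {\<phi>. \<forall>U. compactly_inside U \<Omega> \<longrightarrow> \<phi> \<in> RS_class M p U \<Omega>'}"

definition Lp_map_upper_gradient ::
  "'a::metric_space measure \<Rightarrow> real \<Rightarrow> 'a set \<Rightarrow> 'a set \<Rightarrow> ('a \<Rightarrow> 'a) \<Rightarrow> ('a \<Rightarrow> ennreal) \<Rightarrow> bool" where
  "Lp_map_upper_gradient M p U \<Omega>' \<phi> g \<longleftrightarrow>
     Lp_norm M p U g < \<infinity> \<and> (\<forall>z\<in>\<Omega>'. weak_upper_gradient M p U (\<lambda>x. dist (\<phi> x) z) g)"

definition minimal_map_upper_gradient ::
  "'a::metric_space measure \<Rightarrow> real \<Rightarrow> 'a set \<Rightarrow> 'a set \<Rightarrow> ('a \<Rightarrow> 'a) \<Rightarrow> ('a \<Rightarrow> ennreal) \<Rightarrow> bool" where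
  "minimal_map_upper_gradient M p U \<Omega>' \<phi> g \<longleftrightarrow>
     Lp_map_upper_gradient M p U \<Omega>' \<phi> g \<and>
     (\<forall>h. Lp_map_upper_gradient M p U \<Omega>' \<phi> h \<longrightarrow> Lp_norm M p U g \<le> Lp_norm M p U h)"

text \<open>For \<open>\<phi>\<close> in the local class, the minimal upper gradients on the sets \<open>U\<close> agree almost everywhere
  on overlaps; \<open>D_min\<close> is the function on \<open>\<Omega>\<close> that they define, unique up to null sets.\<close>

definition D_min ::
  "'a::metric_space measure \<Rightarrow> real \<Rightarrow> 'a set \<Rightarrow> 'a set \<Rightarrow> ('a \<Rightarrow> 'a) \<Rightarrow> 'a \<Rightarrow> ennreal" where
  "D_min M p \<Omega> \<Omega>' \<phi> =
     (SOME g. \<forall>U. compactly_inside U \<Omega> \<longrightarrow> minimal_map_upper_gradient M p U \<Omega>' \<phi> g)"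

definition metric_Jacobian :: "'a::metric_space measure \<Rightarrow> ('a \<Rightarrow> 'a) \<Rightarrow> 'a \<Rightarrow> ennreal" where
  \<comment> \<open>for \<open>x\<close> in the open set \<open>\<Omega>\<close>, the limit only involves the values of \<open>\<phi>\<close> on \<open>\<Omega>\<close>\<close>
  "metric_Jacobian M \<phi> x =
     Lim (at_right 0) (\<lambda>r. emeasure M (\<phi> ` ball x r) / emeasure M (ball x r))"

definition K_dilatation ::
  "'a::metric_space measure \<Rightarrow> real \<Rightarrow> 'a set \<Rightarrow> 'a set \<Rightarrow> ('a \<Rightarrow> 'a) \<Rightarrow> 'a \<Rightarrow> ennreal" where
  "K_dilatation M p \<Omega> \<Omega>' \<phi> x =
     enn_powr (enn_powr (D_min M p \<Omega> \<Omega>' \<phi> x) p / metric_Jacobian M \<phi> x) (1 / p)"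

definition K_global ::
  "'a::metric_space measure \<Rightarrow> real \<Rightarrow> 'a set \<Rightarrow> 'a set \<Rightarrow> ('a \<Rightarrow> 'a) \<Rightarrow> ennreal" where
  "K_global M p \<Omega> \<Omega>' \<phi> = esssup (restrict_space (completion M) \<Omega>) (K_dilatation M p \<Omega> \<Omega>' \<phi>)"

end

theory Submission
  imports Defs
begin

text \<open>
  Write \<open>\<nu>(E) = \<mu>(\<phi>(E))\<close>. By Luzin's condition \<open>\<nu>\<close> has a density \<open>J\<close> with respect to \<open>\<mu>\<close>, and by
  the differentiation theorem for doubling measures (\<open>Lebesgue_differentiation\<close>) this density is the
  metric Jacobian. So the condition on \<open>K_p\<close> says that \<open>|D_min \<phi>|\<^sup>p \<le> K\<^sup>p J\<close> almost everywhere, and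
  \<open>\<integral>\<^sub>\<Omega> (h \<circ> \<phi>) J = \<integral>\<^sub>\<Omega>\<^sub>' h\<close>.

  Suppose that \<open>|D_min \<phi>|\<^sup>p \<le> K\<^sup>p J\<close>. Distances to a countable dense set of points control \<open>\<phi>\<close> along almost
  every curve: the length of \<open>\<phi> \<circ> \<gamma>\<close> is bounded by the integral of \<open>|D_min \<phi>|\<close> along \<open>\<gamma>\<close>, on every
  piece of \<open>\<gamma>\<close>. Hence an upper gradient \<open>g\<close> of \<open>f\<close> yields the upper gradient \<open>(g \<circ> \<phi>) |D_min \<phi>|\<close> of
  \<open>f \<circ> \<phi>\<close> (\<open>weak_upper_gradient_comp\<close>), and the change of variables bounds its norm by \<open>K\<close> times
  that of \<open>g\<close>. The same computation pulls back functions whose line integral is infinite on an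
  exceptional family, so that exceptional families in \<open>\<Omega>'\<close> do no harm. The Poincare inequality
  serves to show that \<open>f \<circ> \<phi>\<close> is locally integrable (\<open>locally_L1_if_Poincare\<close>).

  Conversely, let \<open>\<phi>\<close> generate a bounded operator, let \<open>z \<in> \<Omega>'\<close> and let \<open>G\<close> be the minimal upper
  gradient of \<open>v = \<rho>(\<phi>(\<cdot>), z)\<close>, which is the composition of \<open>\<phi>\<close> with a Lipschitz function. To
  localise the norm estimate near a closed set \<open>F\<close>, compose \<open>\<phi>\<close> with the functions
  \<open>e (1 + sin (\<rho>(\<cdot>, z) / e))\<close> and \<open>e (1 + cos (\<rho>(\<cdot>, z) / e))\<close>, cut off outside the \<open>4e\<close>-neighbourhood
  of \<open>F\<close>. Because these functions are of size \<open>e\<close>, the cut-off leaves them 1-Lipschitz and unchanged near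
  \<open>F\<close>, and their energies are at most the volume of the neighbourhood. Because sine and cosine
  together separate nearby values, the upper gradients of the two compositions bound \<open>G\<close> on the
  preimage of \<open>F\<close>. Letting \<open>e\<close> tend to 0 gives \<open>\<integral> G\<^sup>p \<le> C \<mu>(F)\<close> over the preimage of \<open>F\<close>
  (\<open>grad_distance_le_Jacobian\<close>), and by regularity \<open>G\<^sup>p \<le> C J\<close> almost everywhere. The bound is the
  same for all \<open>z\<close>, so \<open>(C J)\<^sup>1\<^sup>/\<^sup>p\<close> is an upper gradient of \<open>\<phi>\<close> and dominates \<open>|D_min \<phi>|\<close>.

  Curves are treated by one device. The length function of a rectifiable curve \<open>\<gamma>\<close> is continuous and
  defines a Stieltjes measure \<open>\<mu>\<^sub>\<gamma>\<close> on the parameter line, for which the line integral of \<open>g\<close> is the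
  integral of \<open>g \<circ> \<gamma>\<close> (\<open>curve_integral_eq\<close>). Length is the least function controlling the
  increments; so a measure bounding the increments of a curve on intervals bounds \<open>\<mu>\<^sub>\<gamma>\<close> on all Borel
  sets (\<open>curve_measure_le\<close>). This principle yields subcurves, images of curves, and the gluing of upper
  gradients (\<open>controlled_glue\<close>), from which the existence of minimal upper gradients follows by
  monotone convergence (\<open>ex_least_ug\<close>).
\<close>

section \<open>Powers of extended nonnegative reals\<close>

lemma enn_powr_0 [simp]: "enn_powr 0 a = 0"
  by (simp add: enn_powr_def)

lemma enn_powr_top [simp]: "enn_powr \<top> a = \<top>"
  by (simp add: enn_powr_def)

lemma enn_powr_1 [simp]: "enn_powr 1 a = 1"
  by (simp add: enn_powr_def)

lemma enn_powr_ennreal: "0 \<le> x \<Longrightarrow> enn_powr (ennreal x) a = ennreal (x powr a)"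
  by (simp add: enn_powr_def)

lemma enn_powr_mono:
  assumes "0 \<le> a" "x \<le> y" shows "enn_powr x a \<le> enn_powr y a"
proof (cases "y = \<top>")
  case False
  then have "x \<noteq> \<top>" using \<open>x \<le> y\<close> by (auto simp: top_unique)
  moreover have "enn2real x \<le> enn2real y"
    using False \<open>x \<le> y\<close> by (intro enn2real_mono) (auto simp: less_top)
  ultimately show ?thesis
    using False assms by (simp add: enn_powr_def ennreal_leI powr_mono2)
qed simp

lemma enn_powr_mult: "enn_powr (x * y) a = enn_powr x a * enn_powr y a"
proof (cases "x = \<top> \<or> y = \<top>")
  case True
  have eq0: "enn_powr u a = 0 \<longleftrightarrow> u = 0" for u
    by (cases u) (simp_all add: enn_powr_def ennreal_eq_0_iff)
  from True show ?thesis
    by (cases "x = 0"; cases "y = 0") (auto simp: ennreal_top_mult ennreal_mult_top eq0)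
next
  case False
  then have "x * y \<noteq> \<top>" by (simp add: ennreal_mult_eq_top_iff)
  then show ?thesis using False
    by (simp add: enn_powr_def enn2real_mult powr_mult ennreal_mult)
qed

lemma enn_powr_inverse: "0 < a \<Longrightarrow> enn_powr (enn_powr x a) (1 / a) = x"
  by (cases x) (auto simp: enn_powr_ennreal powr_powr)

lemma enn_powr_inverse': "0 < a \<Longrightarrow> enn_powr (enn_powr x (1 / a)) a = x"
  by (cases x) (auto simp: enn_powr_ennreal powr_powr)

lemma enn_powr_eq_top_iff [simp]: "enn_powr x a = \<top> \<longleftrightarrow> x = \<top>"
  by (cases x) (auto simp: enn_powr_ennreal)

lemma enn_powr_less_top_iff [simp]: "enn_powr x a < \<top> \<longleftrightarrow> x < \<top>"
  using enn_powr_eq_top_iff[of x a] by (simp only: less_top[symmetric])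

lemma enn_powr_le_iff: "0 < a \<Longrightarrow> enn_powr x a \<le> enn_powr y a \<longleftrightarrow> x \<le> y"
  using enn_powr_mono[of a x y] enn_powr_mono[of "1 / a" "enn_powr x a" "enn_powr y a"]
  by (auto simp: enn_powr_inverse)

lemma enn_powr_le_iff_root: "0 < a \<Longrightarrow> enn_powr x a \<le> y \<longleftrightarrow> x \<le> enn_powr y (1 / a)"
  using enn_powr_le_iff[of a x "enn_powr y (1 / a)"] by (simp add: enn_powr_inverse')

lemma enn_powr_SUP:
  assumes "0 < a" shows "enn_powr (SUP i\<in>I. f i) a = (SUP i\<in>I. enn_powr (f i) a)"
proof (rule antisym)
  show "enn_powr (SUP i\<in>I. f i) a \<le> (SUP i\<in>I. enn_powr (f i) a)"
    unfolding enn_powr_le_iff_root[OF assms]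
  proof (rule SUP_least)
    fix i assume "i \<in> I"
    then have "enn_powr (f i) a \<le> (SUP i\<in>I. enn_powr (f i) a)" by (rule SUP_upper)
    then show "f i \<le> enn_powr (SUP i\<in>I. enn_powr (f i) a) (1 / a)"
      by (simp only: enn_powr_le_iff_root[OF assms])
  qed
  show "(SUP i\<in>I. enn_powr (f i) a) \<le> enn_powr (SUP i\<in>I. f i) a"
    using assms by (intro SUP_least enn_powr_mono SUP_upper) auto
qed

lemma enn_powr_max: "0 < a \<Longrightarrow> enn_powr (max x y) a = max (enn_powr x a) (enn_powr y a)"
  by (simp add: max_def enn_powr_le_iff)

lemma enn_powr_indicator [simp]: "enn_powr (indicator A x) a = indicator A x"
  by (simp add: indicator_def)

lemma measurable_enn_powr [measurable (raw)]:
  "f \<in> borel_measurable N \<Longrightarrow> (\<lambda>x. enn_powr (f x) a) \<in> borel_measurable N"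
  unfolding enn_powr_def infinity_ennreal_def by simp

section \<open>The length function of a curve\<close>

text \<open>The length function controls the increments of the curve (\<open>curve_length_increment\<close>), and it is the
  smallest function that does so (\<open>curve_length_least\<close>). These two properties take the place of
  manipulations of partitions: continuity and all comparisons of lengths are derived from them.\<close>

lemma curve_length_mono: "s \<le> t \<Longrightarrow> curve_length c s \<le> curve_length c t"
  unfolding curve_length_def by (rule SUP_subset_mono) auto

lemma curve_length_increment:
  assumes "0 \<le> s" "s \<le> t"
  shows "ennreal (dist (c s) (c t)) + curve_length c s \<le> curve_length c t"
proof -
  define S where "S xs = (\<Sum>i<length xs - 1. ennreal (dist (c (xs ! i)) (c (xs ! Suc i))))" for xs
  have "ennreal (dist (c s) (c t)) + S xs \<le> curve_length c t"
    if xs: "sorted xs" "set xs \<subseteq> {0..s}" for xs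
  proof -
    let ?ys = "xs @ [s, t]" and ?d = "\<lambda>ys i. ennreal (dist (c (ys ! i)) (c (ys ! Suc i)))"
    have "S xs = (\<Sum>i<length xs - 1. ?d ?ys i)"
      unfolding S_def by (rule sum.cong) (auto simp: nth_append)
    moreover have "ennreal (dist (c s) (c t)) = ?d ?ys (length xs)"
      by (simp add: nth_append)
    ultimately have "ennreal (dist (c s) (c t)) + S xs = (\<Sum>i\<in>insert (length xs) {..<length xs - 1}. ?d ?ys i)"
      by (simp add: sum.insert del: sum_ennreal)
    also have "\<dots> \<le> S ?ys"
      unfolding S_def by (rule sum_mono2) auto
    also have "\<dots> \<le> curve_length c t"
      unfolding curve_length_def S_def using xs assms
      by (intro SUP_upper) (auto simp: sorted_append)
    finally show ?thesis .
  qed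
  moreover have "ennreal (dist (c s) (c t)) + curve_length c s =
      (SUP xs\<in>{xs. sorted xs \<and> set xs \<subseteq> {0..s}}. ennreal (dist (c s) (c t)) + S xs)"
    unfolding curve_length_def S_def
    by (rule ennreal_SUP_add_right) (auto intro: exI[of _ "[]"])
  ultimately show ?thesis
    by (auto intro!: SUP_least)
qed

lemma curve_length_0 [simp]: "curve_length c 0 = 0"
proof -
  have "ennreal (dist (c (xs ! i)) (c (xs ! Suc i))) = 0"
    if "set xs \<subseteq> {0..0}" "i < length xs - 1" for xs and i :: nat
  proof -
    have "xs ! i \<in> set xs" "xs ! Suc i \<in> set xs" using that(2) by (auto intro!: nth_mem)
    then have "xs ! i = 0" "xs ! Suc i = 0" using that(1) by force+
    then show ?thesis by simp
  qed
  then show ?thesis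
    unfolding curve_length_def by (intro antisym SUP_least) (auto simp: sum.neutral)
qed

lemma curve_length_least:
  fixes G :: "real \<Rightarrow> ennreal"
  assumes G: "\<And>a b. 0 \<le> a \<Longrightarrow> a \<le> b \<Longrightarrow> b \<le> t \<Longrightarrow> ennreal (dist (c a) (c b)) + G a \<le> G b"
    and t: "0 \<le> t"
  shows "curve_length c t + G 0 \<le> G t"
proof -
  have mono: "G a \<le> G b" if "0 \<le> a" "a \<le> b" "b \<le> t" for a b
  proof -
    have "G a \<le> ennreal (dist (c a) (c b)) + G a" by simp
    also note G[OF that]
    finally show ?thesis .
  qed
  have "(\<Sum>i<length xs - 1. ennreal (dist (c (xs ! i)) (c (xs ! Suc i)))) + G 0 \<le> G t"
    if xs: "sorted xs" "set xs \<subseteq> {0..t}" for xs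
  proof (cases "xs = []")
    case True then show ?thesis using mono[of 0 t] t by simp
  next
    case False
    have "(\<Sum>i<n. ennreal (dist (c (xs ! i)) (c (xs ! Suc i)))) + G 0 \<le> G (xs ! n)"
      if "n < length xs" for n
      using that
    proof (induction n)
      case 0
      then have "xs ! 0 \<in> set xs" by simp
      then show ?case using mono[of 0 "xs ! 0"] xs by auto
    next
      case (Suc n)
      have in_set: "xs ! n \<in> set xs" "xs ! Suc n \<in> set xs" using Suc.prems by (auto intro!: nth_mem)
      have "xs ! n \<le> xs ! Suc n" using xs(1) Suc.prems by (simp add: sorted_nth_mono)
      then have "ennreal (dist (c (xs ! n)) (c (xs ! Suc n))) + G (xs ! n) \<le> G (xs ! Suc n)"
        using in_set xs(2) by (intro G) auto
      moreover have "(\<Sum>i<Suc n. ennreal (dist (c (xs ! i)) (c (xs ! Suc i)))) + G 0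
          = ennreal (dist (c (xs ! n)) (c (xs ! Suc n)))
            + ((\<Sum>i<n. ennreal (dist (c (xs ! i)) (c (xs ! Suc i)))) + G 0)"
        by (simp add: ac_simps del: sum_ennreal)
      moreover have "\<dots> \<le> ennreal (dist (c (xs ! n)) (c (xs ! Suc n))) + G (xs ! n)"
        using Suc by (intro add_left_mono) simp
      ultimately show ?case by order
    qed
    from this[of "length xs - 1"] False
    have "(\<Sum>i<length xs - 1. ennreal (dist (c (xs ! i)) (c (xs ! Suc i)))) + G 0 \<le> G (xs ! (length xs - 1))"
      by simp
    also have "\<dots> \<le> G t"
    proof (rule mono)
      have "xs ! (length xs - 1) \<in> set xs" using False by (auto intro!: nth_mem)
      then show "0 \<le> xs ! (length xs - 1)" "xs ! (length xs - 1) \<le> t" using xs(2) by auto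
    qed simp
    finally show ?thesis .
  qed
  moreover have "curve_length c t + G 0 = (SUP xs\<in>{xs. sorted xs \<and> set xs \<subseteq> {0..t}}.
      (\<Sum>i<length xs - 1. ennreal (dist (c (xs ! i)) (c (xs ! Suc i)))) + G 0)"
    unfolding curve_length_def
    by (rule ennreal_SUP_add_left[symmetric]) (auto intro: exI[of _ "[]"])
  ultimately show ?thesis by (auto intro!: SUP_least)
qed

text \<open>Splicing the length function before \<open>s\<close> with a control function after \<open>s\<close> controls the whole
  curve; this localises minimality and contains the additivity of length.\<close>

lemma curve_length_least_from:
  fixes G :: "real \<Rightarrow> ennreal"
  assumes G: "\<And>a b. s \<le> a \<Longrightarrow> a \<le> b \<Longrightarrow> b \<le> t \<Longrightarrow> ennreal (dist (c a) (c b)) + G a \<le> G b"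
    and st: "0 \<le> s" "s \<le> t"
  shows "curve_length c t + G s \<le> curve_length c s + G t"
proof -
  define H where "H x = (if x \<le> s then curve_length c x + G s else curve_length c s + G x)" for x
  have "curve_length c t + H 0 \<le> H t"
  proof (rule curve_length_least)
    fix a b assume ab: "0 \<le> a" "a \<le> b" "b \<le> t"
    consider "b \<le> s" | "a \<le> s" "s < b" | "s < a" using ab by linarith
    then show "ennreal (dist (c a) (c b)) + H a \<le> H b"
    proof cases
      case 1
      then show ?thesis using add_right_mono[OF curve_length_increment[of a b c], of "G s"] ab
        by (simp add: H_def ac_simps)
    next
      case 2
      have "ennreal (dist (c a) (c b)) \<le> ennreal (dist (c a) (c s)) + ennreal (dist (c s) (c b))"
        by (simp add: dist_triangle flip: ennreal_plus)
      then have "ennreal (dist (c a) (c b)) + H a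
        \<le> (ennreal (dist (c a) (c s)) + curve_length c a) + (ennreal (dist (c s) (c b)) + G s)"
        using 2 add_right_mono[of "ennreal (dist (c a) (c b))" _ "curve_length c a + G s"]
        by (simp add: H_def ac_simps)
      also have "\<dots> \<le> curve_length c s + G b"
        using 2 ab by (intro add_mono curve_length_increment G) auto
      finally show ?thesis using 2 by (simp add: H_def)
    next
      case 3
      then show ?thesis using add_left_mono[OF G[of a b], of "curve_length c s"] ab
        by (simp add: H_def ac_simps)
    qed
  qed (use st in auto)
  moreover have "H 0 = G s" using st by (simp add: H_def)
  moreover have "H t = curve_length c s + G t"
    using st by (cases "t = s") (auto simp: H_def)
  ultimately show ?thesis by simp
qed

text \<open>Curves are defined by their values on \<open>[0,1]\<close>; composed with the following projection they become
  continuous on the whole line.\<close>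

definition unit_clamp :: "real \<Rightarrow> real" where
  "unit_clamp t = max 0 (min 1 t)"

lemma unit_clamp_simps [simp]:
  "0 \<le> unit_clamp t" "unit_clamp t \<le> 1" "0 \<le> t \<Longrightarrow> t \<le> 1 \<Longrightarrow> unit_clamp t = t"
  "unit_clamp 0 = 0" "unit_clamp 1 = 1"
  by (auto simp: unit_clamp_def)

lemma unit_clamp_mono: "s \<le> t \<Longrightarrow> unit_clamp s \<le> unit_clamp t"
  by (auto simp: unit_clamp_def)

lemma continuous_on_unit_clamp: "path c \<Longrightarrow> continuous_on UNIV (\<lambda>t. c (unit_clamp t))"
  unfolding path_def
  by (rule continuous_on_compose2[of "{0..1}" c]) (auto simp: unit_clamp_def intro!: continuous_intros)

definition arc_length :: "(real \<Rightarrow> 'a::metric_space) \<Rightarrow> real \<Rightarrow> real" where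
  "arc_length c t = enn2real (curve_length c (unit_clamp t))"

definition rectifiable :: "(real \<Rightarrow> 'a::metric_space) \<Rightarrow> bool" where
  "rectifiable c \<longleftrightarrow> path c \<and> curve_length c 1 < \<infinity>"

lemma rectifiable_curve_iff: "rectifiable_curve U c \<longleftrightarrow> rectifiable c \<and> path_image c \<subseteq> U"
  by (auto simp: rectifiable_curve_def rectifiable_def)

context
  fixes c :: "real \<Rightarrow> 'a::metric_space"
  assumes c: "rectifiable c"
begin

lemma ennreal_arc_length: "ennreal (arc_length c t) = curve_length c (unit_clamp t)"
proof -
  have "curve_length c (unit_clamp t) \<le> curve_length c 1" by (rule curve_length_mono) simp
  then show ?thesis
    using c unfolding arc_length_def rectifiable_def by (simp add: order_le_less_trans)
qed

lemma arc_length_nonneg: "0 \<le> arc_length c t"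
  by (simp add: arc_length_def)

lemma arc_length_mono: "s \<le> t \<Longrightarrow> arc_length c s \<le> arc_length c t"
  using ennreal_arc_length arc_length_nonneg curve_length_mono[OF unit_clamp_mono, of s t c]
  by (metis ennreal_le_iff)

lemma dist_le_arc_length:
  assumes "0 \<le> a" "a \<le> b" "b \<le> 1"
  shows "dist (c a) (c b) \<le> arc_length c b - arc_length c a"
proof -
  have "ennreal (dist (c a) (c b) + arc_length c a) \<le> ennreal (arc_length c b)"
    using curve_length_increment[of a b c] assms ennreal_arc_length[of a] ennreal_arc_length[of b]
    by (simp add: arc_length_nonneg)
  then show ?thesis using arc_length_nonneg[of b] by (simp add: ennreal_le_iff del: ennreal_plus)
qed

lemma dist_le_arc_length_abs:
  assumes "a \<in> {0..1}" "b \<in> {0..1}"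
  shows "dist (c a) (c b) \<le> \<bar>arc_length c b - arc_length c a\<bar>"
  using dist_le_arc_length[of a b] dist_le_arc_length[of b a] assms
  by (cases "a \<le> b") (auto simp: dist_commute)

lemma arc_length_least_from:
  assumes G: "\<And>a b. s \<le> a \<Longrightarrow> a \<le> b \<Longrightarrow> b \<le> t \<Longrightarrow> dist (c a) (c b) + G a \<le> G b"
    and st: "0 \<le> s" "s \<le> t" "t \<le> 1" and pos: "\<And>a. s \<le> a \<Longrightarrow> a \<le> t \<Longrightarrow> 0 \<le> G a"
  shows "arc_length c t - arc_length c s \<le> G t - G s"
proof -
  have "curve_length c t + ennreal (G s) \<le> curve_length c s + ennreal (G t)"
    using G pos st by (intro curve_length_least_from) (auto simp flip: ennreal_plus)
  then have "ennreal (arc_length c t + G s) \<le> ennreal (arc_length c s + G t)"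
    using st pos ennreal_arc_length[of s] ennreal_arc_length[of t]
    by (simp add: arc_length_nonneg)
  moreover have "0 \<le> arc_length c s + G t" using arc_length_nonneg[of s] pos[of t] st by simp
  ultimately show ?thesis by (simp add: ennreal_le_iff del: ennreal_plus)
qed

text \<open>A jump of the length function at \<open>t\<close> could be cut down without losing control of the
  continuous curve, contradicting minimality.\<close>

lemma arc_length_continuous_right: "continuous (at_right t) (arc_length c)"
  unfolding continuous_at_right_real_increasing[of "arc_length c", OF arc_length_mono, simplified]
proof (intro allI impI, rule ccontr)
  fix e :: real assume e: "0 < e" and jump: "\<not> (\<exists>d>0. arc_length c (t + d) - arc_length c t < e)"
  have t01: "0 \<le> t" "t < 1"
  proof -
    show "0 \<le> t"
    proof (rule ccontr)
      assume "\<not> 0 \<le> t"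
      then have "arc_length c (t + -t/2) = arc_length c t" by (simp add: arc_length_def unit_clamp_def)
      then show False using jump e \<open>\<not> 0 \<le> t\<close> by (auto dest!: spec[of _ "-t/2"])
    qed
    show "t < 1"
    proof (rule ccontr)
      assume "\<not> t < 1"
      then have "arc_length c (t + 1) = arc_length c t" by (simp add: arc_length_def unit_clamp_def)
      then show False using jump e by (auto dest!: spec[of _ 1])
    qed
  qed
  have big: "arc_length c t + e \<le> arc_length c s" if "t < s" for s
    using jump that by (auto simp: not_less dest!: spec[of _ "s - t"])
  define G where "G x = (if x \<le> t then arc_length c t + e else arc_length c x)" for x
  have "arc_length c 1 - arc_length c t \<le> G 1 - G t"
  proof (rule arc_length_least_from)
    fix a b assume ab: "t \<le> a" "a \<le> b" "b \<le> 1"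
    consider "t < a" | "a = t" "t < b" | "a = t" "b = t" using ab by linarith
    then show "dist (c a) (c b) + G a \<le> G b"
    proof cases
      case 1 then show ?thesis using dist_le_arc_length[of a b] ab t01 by (simp add: G_def)
    next
      case 2
      have lim: "((\<lambda>s. dist (c (unit_clamp s)) (c b) + (arc_length c t + e)) \<longlongrightarrow>
          dist (c (unit_clamp t)) (c b) + (arc_length c t + e)) (at_right t)"
      proof -
        have "continuous_on UNIV (\<lambda>s. c (unit_clamp s))"
          using c by (intro continuous_on_unit_clamp) (simp add: rectifiable_def)
        then have "((\<lambda>s. c (unit_clamp s)) \<longlongrightarrow> c (unit_clamp t)) (at_right t)"
          by (auto simp: continuous_on_def intro: filterlim_mono[OF _ order_refl at_le])
        then show ?thesis by (intro tendsto_intros)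
      qed
      have "\<forall>\<^sub>F s in at_right t. dist (c (unit_clamp s)) (c b) + (arc_length c t + e) \<le> arc_length c b"
        using eventually_at_right_real[OF 2(2)]
      proof eventually_elim
        case (elim s)
        then have "dist (c s) (c b) \<le> arc_length c b - arc_length c s" "arc_length c t + e \<le> arc_length c s"
          using ab t01 by (auto intro!: dist_le_arc_length big)
        then show ?case using elim t01 ab by simp
      qed
      then have "dist (c (unit_clamp t)) (c b) + (arc_length c t + e) \<le> arc_length c b"
        by (rule tendsto_upperbound[OF lim]) simp
      then show ?thesis using 2 t01 by (simp add: G_def)
    qed (simp add: G_def)
  qed (use t01 e arc_length_nonneg in \<open>auto simp: G_def intro: add_nonneg_nonneg\<close>)
  then show False using t01 e by (simp add: G_def)
qed

lemma arc_length_continuous_left: "continuous (at_left t) (arc_length c)"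
  unfolding continuous_at_left_real_increasing[of "arc_length c", OF arc_length_mono, simplified]
proof (intro allI impI, rule ccontr)
  fix e :: real assume e: "0 < e" and jump: "\<not> (\<exists>d>0. arc_length c t - arc_length c (t - d) < e)"
  have t01: "0 < t" "t \<le> 1"
  proof -
    show "0 < t"
    proof (rule ccontr)
      assume "\<not> 0 < t"
      then have "arc_length c (t - 1) = arc_length c t" by (simp add: arc_length_def unit_clamp_def)
      then show False using jump e by (auto dest!: spec[of _ 1])
    qed
    show "t \<le> 1"
    proof (rule ccontr)
      assume "\<not> t \<le> 1"
      then have "arc_length c (t - (t - 1)) = arc_length c t" by (simp add: arc_length_def unit_clamp_def)
      then show False using jump e \<open>\<not> t \<le> 1\<close> by (auto dest!: spec[of _ "t - 1"])
    qed
  qed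
  have big: "arc_length c s \<le> arc_length c t - e" if "s < t" for s
    using jump that by (auto simp: not_less dest!: spec[of _ "t - s"])
  define G where "G x = (if x < t then arc_length c x else arc_length c t - e)" for x
  have "arc_length c t - arc_length c 0 \<le> G t - G 0"
  proof (rule arc_length_least_from)
    fix a b assume ab: "0 \<le> a" "a \<le> b" "b \<le> t"
    consider "b < t" | "a < t" "b = t" | "a = t" "b = t" using ab by linarith
    then show "dist (c a) (c b) + G a \<le> G b"
    proof cases
      case 1 then show ?thesis using dist_le_arc_length[of a b] ab t01 by (simp add: G_def)
    next
      case 2
      have lim: "((\<lambda>s. dist (c a) (c (unit_clamp s)) + arc_length c a) \<longlongrightarrow>
          dist (c a) (c (unit_clamp t)) + arc_length c a) (at_left t)"
      proof -
        have "continuous_on UNIV (\<lambda>s. c (unit_clamp s))"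
          using c by (intro continuous_on_unit_clamp) (simp add: rectifiable_def)
        then have "((\<lambda>s. c (unit_clamp s)) \<longlongrightarrow> c (unit_clamp t)) (at_left t)"
          by (auto simp: continuous_on_def intro: filterlim_mono[OF _ order_refl at_le])
        then show ?thesis by (intro tendsto_intros)
      qed
      have "\<forall>\<^sub>F s in at_left t. dist (c a) (c (unit_clamp s)) + arc_length c a \<le> arc_length c t - e"
        using eventually_at_left_real[OF 2(1)]
      proof eventually_elim
        case (elim s)
        then have "dist (c a) (c s) \<le> arc_length c s - arc_length c a" "arc_length c s \<le> arc_length c t - e"
          using ab t01 by (auto intro!: dist_le_arc_length big)
        then show ?case using elim t01 ab by simp
      qed
      then have "dist (c a) (c (unit_clamp t)) + arc_length c a \<le> arc_length c t - e"
        by (rule tendsto_upperbound[OF lim]) simp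
      then show ?thesis using 2 t01 by (simp add: G_def)
    qed (simp add: G_def)
  next
    fix a assume "0 \<le> a" "a \<le> t"
    then show "0 \<le> G a" using arc_length_nonneg[of a] arc_length_nonneg[of 0] big[of 0] t01 
      by (auto simp: G_def)
  qed (use t01 in auto)
  then show False using t01 e by (simp add: G_def)
qed

lemma continuous_on_arc_length: "continuous_on A (arc_length c)"
  by (rule continuous_at_imp_continuous_on)
     (simp add: continuous_at_split arc_length_continuous_left arc_length_continuous_right)

end

section \<open>Line integrals as integrals over the parameter\<close>

definition curve_measure :: "(real \<Rightarrow> 'a::metric_space) \<Rightarrow> real measure" where
  "curve_measure c = interval_measure (arc_length c)"

lemma sets_curve_measure [simp, measurable_cong]: "sets (curve_measure c) = sets borel"
  by (simp add: curve_measure_def)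

lemma space_curve_measure [simp]: "space (curve_measure c) = UNIV"
  by (simp add: curve_measure_def)

lemma emeasure_curve_measure_Ioc:
  assumes "rectifiable c" "a \<le> b"
  shows "emeasure (curve_measure c) {a<..b} = ennreal (arc_length c b - arc_length c a)"
  unfolding curve_measure_def using assms
  by (intro emeasure_interval_measure_Ioc arc_length_mono arc_length_continuous_right)

lemma arc_length_le_0: "t \<le> 0 \<Longrightarrow> arc_length c t = 0"
  by (simp add: arc_length_def unit_clamp_def)

lemma arc_length_gt_1: "1 < t \<Longrightarrow> arc_length c t = arc_length c 1"
  by (simp add: arc_length_def unit_clamp_def)

lemma emeasure_curve_measure_Ioi:
  assumes c: "rectifiable c"
  shows "emeasure (curve_measure c) {a<..} = ennreal (arc_length c 1 - arc_length c a)"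
proof -
  obtain m where m: "1 < m" "a \<le> m" by (rule that[of "max 2 a"]) auto
  have "(\<lambda>n::nat. emeasure (curve_measure c) {a<..m + real n}) \<longlonglongrightarrow>
      emeasure (curve_measure c) (\<Union>n. {a<..m + real n})"
    by (intro Lim_emeasure_incseq) (auto simp: incseq_def)
  moreover have "(\<Union>n. {a<..m + real n}) = {a<..}"
  proof (intro set_eqI iffI)
    fix x assume "x \<in> {a<..}"
    moreover obtain n :: nat where "x - m \<le> real n" by (rule real_arch_simple[of "x - m", THEN exE])
    ultimately have "x \<in> {a<..m + real n}" by simp
    then show "x \<in> (\<Union>n. {a<..m + real n})" by blast
  qed auto
  moreover have "emeasure (curve_measure c) {a<..m + real n} = ennreal (arc_length c 1 - arc_length c a)" for n
    using m by (subst emeasure_curve_measure_Ioc[OF c]) (simp_all add: arc_length_gt_1)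
  ultimately show ?thesis by (simp add: LIMSEQ_const_iff)
qed

lemma emeasure_curve_measure_UNIV:
  assumes c: "rectifiable c"
  shows "emeasure (curve_measure c) UNIV = ennreal (arc_length c 1)"
proof -
  have "(\<lambda>n::nat. emeasure (curve_measure c) {- real n<..}) \<longlonglongrightarrow>
      emeasure (curve_measure c) (\<Union>n. {- real n<..})"
    by (intro Lim_emeasure_incseq) (auto simp: incseq_def)
  moreover have "(\<Union>n. {- real n<..}) = UNIV"
  proof -
    have "\<exists>n::nat. - real n < x" for x
    proof -
      obtain n :: nat where "- x < real n" by (rule reals_Archimedean2[of "- x", THEN exE])
      then have "- real n < x" by simp
      then show ?thesis ..
    qed
    then show ?thesis by blast
  qed
  moreover have "emeasure (curve_measure c) {- real n<..} = ennreal (arc_length c 1)" for n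
    by (subst emeasure_curve_measure_Ioi[OF c]) (auto simp: arc_length_le_0)
  ultimately show ?thesis by (simp add: LIMSEQ_const_iff)
qed

lemma finite_measure_curve_measure: "rectifiable c \<Longrightarrow> finite_measure (curve_measure c)"
  by (rule finite_measureI) (simp add: emeasure_curve_measure_UNIV)

text \<open>Both sides are determined by half-lines \<open>{x<..}\<close>. Their preimages under the length function are
  half-lines again, since that function is continuous and monotone.\<close>

lemma distr_curve_measure:
  assumes c: "rectifiable c"
  shows "distr (curve_measure c) borel (arc_length c) = density lborel (indicator {0..arc_length c 1})"
proof (rule measure_eqI_lessThan)
  let ?L = "arc_length c"
  have cont: "continuous_on A ?L" for A using c by (rule continuous_on_arc_length)
  then have meas [measurable]: "?L \<in> borel_measurable borel" by (rule borel_measurable_continuous_onI)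
  have L: "0 \<le> ?L t" "?L t \<le> ?L 1" for t
    using c arc_length_gt_1[of t c] arc_length_mono[OF c, of t 1]
    by (simp_all add: arc_length_nonneg) (cases "t \<le> 1"; simp)
  show "emeasure (distr (curve_measure c) borel ?L) {x<..} = emeasure (density lborel (indicator {0..?L 1})) {x<..}" for x
  proof -
    have rhs: "emeasure (density lborel (indicator {0..?L 1})) {x<..} = ennreal (?L 1 - max x 0)"
    proof -
      have "emeasure (density lborel (indicator {0..?L 1})) {x<..} = emeasure lborel ({0..?L 1} \<inter> {x<..})"
        by (subst emeasure_density) (auto simp: indicator_inter_arith[symmetric])
      also have "\<dots> = ennreal (?L 1 - max x 0)"
      proof (cases "x < 0")
        case True
        then have "{0..?L 1} \<inter> {x<..} = {0..?L 1}" by auto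
        then show ?thesis using True L by simp
      next
        case False
        then have "{0..?L 1} \<inter> {x<..} = {x<..?L 1}" by auto
        then show ?thesis using False by (cases "x \<le> ?L 1") (auto simp: ennreal_neg)
      qed
      finally show ?thesis .
    qed
    have lhs: "emeasure (distr (curve_measure c) borel ?L) {x<..} = emeasure (curve_measure c) {t. x < ?L t}"
      by (subst emeasure_distr) (auto simp: vimage_def measurable_def)
    consider "x < 0" | "?L 1 \<le> x" | "0 \<le> x" "x < ?L 1" by linarith
    then show ?thesis
    proof cases
      case 1
      then have "{t. x < ?L t} = UNIV" using less_le_trans[OF 1 L(1)] by auto
      then show ?thesis using 1 c by (simp add: lhs rhs emeasure_curve_measure_UNIV)
    next
      case 2
      then have "{t. x < ?L t} = {}" using order_trans[OF L(2) 2] by (auto simp: not_less)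
      then show ?thesis using 2 L[of 1] by (simp add: lhs rhs ennreal_neg)
    next
      case 3
      \<comment> \<open>the last parameter at which the length is still \<open>x\<close>\<close>
      have "compact ({0..1} \<inter> ?L -` {..x})"
        by (rule compact_Int_closed) (auto intro!: closed_vimage continuous_at_imp_continuous_on cont
          simp: continuous_on_eq_continuous_within[symmetric])
      moreover have "0 \<in> {0..1} \<inter> ?L -` {..x}" using 3 by (simp add: arc_length_le_0)
      ultimately have "\<exists>t\<in>{0..1} \<inter> ?L -` {..x}. \<forall>s\<in>{0..1} \<inter> ?L -` {..x}. s \<le> t"
        using compact_attains_sup[of "{0..1} \<inter> ?L -` {..x}"] by blast
      then obtain t where t: "t \<in> {0..1}" "?L t \<le> x" "\<And>s. s \<in> {0..1} \<Longrightarrow> ?L s \<le> x \<Longrightarrow> s \<le> t"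
        by auto
      obtain s where s: "t \<le> s" "s \<le> 1" "?L s = x"
        using IVT'[of ?L t x 1] t 3 cont by auto
      then have "s = t" using t(3)[of s] t(1) by auto
      with s have Lt: "?L t = x" by simp
      have "{u. x < ?L u} = {t<..}"
      proof (intro set_eqI iffI; clarsimp)
        fix u assume "x < ?L u"
        then show "t < u" using Lt arc_length_mono[OF c, of u t] by (meson not_le order_less_irrefl order_less_le_trans)
      next
        fix u assume u: "t < u"
        show "x < ?L u"
        proof (cases "u \<le> 1")
          case True then show ?thesis using t(3)[of u] u t(1) by (cases "?L u \<le> x") auto
        next
          case False then show ?thesis using 3 by (simp add: arc_length_gt_1)
        qed
      qed
      then show ?thesis using 3 c Lt by (simp add: lhs rhs emeasure_curve_measure_Ioi)
    qed
  qed
  show "emeasure (distr (curve_measure c) borel ?L) {x<..} < \<infinity>" for x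
  proof -
    interpret finite_measure "curve_measure c" using c by (rule finite_measure_curve_measure)
    show ?thesis by (subst emeasure_distr) (auto simp: less_top[symmetric])
  qed
qed auto

lemma
  assumes c: "rectifiable c" and s: "s \<in> {0..arc_length c 1}"
  shows arclength_param_eq: "t \<in> {0..1} \<Longrightarrow> arc_length c t = s \<Longrightarrow> arclength_param c s = c t"
    and arclength_param_obtain: "\<exists>t\<in>{0..1}. arc_length c t = s \<and> arclength_param c s = c t"
proof -
  have iff: "curve_length c t = ennreal s \<longleftrightarrow> arc_length c t = s" if "t \<in> {0..1}" for t
    using ennreal_arc_length[OF c, of t] that s arc_length_nonneg[OF c, of t]
    by auto
  obtain t0 where t0: "0 \<le> t0" "t0 \<le> 1" "arc_length c t0 = s"
    using IVT'[of "arc_length c" 0 s 1] s continuous_on_arc_length[OF c] by (auto simp: arc_length_le_0)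
  define t1 where "t1 = (SOME t. t \<in> {0..1} \<and> curve_length c t = ennreal s)"
  have "t1 \<in> {0..1} \<and> curve_length c t1 = ennreal s"
    unfolding t1_def by (rule someI[of _ t0]) (use t0 iff[of t0] in auto)
  then have t1: "t1 \<in> {0..1}" "arc_length c t1 = s" using iff[of t1] by auto
  have eq: "arclength_param c s = c t1" by (simp add: arclength_param_def t1_def)
  show "\<exists>t\<in>{0..1}. arc_length c t = s \<and> arclength_param c s = c t" using t1 eq by auto
  show "arclength_param c s = c t" if "t \<in> {0..1}" "arc_length c t = s"
    using dist_le_arc_length_abs[OF c, of t t1] that t1 eq by simp
qed

text \<open>The length function pushes \<^term>\<open>curve_measure c\<close> forward to Lebesgue measure on the interval
  of arc lengths, and composing it with the arc length parametrisation gives the curve back. The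
  parametrisation is 1-Lipschitz, hence measurable.\<close>

lemma curve_integral_eq:
  assumes c: "rectifiable c" and g [measurable]: "g \<in> borel_measurable borel"
  shows "curve_integral c g = (\<integral>\<^sup>+t. g (c (unit_clamp t)) \<partial>curve_measure c)"
proof -
  let ?L = "arc_length c"
  define q where "q s = arclength_param c (max 0 (min (?L 1) s))" for s
  have L1: "0 \<le> ?L 1" using c by (rule arc_length_nonneg)
  have lip: "dist (q s) (q s') \<le> 1 * dist s s'" for s s'
  proof -
    obtain t where t: "t \<in> {0..1}" "?L t = max 0 (min (?L 1) s)" "q s = c t"
      using arclength_param_obtain[OF c, of "max 0 (min (?L 1) s)"] L1 by (auto simp: q_def)
    obtain t' where t': "t' \<in> {0..1}" "?L t' = max 0 (min (?L 1) s')" "q s' = c t'"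
      using arclength_param_obtain[OF c, of "max 0 (min (?L 1) s')"] L1 by (auto simp: q_def)
    have "dist (c t) (c t') \<le> \<bar>max 0 (min (?L 1) s') - max 0 (min (?L 1) s)\<bar>"
      using dist_le_arc_length_abs[OF c t(1) t'(1)] t(2) t'(2) by simp
    also have "\<dots> \<le> \<bar>s - s'\<bar>" by (auto simp: max_def min_def)
    finally show ?thesis using t(3) t'(3) by (simp add: dist_real_def)
  qed
  have "continuous_on UNIV q"
    by (rule continuous_on_iff[THEN iffD2]) (use lip in \<open>auto intro: le_less_trans\<close>)
  then have [measurable]: "q \<in> borel_measurable borel" by (rule borel_measurable_continuous_onI)
  have [measurable]: "?L \<in> borel_measurable borel"
    using c by (intro borel_measurable_continuous_onI continuous_on_arc_length)
  have "curve_integral c g = (\<integral>\<^sup>+s. indicator {0..?L 1} s * g (q s) \<partial>lborel)"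
    unfolding curve_integral_def using c ennreal_arc_length[OF c, of 1]
    by (intro nn_integral_cong) (auto simp: q_def arc_length_def indicator_def)
  also have "\<dots> = (\<integral>\<^sup>+s. g (q s) \<partial>density lborel (indicator {0..?L 1}))"
    by (rule nn_integral_density[symmetric]) auto
  also have "\<dots> = (\<integral>\<^sup>+t. g (q (?L t)) \<partial>curve_measure c)"
    unfolding distr_curve_measure[OF c, symmetric] by (rule nn_integral_distr) auto
  also have "\<dots> = (\<integral>\<^sup>+t. g (c (unit_clamp t)) \<partial>curve_measure c)"
  proof (rule nn_integral_cong)
    fix t
    have "?L (unit_clamp t) = ?L t" by (simp add: arc_length_def)
    moreover have "?L t \<in> {0..?L 1}"
      using c arc_length_mono[OF c, of "unit_clamp t" 1] calculation by (simp add: arc_length_nonneg)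
    ultimately have "q (?L t) = c (unit_clamp t)"
      unfolding q_def by (subst arclength_param_eq[OF c, of _ "unit_clamp t"]) auto
    then show "g (q (?L t)) = g (c (unit_clamp t))" by simp
  qed
  finally show ?thesis .
qed

lemma curve_integral_cong:
  assumes c: "rectifiable c" and "\<And>x. x \<in> path_image c \<Longrightarrow> g x = h x"
  shows "curve_integral c g = curve_integral c h"
  unfolding curve_integral_def
proof (rule nn_integral_cong)
  fix s
  have "g (arclength_param c s) = h (arclength_param c s)" if "s \<in> {0..enn2real (curve_length c 1)}"
    using arclength_param_obtain[OF c, of s] that assms(2) by (auto simp: path_image_def arc_length_def)
  then show "g (arclength_param c s) * indicator {0..enn2real (curve_length c 1)} s
    = h (arclength_param c s) * indicator {0..enn2real (curve_length c 1)} s"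
    by (auto simp: indicator_def)
qed

lemma measurable_curve_clamp:
  "rectifiable c \<Longrightarrow> (\<lambda>t. c (unit_clamp t)) \<in> borel_measurable borel"
  by (intro borel_measurable_continuous_onI continuous_on_unit_clamp) (simp add: rectifiable_def)

section \<open>Domination of curves by measures\<close>

text \<open>A compact set inside \<open>W\<close> is covered by disjoint half-open intervals so short that those meeting
  it stay in a prescribed open neighbourhood inside \<open>W\<close>. Regularity of finite measures on the line
  passes from intervals to Borel sets.\<close>

lemma emeasure_le_if_le_on_intervals:
  fixes L m :: "real measure"
  assumes L: "finite_measure L" "sets L = sets borel" and m: "finite_measure m" "sets m = sets borel"
    and W: "open W"
    and le: "\<And>a b. a \<le> b \<Longrightarrow> {a..b} \<subseteq> W \<Longrightarrow> emeasure L {a<..b} \<le> emeasure m {a<..b}"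
    and B: "B \<in> sets borel" "B \<subseteq> W"
  shows "emeasure L B \<le> emeasure m B"
proof -
  have KU: "emeasure L K \<le> emeasure m U" if K: "compact K" "K \<subseteq> U" and U: "open U" "U \<subseteq> W" for K U
  proof -
    obtain d where d: "0 < d" "\<And>x y. x \<in> K \<Longrightarrow> dist x y < d \<Longrightarrow> y \<in> U"
    proof -
      obtain e where e: "0 < e" "(\<Union>x\<in>K. ball x e) \<subseteq> U"
        using compact_subset_open_imp_ball_epsilon_subset[OF K(1) U(1) K(2)] by blast
      then show thesis by (intro that[of e]) (auto simp: subset_eq)
    qed
    define h where "h = d / 2"
    have h: "0 < h" using d by (simp add: h_def)
    define I :: "int \<Rightarrow> real set" where "I k = {of_int k * h<..of_int (k + 1) * h}" for k
    have I_borel [simp]: "I k \<in> sets borel" for k by (simp add: I_def)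
    define J where "J = {k. I k \<inter> K \<noteq> {}}"
    have disj: "disjoint_family_on I J"
    proof -
      have "k = k'" if x: "x \<in> I k" "x \<in> I k'" for k k' x
      proof -
        have "of_int k * h < of_int (k' + 1) * h" "of_int k' * h < of_int (k + 1) * h"
          using x by (auto simp: I_def)
        then have "real_of_int k < of_int (k' + 1)" "real_of_int k' < of_int (k + 1)"
          using h by (simp_all only: mult_less_cancel_right_pos)
        then show ?thesis by linarith
      qed
      then show ?thesis by (auto simp: disjoint_family_on_def)
    qed
    have closure: "{of_int k * h..of_int (k + 1) * h} \<subseteq> U" if "k \<in> J" for k
    proof
      fix y assume y: "y \<in> {of_int k * h..of_int (k + 1) * h}"
      obtain x where x: "x \<in> K" "x \<in> I k" using \<open>k \<in> J\<close> by (auto simp: J_def)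
      have "dist x y \<le> h" using x(2) y by (auto simp: I_def dist_real_def algebra_simps)
      then show "y \<in> U" using d x(1) h by (intro d(2)[of x]) (auto simp: h_def)
    qed
    have "K \<subseteq> (\<Union>k\<in>J. I k)"
    proof
      fix x assume x: "x \<in> K"
      have "x \<in> I (\<lceil>x / h\<rceil> - 1)"
      proof -
        have "of_int \<lceil>x / h\<rceil> - 1 < x / h" "x / h \<le> of_int \<lceil>x / h\<rceil>" by linarith+
        then have "(of_int \<lceil>x / h\<rceil> - 1) * h < x" "x \<le> of_int \<lceil>x / h\<rceil> * h"
          using h by (simp_all only: pos_less_divide_eq pos_divide_le_eq)
        then show ?thesis by (simp add: I_def)
      qed
      with x show "x \<in> (\<Union>k\<in>J. I k)" by (auto simp: J_def)
    qed
    then have "emeasure L K \<le> emeasure L (\<Union>k\<in>J. I k)"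
      using L by (intro emeasure_mono) (auto intro!: sets.countable_UN')
    also have "\<dots> = (\<integral>\<^sup>+k. emeasure L (I k) \<partial>count_space J)"
      using disj L by (intro emeasure_UN_countable) auto
    also have "\<dots> \<le> (\<integral>\<^sup>+k. emeasure m (I k) \<partial>count_space J)"
    proof (rule nn_integral_mono)
      fix k assume "k \<in> space (count_space J)"
      then have "{of_int k * h..of_int (k + 1) * h} \<subseteq> W" using closure[of k] U by auto
      moreover have "of_int k * h \<le> of_int (k + 1) * h" using h by (intro mult_right_mono) auto
      ultimately show "emeasure L (I k) \<le> emeasure m (I k)"
        unfolding I_def by (intro le) auto
    qed
    also have "\<dots> = emeasure m (\<Union>k\<in>J. I k)"
      using disj m by (intro emeasure_UN_countable[symmetric]) auto
    also have "\<dots> \<le> emeasure m U"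
    proof (rule emeasure_mono)
      have "I k \<subseteq> U" if "k \<in> J" for k using closure[OF that] by (auto simp: I_def)
      then show "(\<Union>k\<in>J. I k) \<subseteq> U" by auto
    qed (use U m in auto)
    finally show ?thesis .
  qed
  have "emeasure L B = (SUP K\<in>{K. K \<subseteq> B \<and> compact K}. emeasure L K)"
    using L B by (intro inner_regular) (auto simp: finite_measure.finite_emeasure_space)
  also have "\<dots> \<le> (INF U\<in>{U. B \<subseteq> U \<and> open U}. emeasure m U)"
  proof (intro SUP_least INF_greatest; clarsimp)
    fix K U assume "K \<subseteq> B" "compact K" "B \<subseteq> U" "open U"
    then have "emeasure L K \<le> emeasure m (U \<inter> W)" using B W by (intro KU) auto
    also have "\<dots> \<le> emeasure m U" using \<open>open U\<close> m by (intro emeasure_mono) auto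
    finally show "emeasure L K \<le> emeasure m U" .
  qed
  also have "\<dots> = emeasure m B"
    using m B by (intro outer_regular[symmetric]) (auto simp: finite_measure.finite_emeasure_space)
  finally show ?thesis .
qed

lemma set_nn_integral_mono_measure:
  assumes "sets L = sets m" "B \<in> sets m"
    and le: "\<And>A. A \<in> sets m \<Longrightarrow> A \<subseteq> B \<Longrightarrow> emeasure L A \<le> emeasure m A"
    and f [measurable]: "f \<in> borel_measurable m"
  shows "(\<integral>\<^sup>+x\<in>B. f x \<partial>L) \<le> (\<integral>\<^sup>+x\<in>B. f x \<partial>m)"
proof -
  note [measurable] = \<open>B \<in> sets m\<close>
  note [measurable_cong] = \<open>sets L = sets m\<close>
  have space: "space L = space m" using assms(1) by (rule sets_eq_imp_space_eq)
  have "density L (indicator B) \<le> density m (indicator B)"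
  proof (subst le_measure)
    show "\<forall>A\<in>sets (density L (indicator B)). emeasure (density L (indicator B)) A \<le> emeasure (density m (indicator B)) A"
    proof
      fix A assume "A \<in> sets (density L (indicator B))"
      then have A [measurable]: "A \<in> sets m" using assms(1) by simp
      have "emeasure L (B \<inter> A) \<le> emeasure m (B \<inter> A)" by (intro le) auto
      then show "emeasure (density L (indicator B)) A \<le> emeasure (density m (indicator B)) A"
        using assms(1) A \<open>B \<in> sets m\<close> by (simp add: emeasure_density nn_integral_indicator flip: indicator_inter_arith)
    qed
  qed (use assms in auto)
  then have "(\<integral>\<^sup>+x. f x \<partial>density L (indicator B)) \<le> (\<integral>\<^sup>+x. f x \<partial>density m (indicator B))"
    by (intro nn_integral_mono_measure) (use assms in auto)
  then show ?thesis
    by (simp add: nn_integral_density mult.commute)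
qed

lemma curve_length_le_measure:
  assumes m: "sets m = sets borel"
    and dom: "\<And>a b. s \<le> a \<Longrightarrow> a \<le> b \<Longrightarrow> b \<le> t \<Longrightarrow> ennreal (dist (c a) (c b)) \<le> emeasure m {a<..b}"
    and st: "0 \<le> s" "s \<le> t"
  shows "curve_length c t \<le> curve_length c s + emeasure m {s<..t}"
proof -
  have "curve_length c t + emeasure m {s<..s} \<le> curve_length c s + emeasure m {s<..t}"
  proof (rule curve_length_least_from[where G = "\<lambda>x. emeasure m {s<..x}"])
    fix a b assume ab: "s \<le> a" "a \<le> b" "b \<le> t"
    have "ennreal (dist (c a) (c b)) + emeasure m {s<..a} \<le> emeasure m {a<..b} + emeasure m {s<..a}"
      by (intro add_right_mono dom ab)
    also have "\<dots> = emeasure m ({a<..b} \<union> {s<..a})"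
      using m by (intro plus_emeasure) auto
    also have "{a<..b} \<union> {s<..a} = {s<..b}" using ab by auto
    finally show "ennreal (dist (c a) (c b)) + emeasure m {s<..a} \<le> emeasure m {s<..b}" .
  qed (use st in auto)
  then show ?thesis by simp
qed

lemma rectifiable_if_dominated:
  assumes m: "finite_measure m" "sets m = sets borel"
    and dom: "\<And>a b. 0 \<le> a \<Longrightarrow> a \<le> b \<Longrightarrow> b \<le> 1 \<Longrightarrow> ennreal (dist (c a) (c b)) \<le> emeasure m {a<..b}"
    and c: "path c"
  shows "rectifiable c"
  using curve_length_le_measure[OF m(2) dom, where s = 0 and t = 1] c
    finite_measure.emeasure_finite[OF m(1), of "{0<..1}"]
  by (auto simp: rectifiable_def less_top[symmetric] top_unique)

text \<open>Domination of the increments is domination of the arc length measure on intervals, by minimality of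
  length, and extends to Borel sets of parameters. If \<open>m\<close> has a density, that density plays the role of
  a bound for the metric derivative of the curve.\<close>

lemma curve_measure_le:
  assumes c: "rectifiable c" and m: "finite_measure m" "sets m = sets borel"
    and W: "open W"
    and dom: "\<And>a b. 0 \<le> a \<Longrightarrow> a \<le> b \<Longrightarrow> b \<le> 1 \<Longrightarrow> {a..b} \<subseteq> W \<Longrightarrow> ennreal (dist (c a) (c b)) \<le> emeasure m {a<..b}"
    and B: "B \<in> sets borel" "B \<subseteq> W"
  shows "emeasure (curve_measure c) B \<le> emeasure m B"
proof (rule emeasure_le_if_le_on_intervals[OF finite_measure_curve_measure[OF c] sets_curve_measure m W _ B])
  fix a b :: real assume ab: "a \<le> b" "{a..b} \<subseteq> W"
  show "emeasure (curve_measure c) {a<..b} \<le> emeasure m {a<..b}"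
  proof (cases "b \<le> 0 \<or> 1 < a")
    case True
    then have "unit_clamp a = unit_clamp b" using ab by (auto simp: unit_clamp_def)
    then show ?thesis using c ab by (simp add: emeasure_curve_measure_Ioc arc_length_def)
  next
    case False
    define a' b' where "a' = unit_clamp a" and "b' = unit_clamp b"
    have sub: "{a'..b'} \<subseteq> {a..b}" "{a'<..b'} \<subseteq> {a<..b}" "0 \<le> a'" "a' \<le> b'" "b' \<le> 1"
      using False ab by (auto simp: a'_def b'_def unit_clamp_def)
    have "curve_length c b' \<le> curve_length c a' + emeasure m {a'<..b'}"
    proof (rule curve_length_le_measure[OF m(2)])
      fix u v assume "a' \<le> u" "u \<le> v" "v \<le> b'"
      moreover from this have "{u..v} \<subseteq> W" using sub ab by auto
      ultimately show "ennreal (dist (c u) (c v)) \<le> emeasure m {u<..v}"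
        using sub by (intro dom) auto
    qed (use sub in auto)
    then have "ennreal (arc_length c b) \<le> ennreal (arc_length c a) + emeasure m {a'<..b'}"
      using c by (simp add: ennreal_arc_length a'_def b'_def)
    then have "ennreal (arc_length c b) - ennreal (arc_length c a) \<le> emeasure m {a'<..b'}"
      by (simp add: ennreal_minus_le_iff)
    also have "\<dots> \<le> emeasure m {a<..b}" using sub m by (intro emeasure_mono) auto
    finally show ?thesis
      using c ab by (simp add: emeasure_curve_measure_Ioc ennreal_minus arc_length_nonneg)
  qed
qed

lemma curve_integral_le_dominated:
  assumes c: "rectifiable c" and m: "finite_measure m" "sets m = sets borel"
    and dom: "\<And>a b. 0 \<le> a \<Longrightarrow> a \<le> b \<Longrightarrow> b \<le> 1 \<Longrightarrow> ennreal (dist (c a) (c b)) \<le> emeasure m {a<..b}"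
    and g [measurable]: "g \<in> borel_measurable borel"
  shows "curve_integral c g \<le> (\<integral>\<^sup>+t. g (c (unit_clamp t)) \<partial>m)"
proof -
  note [measurable_cong] = m(2) and [measurable] = measurable_curve_clamp[OF c]
  have "(\<integral>\<^sup>+t\<in>UNIV. g (c (unit_clamp t)) \<partial>curve_measure c) \<le> (\<integral>\<^sup>+t\<in>UNIV. g (c (unit_clamp t)) \<partial>m)"
    by (rule set_nn_integral_mono_measure)
       (use m in \<open>auto intro!: curve_measure_le[OF c m open_UNIV] dom\<close>)
  then show ?thesis by (simp add: curve_integral_eq[OF c g])
qed

definition subcurve :: "real \<Rightarrow> real \<Rightarrow> (real \<Rightarrow> 'a) \<Rightarrow> real \<Rightarrow> 'a" where
  "subcurve a b c u = c (a + u * (b - a))"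

lemma subcurve_image:
  fixes a b u :: real
  assumes "0 \<le> a" "a \<le> b" "b \<le> 1" and u: "u \<in> {0..1}"
  shows "a + u * (b - a) \<in> {a..b}" "a + u * (b - a) \<in> {0..1}"
proof -
  have "u * (b - a) \<le> 1 * (b - a)" by (rule mult_right_mono) (use assms in auto)
  moreover have "0 \<le> u * (b - a)" by (rule mult_nonneg_nonneg) (use assms in auto)
  ultimately show "a + u * (b - a) \<in> {a..b}" by simp
  then show "a + u * (b - a) \<in> {0..1}" using assms by auto
qed

text \<open>The arc length measure of the whole curve, restricted to the parameter interval and rescaled to
  \<open>[0,1]\<close>, dominates the increments of the subcurve.\<close>

lemma curve_integral_subcurve_le:
  assumes c: "rectifiable c" and ab: "0 \<le> a" "a \<le> b" "b \<le> 1"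
    and g [measurable]: "g \<in> borel_measurable borel"
  shows "rectifiable (subcurve a b c)"
    and "curve_integral (subcurve a b c) g \<le> (\<integral>\<^sup>+t\<in>{a<..b}. g (c (unit_clamp t)) \<partial>curve_measure c)"
proof -
  note [measurable] = measurable_curve_clamp[OF c]
  interpret finite_measure "curve_measure c" using c by (rule finite_measure_curve_measure)
  define r where "r t = (t - a) / (b - a)" for t
  have [measurable]: "r \<in> borel_measurable borel" by (simp add: r_def[abs_def])
  define m0 where "m0 = density (curve_measure c) (indicator {a<..b})"
  have [measurable_cong, simp]: "sets m0 = sets borel" by (simp add: m0_def)
  define m where "m = distr m0 borel r"
  have fin0: "finite_measure m0"
    unfolding m0_def by (rule finite_measureI) (simp add: emeasure_density less_top[symmetric])
  have fin: "finite_measure m"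
    unfolding m_def by (rule finite_measure.finite_measure_distr[OF fin0]) simp
  have path: "path (subcurve a b c)"
    unfolding path_def subcurve_def[abs_def]
  proof (rule continuous_on_compose2[of "{0..1}" c])
    show "continuous_on {0..1} c" using c by (simp add: rectifiable_def path_def)
    show "continuous_on {0..1} (\<lambda>u. a + u * (b - a))" by (intro continuous_intros)
    show "(\<lambda>u. a + u * (b - a)) ` {0..1} \<subseteq> {0..1}" using subcurve_image(2)[OF ab] by blast
  qed
  have sub: "subcurve a b c u = c (a + u * (b - a))" for u
    by (simp add: subcurve_def)
  have dom: "ennreal (dist (subcurve a b c u) (subcurve a b c v)) \<le> emeasure m {u<..v}"
    if uv: "0 \<le> u" "u \<le> v" "v \<le> 1" for u v
  proof (cases "a = b")
    case True then show ?thesis by (simp add: subcurve_def)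
  next
    case False
    then have ab': "a < b" using ab by simp
    have le: "a + u * (b - a) \<le> a + v * (b - a)" "a + v * (b - a) \<le> b" "a \<le> a + u * (b - a)"
    proof -
      show "a + u * (b - a) \<le> a + v * (b - a)" using uv ab by (intro add_left_mono mult_right_mono) auto
      have "v * (b - a) \<le> 1 * (b - a)" using uv ab by (intro mult_right_mono) auto
      then show "a + v * (b - a) \<le> b" by simp
      show "a \<le> a + u * (b - a)" using uv ab by simp
    qed
    have "dist (c (a + u * (b - a))) (c (a + v * (b - a)))
        \<le> arc_length c (a + v * (b - a)) - arc_length c (a + u * (b - a))"
      using le ab by (intro dist_le_arc_length[OF c]) auto
    then have "ennreal (dist (subcurve a b c u) (subcurve a b c v))
        \<le> emeasure (curve_measure c) {a + u * (b - a)<..a + v * (b - a)}"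
      unfolding emeasure_curve_measure_Ioc[OF c le(1)] sub by (intro ennreal_leI)
    also have "{a + u * (b - a)<..a + v * (b - a)} = {a<..b} \<inter> r -` {u<..v}"
    proof (intro set_eqI)
      fix t
      have "t \<in> r -` {u<..v} \<longleftrightarrow> t \<in> {a + u * (b - a)<..a + v * (b - a)}"
        using ab' by (auto simp: r_def field_simps)
      moreover have "t \<in> {a<..b}" if "t \<in> {a + u * (b - a)<..a + v * (b - a)}"
        using that le by auto
      ultimately show "t \<in> {a + u * (b - a)<..a + v * (b - a)} \<longleftrightarrow> t \<in> {a<..b} \<inter> r -` {u<..v}" by blast
    qed
    also have "emeasure (curve_measure c) \<dots> = emeasure m {u<..v}"
    proof -
      have V: "r -` {u<..v} \<in> sets borel" using measurable_sets[of r borel borel "{u<..v}"] by simp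
      have "emeasure m {u<..v} = emeasure m0 (r -` {u<..v})"
        unfolding m_def by (subst emeasure_distr) (auto simp: m0_def)
      also have "\<dots> = emeasure (curve_measure c) ({a<..b} \<inter> r -` {u<..v})"
        unfolding m0_def using V by (simp add: emeasure_density flip: indicator_inter_arith)
      finally show ?thesis ..
    qed
    finally show ?thesis .
  qed
  have m: "sets m = sets borel" by (simp add: m_def)
  show rect: "rectifiable (subcurve a b c)"
    using dom path by (rule rectifiable_if_dominated[OF fin m])
  note [measurable] = measurable_curve_clamp[OF rect]
  have "curve_integral (subcurve a b c) g \<le> (\<integral>\<^sup>+t. g (subcurve a b c (unit_clamp t)) \<partial>m)"
    using dom by (intro curve_integral_le_dominated[OF rect fin m]) auto
  also have "\<dots> = (\<integral>\<^sup>+t. g (subcurve a b c (unit_clamp (r t))) \<partial>m0)"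
    unfolding m_def by (rule nn_integral_distr) auto
  also have "\<dots> = (\<integral>\<^sup>+t. g (subcurve a b c (unit_clamp (r t))) * indicator {a<..b} t \<partial>curve_measure c)"
    unfolding m0_def by (subst nn_integral_density) (auto simp: mult.commute)
  also have "\<dots> = (\<integral>\<^sup>+t\<in>{a<..b}. g (c (unit_clamp t)) \<partial>curve_measure c)"
  proof (rule nn_integral_cong)
    fix t
    show "g (subcurve a b c (unit_clamp (r t))) * indicator {a<..b} t = g (c (unit_clamp t)) * indicator {a<..b} t"
    proof (cases "t \<in> {a<..b}")
      case True
      then have "0 \<le> r t" "r t \<le> 1" "a + r t * (b - a) = t" by (auto simp: r_def divide_simps)
      then show ?thesis using True ab by (simp add: sub)
    qed simp
  qed
  finally show "curve_integral (subcurve a b c) g \<le> (\<integral>\<^sup>+t\<in>{a<..b}. g (c (unit_clamp t)) \<partial>curve_measure c)" .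
qed

section \<open>Almost every curve\<close>

text \<open>The function \<open>\<eta>\<close> of finite energy describes an exceptional family, the curves along which its integral
  is infinite; these are the families of modulus zero (\<open>ae_curve_iff_modulus\<close>). Being given by a function,
  they behave well under countable unions, passing to subcurves, and pulling back by a map.\<close>

definition ae_curve :: "'a::metric_space measure \<Rightarrow> real \<Rightarrow> 'a set \<Rightarrow> ((real \<Rightarrow> 'a) \<Rightarrow> bool) \<Rightarrow> bool" where
  "ae_curve M p U P \<longleftrightarrow> (\<exists>\<eta>\<in>borel_measurable borel. (\<integral>\<^sup>+x. enn_powr (\<eta> x) p \<partial>M) < \<infinity> \<and>
     (\<forall>\<gamma>. rectifiable_curve U \<gamma> \<longrightarrow> curve_integral \<gamma> \<eta> < \<infinity> \<longrightarrow> P \<gamma>))"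

lemma ae_curve_mono:
  assumes "ae_curve M p U P" "\<And>\<gamma>. rectifiable_curve V \<gamma> \<Longrightarrow> P \<gamma> \<Longrightarrow> Q \<gamma>" "V \<subseteq> U"
  shows "ae_curve M p V Q"
  using assms unfolding ae_curve_def rectifiable_curve_def by (meson order_trans)

lemma curve_integral_mono: "(\<And>x. g x \<le> h x) \<Longrightarrow> curve_integral c g \<le> curve_integral c h"
  unfolding curve_integral_def by (intro nn_integral_mono mult_right_mono) auto

lemma curve_integral_cmult:
  assumes c: "rectifiable c" and g [measurable]: "g \<in> borel_measurable borel"
  shows "curve_integral c (\<lambda>x. k * g x) = k * curve_integral c g"
proof -
  note [measurable] = measurable_curve_clamp[OF c]
  show ?thesis by (simp add: curve_integral_eq[OF c] nn_integral_cmult)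
qed

text \<open>The \<open>p\<close>-th power of a supremum is at most the sum of the \<open>p\<close>-th powers.\<close>

lemma nn_integral_enn_powr_SUP_finite:
  assumes M [measurable_cong]: "sets M = sets borel" and p: "0 < p"
    and \<theta> [measurable]: "\<And>n::nat. \<theta> n \<in> borel_measurable borel"
    and le: "\<And>n. (\<integral>\<^sup>+x. enn_powr (\<theta> n x) p \<partial>M) \<le> ennreal ((1/2)^n)"
  shows "(\<integral>\<^sup>+x. enn_powr (SUP n. \<theta> n x) p \<partial>M) < \<infinity>"
proof -
  have "(\<integral>\<^sup>+x. enn_powr (SUP n. \<theta> n x) p \<partial>M) = (\<integral>\<^sup>+x. (SUP n. enn_powr (\<theta> n x) p) \<partial>M)"
    by (simp add: enn_powr_SUP[OF p])
  also have "\<dots> \<le> (\<integral>\<^sup>+x. (\<Sum>n. enn_powr (\<theta> n x) p) \<partial>M)"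
  proof (intro nn_integral_mono SUP_least)
    fix x n
    show "enn_powr (\<theta> n x) p \<le> (\<Sum>n. enn_powr (\<theta> n x) p)"
      using sum_le_suminf[of "\<lambda>n. enn_powr (\<theta> n x) p" "{n}"] by simp
  qed
  also have "\<dots> = (\<Sum>n. \<integral>\<^sup>+x. enn_powr (\<theta> n x) p \<partial>M)"
    by (rule nn_integral_suminf) measurable
  also have "\<dots> \<le> (\<Sum>n. ennreal ((1/2)^n))"
    by (intro suminf_le le) auto
  also have "\<dots> = ennreal (\<Sum>n. (1/2)^n)"
    by (intro suminf_ennreal2) auto
  also have "\<dots> < \<infinity>" by simp
  finally show ?thesis .
qed

lemma nn_integral_enn_powr_cmult:
  assumes M [measurable_cong]: "sets M = sets borel" and [measurable]: "\<eta> \<in> borel_measurable borel"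
  shows "(\<integral>\<^sup>+x. enn_powr (k * \<eta> x) p \<partial>M) = enn_powr k p * (\<integral>\<^sup>+x. enn_powr (\<eta> x) p \<partial>M)"
  by (simp add: enn_powr_mult nn_integral_cmult)

lemma small_multiple_energy:
  assumes M: "sets M = sets borel" and p: "0 < p" and \<eta>: "\<eta> \<in> borel_measurable borel"
    and fin: "(\<integral>\<^sup>+x. enn_powr (\<eta> x) p \<partial>M) < \<infinity>" and d: "0 < (d::real)"
  shows "\<exists>k::real>0. (\<integral>\<^sup>+x. enn_powr (ennreal k * \<eta> x) p \<partial>M) \<le> ennreal d"
proof -
  obtain i where i: "(\<integral>\<^sup>+x. enn_powr (\<eta> x) p \<partial>M) = ennreal i" "0 \<le> i"
    using fin by (cases "\<integral>\<^sup>+x. enn_powr (\<eta> x) p \<partial>M") auto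
  define k where "k = (d / (i + 1)) powr (1 / p)"
  have k: "0 < k" "k powr p = d / (i + 1)" using d i p by (auto simp: k_def powr_powr)
  have "(\<integral>\<^sup>+x. enn_powr (ennreal k * \<eta> x) p \<partial>M) = ennreal (d / (i + 1)) * ennreal i"
    using k by (simp add: nn_integral_enn_powr_cmult[OF M \<eta>] i(1) enn_powr_ennreal)
  also have "\<dots> = ennreal (d * (i / (i + 1)))" using i d by (simp flip: ennreal_mult')
  also have "\<dots> \<le> ennreal d" using i d by (intro ennreal_leI mult_left_le) (auto simp: divide_simps)
  finally show ?thesis using k by blast
qed

lemma ae_curve_all:
  assumes M: "sets M = sets borel" and p: "0 < p" and ae: "\<And>n::nat. ae_curve M p U (P n)"
  shows "ae_curve M p U (\<lambda>\<gamma>. \<forall>n. P n \<gamma>)"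
proof -
  have "\<forall>n. \<exists>\<eta>. \<eta> \<in> borel_measurable borel \<and> (\<integral>\<^sup>+x. enn_powr (\<eta> x) p \<partial>M) < \<infinity> \<and>
     (\<forall>\<gamma>. rectifiable_curve U \<gamma> \<longrightarrow> curve_integral \<gamma> \<eta> < \<infinity> \<longrightarrow> P n \<gamma>)"
    using ae unfolding ae_curve_def by blast
  then obtain \<eta> where \<eta>: "\<And>n. \<eta> n \<in> borel_measurable borel" "\<And>n. (\<integral>\<^sup>+x. enn_powr (\<eta> n x) p \<partial>M) < \<infinity>"
     "\<And>n \<gamma>. rectifiable_curve U \<gamma> \<Longrightarrow> curve_integral \<gamma> (\<eta> n) < \<infinity> \<Longrightarrow> P n \<gamma>"
    by metis
  have "\<forall>n. \<exists>k::real>0. (\<integral>\<^sup>+x. enn_powr (ennreal k * \<eta> n x) p \<partial>M) \<le> ennreal ((1/2)^n)"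
    using \<eta> by (intro allI small_multiple_energy[OF M p]) auto
  then obtain k where k: "\<And>n. 0 < (k n :: real)"
      "\<And>n. (\<integral>\<^sup>+x. enn_powr (ennreal (k n) * \<eta> n x) p \<partial>M) \<le> ennreal ((1/2)^n)"
    by metis
  define \<theta> where "\<theta> n x = ennreal (k n) * \<eta> n x" for n x
  have \<theta> [measurable]: "\<theta> n \<in> borel_measurable borel" for n
    using \<eta>(1)[of n] unfolding \<theta>_def[abs_def] by measurable
  have "P n \<gamma>" if \<gamma>: "rectifiable_curve U \<gamma>" "curve_integral \<gamma> (\<lambda>x. SUP n. \<theta> n x) < \<infinity>" for n \<gamma>
  proof (rule \<eta>(3)[OF \<gamma>(1)])
    have rect: "rectifiable \<gamma>" using \<gamma> by (simp add: rectifiable_curve_iff)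
    have "ennreal (k n) * curve_integral \<gamma> (\<eta> n) = curve_integral \<gamma> (\<theta> n)"
      unfolding \<theta>_def by (rule curve_integral_cmult[OF rect \<eta>(1), symmetric])
    also have "\<dots> \<le> curve_integral \<gamma> (\<lambda>x. SUP n. \<theta> n x)"
      by (intro curve_integral_mono SUP_upper) simp
    also note \<gamma>(2)
    finally show "curve_integral \<gamma> (\<eta> n) < \<infinity>"
      using k(1)[of n] by (auto simp: ennreal_mult_less_top)
  qed
  moreover have "(\<integral>\<^sup>+x. enn_powr (SUP n. \<theta> n x) p \<partial>M) < \<infinity>"
    by (rule nn_integral_enn_powr_SUP_finite[OF M p \<theta>]) (simp add: \<theta>_def k(2))
  ultimately show ?thesis
    unfolding ae_curve_def by (intro bexI[of _ "\<lambda>x. SUP n. \<theta> n x"]) auto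
qed

lemma ae_curve_conj:
  assumes M: "sets M = sets borel" and p: "0 < p" and "ae_curve M p U P" "ae_curve M p U Q"
  shows "ae_curve M p U (\<lambda>\<gamma>. P \<gamma> \<and> Q \<gamma>)"
proof -
  have "ae_curve M p U (\<lambda>\<gamma>. \<forall>n::nat. (if n = 0 then P else Q) \<gamma>)"
    using assms by (intro ae_curve_all) auto
  then show ?thesis
  proof (rule ae_curve_mono)
    fix \<gamma> assume *: "\<forall>n::nat. (if n = 0 then P else Q) \<gamma>"
    show "P \<gamma> \<and> Q \<gamma>" using *[rule_format, of 0] *[rule_format, of 1] by simp
  qed simp
qed

text \<open>Small multiples of a function whose line integrals are infinite are admissible of arbitrarily small
  energy. Conversely, suitable multiples of admissible functions of rapidly decreasing energy have a
  supremum of finite energy.\<close>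

lemma ae_curve_iff_modulus:
  assumes M: "sets M = sets borel" and p: "0 < p"
  shows "ae_curve M p U P \<longleftrightarrow> (\<exists>\<Gamma>. modulus M p \<Gamma> = 0 \<and> (\<forall>\<gamma>. rectifiable_curve U \<gamma> \<longrightarrow> \<gamma> \<notin> \<Gamma> \<longrightarrow> P \<gamma>))"
proof
  assume "ae_curve M p U P"
  then obtain \<eta> where \<eta>: "\<eta> \<in> borel_measurable borel" "(\<integral>\<^sup>+x. enn_powr (\<eta> x) p \<partial>M) < \<infinity>"
     "\<And>\<gamma>. rectifiable_curve U \<gamma> \<Longrightarrow> curve_integral \<gamma> \<eta> < \<infinity> \<Longrightarrow> P \<gamma>"
    unfolding ae_curve_def by blast
  let ?\<Gamma> = "{\<gamma>. curve_integral \<gamma> \<eta> = \<infinity>}"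
  have "modulus M p ?\<Gamma> \<le> 0 + ennreal d" if "0 < d" for d :: real
  proof -
    obtain k :: real where k: "0 < k" "(\<integral>\<^sup>+x. enn_powr (ennreal k * \<eta> x) p \<partial>M) \<le> ennreal d"
      using small_multiple_energy[OF M p \<eta>(1,2) \<open>0 < d\<close>] by blast
    have "modulus M p ?\<Gamma> \<le> (\<integral>\<^sup>+x. enn_powr (ennreal k * \<eta> x) p \<partial>M)"
      unfolding modulus_def
    proof (rule INF_lower, intro CollectI conjI ballI impI)
      show "(\<lambda>x. ennreal k * \<eta> x) \<in> borel_measurable borel"
        by (intro borel_measurable_times_ennreal borel_measurable_const \<eta>(1))
      fix \<gamma> :: "real \<Rightarrow> 'a" assume \<gamma>: "\<gamma> \<in> ?\<Gamma>" "rectifiable_curve UNIV \<gamma>"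
      then have "rectifiable \<gamma>" by (simp add: rectifiable_curve_iff)
      then have "curve_integral \<gamma> (\<lambda>x. ennreal k * \<eta> x) = ennreal k * curve_integral \<gamma> \<eta>"
        by (rule curve_integral_cmult[OF _ \<eta>(1)])
      moreover have "curve_integral \<gamma> \<eta> = \<top>" using \<gamma>(1) by simp
      moreover have "ennreal k * \<top> = \<top>" using k(1) by (simp add: ennreal_mult_top)
      ultimately show "1 \<le> curve_integral \<gamma> (\<lambda>x. ennreal k * \<eta> x)"
        by (simp only: top_greatest)
    qed
    also note k(2)
    finally show ?thesis by (simp only: add_0)
  qed
  then have "modulus M p ?\<Gamma> \<le> 0" by (rule ennreal_le_epsilon)
  moreover have "\<forall>\<gamma>. rectifiable_curve U \<gamma> \<longrightarrow> \<gamma> \<notin> ?\<Gamma> \<longrightarrow> P \<gamma>"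
    using \<eta>(3) by (auto simp: less_top[symmetric])
  ultimately show "\<exists>\<Gamma>. modulus M p \<Gamma> = 0 \<and> (\<forall>\<gamma>. rectifiable_curve U \<gamma> \<longrightarrow> \<gamma> \<notin> \<Gamma> \<longrightarrow> P \<gamma>)"
    by (intro exI[of _ ?\<Gamma>]) auto
next
  assume "\<exists>\<Gamma>. modulus M p \<Gamma> = 0 \<and> (\<forall>\<gamma>. rectifiable_curve U \<gamma> \<longrightarrow> \<gamma> \<notin> \<Gamma> \<longrightarrow> P \<gamma>)"
  then obtain \<Gamma> where \<Gamma>: "modulus M p \<Gamma> = 0" "\<And>\<gamma>. rectifiable_curve U \<gamma> \<Longrightarrow> \<gamma> \<notin> \<Gamma> \<Longrightarrow> P \<gamma>" by blast
  \<comment> \<open>the weight \<open>n + 1\<close> makes the supremum of the admissible functions infinite on the family\<close>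
  have "\<exists>\<eta>. \<eta> \<in> borel_measurable borel \<and> (\<forall>\<gamma>\<in>\<Gamma>. rectifiable_curve UNIV \<gamma> \<longrightarrow> 1 \<le> curve_integral \<gamma> \<eta>) \<and>
      (\<integral>\<^sup>+x. enn_powr (\<eta> x) p \<partial>M) < ennreal ((1/2)^n / real (Suc n) powr p)" for n
  proof -
    have "modulus M p \<Gamma> < ennreal ((1/2)^n / real (Suc n) powr p)" by (simp add: \<Gamma>(1))
    then show ?thesis unfolding modulus_def INF_less_iff by auto
  qed
  then obtain \<eta> where "\<And>n. \<eta> n \<in> borel_measurable borel \<and>
      (\<forall>\<gamma>\<in>\<Gamma>. rectifiable_curve UNIV \<gamma> \<longrightarrow> 1 \<le> curve_integral \<gamma> (\<eta> n)) \<and>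
      (\<integral>\<^sup>+x. enn_powr (\<eta> n x) p \<partial>M) < ennreal ((1/2)^n / real (Suc n) powr p)"
    by (rule that[OF someI_ex])
  then have \<eta>: "\<And>n. \<eta> n \<in> borel_measurable borel"
      "\<And>n \<gamma>. \<gamma> \<in> \<Gamma> \<Longrightarrow> rectifiable_curve UNIV \<gamma> \<Longrightarrow> 1 \<le> curve_integral \<gamma> (\<eta> n)"
      "\<And>n. (\<integral>\<^sup>+x. enn_powr (\<eta> n x) p \<partial>M) < ennreal ((1/2)^n / real (Suc n) powr p)"
    by blast+
  define \<theta> where "\<theta> n x = ennreal (real (Suc n)) * \<eta> n x" for n x
  have \<theta> [measurable]: "\<theta> n \<in> borel_measurable borel" for n
    using \<eta>(1)[of n] unfolding \<theta>_def[abs_def] by measurable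
  have "P \<gamma>" if \<gamma>: "rectifiable_curve U \<gamma>" "curve_integral \<gamma> (\<lambda>x. SUP n. \<theta> n x) < \<infinity>" for \<gamma>
  proof (rule \<Gamma>(2)[OF \<gamma>(1)], rule notI)
    assume in_\<Gamma>: "\<gamma> \<in> \<Gamma>"
    have rect: "rectifiable \<gamma>" using \<gamma> by (simp add: rectifiable_curve_iff)
    have "of_nat n \<le> curve_integral \<gamma> (\<lambda>x. SUP n. \<theta> n x)" for n
    proof -
      have "of_nat n \<le> ennreal (real (Suc n)) * 1" by (simp add: ennreal_of_nat_eq_real_of_nat ennreal_leI)
      also have "\<dots> \<le> ennreal (real (Suc n)) * curve_integral \<gamma> (\<eta> n)"
        using \<eta>(2)[OF in_\<Gamma>, of n] rect by (intro mult_left_mono) (auto simp: rectifiable_curve_iff)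
      also have "\<dots> = curve_integral \<gamma> (\<theta> n)"
        unfolding \<theta>_def by (rule curve_integral_cmult[OF rect \<eta>(1), symmetric])
      also have "\<dots> \<le> curve_integral \<gamma> (\<lambda>x. SUP n. \<theta> n x)"
        by (intro curve_integral_mono SUP_upper) simp
      finally show ?thesis .
    qed
    then have "(SUP n. of_nat n) \<le> curve_integral \<gamma> (\<lambda>x. SUP n. \<theta> n x)" by (intro SUP_least)
    then show False using \<gamma>(2) by (simp add: ennreal_SUP_of_nat_eq_top top_unique)
  qed
  moreover have "(\<integral>\<^sup>+x. enn_powr (SUP n. \<theta> n x) p \<partial>M) < \<infinity>"
  proof (rule nn_integral_enn_powr_SUP_finite[OF M p \<theta>])
    fix n
    have "(\<integral>\<^sup>+x. enn_powr (\<theta> n x) p \<partial>M) = ennreal (real (Suc n) powr p) * (\<integral>\<^sup>+x. enn_powr (\<eta> n x) p \<partial>M)"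
      unfolding \<theta>_def nn_integral_enn_powr_cmult[OF M \<eta>(1)]
      by (simp only: enn_powr_ennreal of_nat_0_le_iff)
    also have "\<dots> \<le> ennreal (real (Suc n) powr p) * ennreal ((1/2)^n / real (Suc n) powr p)"
      using \<eta>(3)[of n] by (intro mult_left_mono) auto
    also have "\<dots> = ennreal ((1/2)^n)" by (simp flip: ennreal_mult')
    finally show "(\<integral>\<^sup>+x. enn_powr (\<theta> n x) p \<partial>M) \<le> ennreal ((1/2)^n)" .
  qed
  ultimately show "ae_curve M p U P"
    unfolding ae_curve_def by (intro bexI[of _ "\<lambda>x. SUP n. \<theta> n x"]) auto
qed

lemma ae_curve_subcurves:
  assumes M: "sets M = sets borel" and ae: "ae_curve M p V P"
  shows "ae_curve M p U (\<lambda>\<gamma>. \<forall>a b. 0 \<le> a \<longrightarrow> a \<le> b \<longrightarrow> b \<le> 1 \<longrightarrow> \<gamma> ` {a..b} \<subseteq> V \<longrightarrow> P (subcurve a b \<gamma>))"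
proof -
  obtain \<eta> where \<eta>: "\<eta> \<in> borel_measurable borel" "(\<integral>\<^sup>+x. enn_powr (\<eta> x) p \<partial>M) < \<infinity>"
     "\<And>\<gamma>. rectifiable_curve V \<gamma> \<Longrightarrow> curve_integral \<gamma> \<eta> < \<infinity> \<Longrightarrow> P \<gamma>"
    using ae unfolding ae_curve_def by blast
  have "P (subcurve a b \<gamma>)"
    if \<gamma>: "rectifiable_curve U \<gamma>" "curve_integral \<gamma> \<eta> < \<infinity>" and ab: "0 \<le> a" "a \<le> b" "b \<le> 1" and V: "\<gamma> ` {a..b} \<subseteq> V"
    for \<gamma> a b
  proof (rule \<eta>(3))
    have rect: "rectifiable \<gamma>" using \<gamma> by (simp add: rectifiable_curve_iff)
    note sub = curve_integral_subcurve_le[OF rect ab \<eta>(1)]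
    show "rectifiable_curve V (subcurve a b \<gamma>)"
      using sub(1) V subcurve_image(1)[OF ab]
      by (auto simp: rectifiable_curve_iff path_image_def subcurve_def image_subset_iff)
    note sub(2)
    also have "(\<integral>\<^sup>+t\<in>{a<..b}. \<eta> (\<gamma> (unit_clamp t)) \<partial>curve_measure \<gamma>) \<le> curve_integral \<gamma> \<eta>"
      unfolding curve_integral_eq[OF rect \<eta>(1)] by (intro nn_integral_mono) (auto simp: indicator_def)
    also note \<gamma>(2)
    finally show "curve_integral (subcurve a b \<gamma>) \<eta> < \<infinity>" .
  qed
  with \<eta>(1,2) show ?thesis unfolding ae_curve_def by blast
qed

lemma ae_curve_finite_integral:
  assumes "g \<in> borel_measurable borel" "(\<integral>\<^sup>+x. enn_powr (g x) p \<partial>M) < \<infinity>"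
  shows "ae_curve M p U (\<lambda>\<gamma>. curve_integral \<gamma> g < \<infinity>)"
  using assms unfolding ae_curve_def by blast

text \<open>The function that is infinite on a null set and 0 elsewhere has energy 0.\<close>

lemma ae_curve_AE:
  assumes M [measurable_cong]: "sets M = sets borel" and N: "N \<in> null_sets M"
  shows "ae_curve M p U (\<lambda>\<gamma>. AE t in curve_measure \<gamma>. \<gamma> (unit_clamp t) \<notin> N)"
proof -
  have [measurable]: "N \<in> sets borel" using N M by auto
  let ?\<eta> = "\<lambda>x. \<infinity> * indicator N x :: ennreal"
  have "(\<integral>\<^sup>+x. enn_powr (?\<eta> x) p \<partial>M) = (\<integral>\<^sup>+x. \<infinity> * indicator N x \<partial>M)"
    by (intro nn_integral_cong) (auto simp: indicator_def)
  also have "\<dots> = 0" using N by (simp add: nn_integral_cmult_indicator null_setsD1)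
  finally have "ae_curve M p U (\<lambda>\<gamma>. curve_integral \<gamma> ?\<eta> < \<infinity>)"
    by (intro ae_curve_finite_integral) auto
  then show ?thesis
  proof (rule ae_curve_mono)
    fix \<gamma> assume \<gamma>: "rectifiable_curve U \<gamma>" "curve_integral \<gamma> ?\<eta> < \<infinity>"
    have rect: "rectifiable \<gamma>" using \<gamma> by (simp add: rectifiable_curve_iff)
    note [measurable] = measurable_curve_clamp[OF rect]
    have "(\<integral>\<^sup>+t. ?\<eta> (\<gamma> (unit_clamp t)) \<partial>curve_measure \<gamma>) \<noteq> \<infinity>"
      using \<gamma>(2) by (simp add: curve_integral_eq[OF rect])
    then have "AE t in curve_measure \<gamma>. ?\<eta> (\<gamma> (unit_clamp t)) \<noteq> \<infinity>"
      by (intro nn_integral_PInf_AE) auto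
    then show "AE t in curve_measure \<gamma>. \<gamma> (unit_clamp t) \<notin> N"
      by eventually_elim (auto simp: indicator_def)
  qed simp
qed

section \<open>Weak upper gradients along almost every curve\<close>

definition energy :: "'a::metric_space measure \<Rightarrow> real \<Rightarrow> 'a set \<Rightarrow> ('a \<Rightarrow> ennreal) \<Rightarrow> ennreal" where
  "energy M p U g = (\<integral>\<^sup>+x\<in>U. enn_powr (g x) p \<partial>M)"

lemma Lp_norm_eq: "Lp_norm M p U g = enn_powr (energy M p U g) (1 / p)"
  by (simp add: Lp_norm_def energy_def nn_integral_completion)

text \<open>Unlike the upper gradient inequality, which compares the end points only, the following condition
  is on all parameter intervals and includes finiteness of the line integral; it says that \<open>f\<close> is
  absolutely continuous along \<open>\<gamma>\<close> with speed at most \<open>g\<close> times the speed of \<open>\<gamma>\<close>.\<close>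

definition controlled ::
  "(real \<Rightarrow> 'a::metric_space) \<Rightarrow> ('a \<Rightarrow> 'b::metric_space) \<Rightarrow> ('a \<Rightarrow> ennreal) \<Rightarrow> bool" where
  "controlled \<gamma> f g \<longleftrightarrow> curve_integral \<gamma> g < \<infinity> \<and>
     (\<forall>a b. 0 \<le> a \<longrightarrow> a \<le> b \<longrightarrow> b \<le> 1 \<longrightarrow>
       ennreal (dist (f (\<gamma> a)) (f (\<gamma> b))) \<le> (\<integral>\<^sup>+t\<in>{a<..b}. g (\<gamma> (unit_clamp t)) \<partial>curve_measure \<gamma>))"

lemma controlledD:
  "controlled \<gamma> f g \<Longrightarrow> 0 \<le> a \<Longrightarrow> a \<le> b \<Longrightarrow> b \<le> 1 \<Longrightarrow>
    ennreal (dist (f (\<gamma> a)) (f (\<gamma> b))) \<le> (\<integral>\<^sup>+t\<in>{a<..b}. g (\<gamma> (unit_clamp t)) \<partial>curve_measure \<gamma>)"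
  by (simp add: controlled_def)

text \<open>Upper gradients on \<open>U\<close> are only meaningful on \<open>U\<close>; extended by zero they become Borel functions on
  the whole space.\<close>

definition zero_off :: "'a set \<Rightarrow> ('a \<Rightarrow> ennreal) \<Rightarrow> 'a \<Rightarrow> ennreal" where
  "zero_off U g x = g x * indicator U x"

lemma measurable_zero_off_iff:
  "open U \<Longrightarrow> g \<in> borel_measurable (restrict_space borel U) \<longleftrightarrow> zero_off U g \<in> borel_measurable borel"
  unfolding zero_off_def[abs_def] by (rule borel_measurable_restrict_space_iff_ennreal) simp

lemma energy_zero_off: "(\<integral>\<^sup>+x. enn_powr (zero_off U g x) p \<partial>M) = energy M p U g"
  by (simp add: energy_def zero_off_def enn_powr_mult)

lemma curve_integral_zero_off:
  "rectifiable_curve U \<gamma> \<Longrightarrow> curve_integral \<gamma> (zero_off U g) = curve_integral \<gamma> g"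
  by (rule curve_integral_cong) (auto simp: rectifiable_curve_iff zero_off_def)

text \<open>The upper gradient inequality holds along almost all curves in \<open>V\<close>. If it fails on a subcurve in
  \<open>V\<close> of some curve, that curve belongs to the exceptional family as well.\<close>

lemma ae_curve_local_control:
  assumes M: "sets M = sets borel" and p: "0 < p" and V: "open V"
    and g: "weak_upper_gradient M p V f g"
  shows "ae_curve M p U (\<lambda>\<gamma>. \<forall>a b. 0 \<le> a \<longrightarrow> a \<le> b \<longrightarrow> b \<le> 1 \<longrightarrow> \<gamma> ` {a..b} \<subseteq> V \<longrightarrow>
     ennreal (dist (f (\<gamma> a)) (f (\<gamma> b))) \<le> (\<integral>\<^sup>+t\<in>{a<..b}. zero_off V g (\<gamma> (unit_clamp t)) \<partial>curve_measure \<gamma>))"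
proof -
  have [measurable]: "zero_off V g \<in> borel_measurable borel"
    using g V by (simp add: weak_upper_gradient_def measurable_zero_off_iff)
  have "ae_curve M p V (upper_gradient_ineq f g)"
    using g unfolding weak_upper_gradient_def ae_curve_iff_modulus[OF M p] by blast
  then have "ae_curve M p V (\<lambda>\<gamma>. rectifiable_curve V \<gamma> \<and> upper_gradient_ineq f g \<gamma>)"
    by (rule ae_curve_mono) auto
  from ae_curve_subcurves[OF M this, of U] show ?thesis
  proof (rule ae_curve_mono, intro allI impI)
    fix \<gamma> a b
    assume \<gamma>: "rectifiable_curve U \<gamma>" and
      all: "\<forall>a b. 0 \<le> a \<longrightarrow> a \<le> b \<longrightarrow> b \<le> 1 \<longrightarrow> \<gamma> ` {a..b} \<subseteq> V \<longrightarrow>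
        rectifiable_curve V (subcurve a b \<gamma>) \<and> upper_gradient_ineq f g (subcurve a b \<gamma>)"
      and ab: "0 \<le> a" "a \<le> b" "b \<le> 1" and V: "\<gamma> ` {a..b} \<subseteq> V"
    have rect: "rectifiable \<gamma>" using \<gamma> by (simp add: rectifiable_curve_iff)
    have sub: "rectifiable_curve V (subcurve a b \<gamma>)" "upper_gradient_ineq f g (subcurve a b \<gamma>)"
      using all ab V by blast+
    have "ennreal (dist (f (\<gamma> a)) (f (\<gamma> b))) \<le> curve_integral (subcurve a b \<gamma>) g"
      using sub(2) by (simp add: upper_gradient_ineq_def dist_real_def subcurve_def pathstart_def pathfinish_def)
    also have "\<dots> = curve_integral (subcurve a b \<gamma>) (zero_off V g)"
      using sub(1) by (rule curve_integral_zero_off[symmetric])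
    also have "\<dots> \<le> (\<integral>\<^sup>+t\<in>{a<..b}. zero_off V g (\<gamma> (unit_clamp t)) \<partial>curve_measure \<gamma>)"
      by (rule curve_integral_subcurve_le(2)[OF rect ab]) measurable
    finally show "ennreal (dist (f (\<gamma> a)) (f (\<gamma> b))) \<le> (\<integral>\<^sup>+t\<in>{a<..b}. zero_off V g (\<gamma> (unit_clamp t)) \<partial>curve_measure \<gamma>)" .
  qed simp
qed

lemma ae_curve_controlled:
  assumes M: "sets M = sets borel" and p: "0 < p" and U: "open U"
    and g: "weak_upper_gradient M p U f g" "energy M p U g < \<infinity>"
  shows "ae_curve M p U (\<lambda>\<gamma>. controlled \<gamma> f (zero_off U g))"
proof -
  have meas: "zero_off U g \<in> borel_measurable borel"
    using g U by (simp add: weak_upper_gradient_def measurable_zero_off_iff)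
  have "ae_curve M p U (\<lambda>\<gamma>. curve_integral \<gamma> (zero_off U g) < \<infinity>)"
    by (rule ae_curve_finite_integral[OF meas]) (use g(2) in \<open>simp add: energy_zero_off\<close>)
  from ae_curve_conj[OF M p this ae_curve_local_control[OF M p U g(1)]] show ?thesis
  proof (rule ae_curve_mono)
    fix \<gamma> assume \<gamma>: "rectifiable_curve U \<gamma>" and
      *: "curve_integral \<gamma> (zero_off U g) < \<infinity> \<and> (\<forall>a b. 0 \<le> a \<longrightarrow> a \<le> b \<longrightarrow> b \<le> 1 \<longrightarrow> \<gamma> ` {a..b} \<subseteq> U \<longrightarrow>
     ennreal (dist (f (\<gamma> a)) (f (\<gamma> b))) \<le> (\<integral>\<^sup>+t\<in>{a<..b}. zero_off U g (\<gamma> (unit_clamp t)) \<partial>curve_measure \<gamma>))"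
    have "\<gamma> ` {a..b} \<subseteq> U" if "0 \<le> a" "b \<le> 1" for a b
      using \<gamma> that by (auto simp: rectifiable_curve_def path_image_def image_subset_iff)
    with * show "controlled \<gamma> f (zero_off U g)" by (simp add: controlled_def)
  qed simp
qed

lemma weak_upper_gradientI:
  assumes M: "sets M = sets borel" and p: "0 < p" and U: "open U"
    and g: "zero_off U g \<in> borel_measurable borel"
    and ctl: "ae_curve M p U (\<lambda>\<gamma>. ennreal \<bar>f (\<gamma> 0) - f (\<gamma> 1)\<bar> \<le> curve_integral \<gamma> (zero_off U g))"
  shows "weak_upper_gradient M p U f g"
proof -
  have "ae_curve M p U (upper_gradient_ineq f g)"
    using ctl by (rule ae_curve_mono)
      (auto simp: upper_gradient_ineq_def pathstart_def pathfinish_def curve_integral_zero_off)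
  then show ?thesis
    using g U unfolding weak_upper_gradient_def ae_curve_iff_modulus[OF M p]
    by (auto simp: measurable_zero_off_iff)
qed

lemma controlled_ends:
  assumes c: "rectifiable \<gamma>" and g: "g \<in> borel_measurable borel" and ctl: "controlled \<gamma> f g"
  shows "ennreal (dist (f (\<gamma> 0)) (f (\<gamma> 1))) \<le> curve_integral \<gamma> g"
proof -
  have "ennreal (dist (f (\<gamma> 0)) (f (\<gamma> 1))) \<le> (\<integral>\<^sup>+t\<in>{0<..1}. g (\<gamma> (unit_clamp t)) \<partial>curve_measure \<gamma>)"
    using ctl by (rule controlledD) auto
  also have "\<dots> \<le> curve_integral \<gamma> g"
    unfolding curve_integral_eq[OF c g] by (intro nn_integral_mono) (auto simp: indicator_def)
  finally show ?thesis .
qed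

lemma weak_upper_gradient_if_controlled:
  assumes M: "sets M = sets borel" and p: "0 < p" and U: "open U"
    and g: "zero_off U g \<in> borel_measurable borel"
    and ctl: "ae_curve M p U (\<lambda>\<gamma>. controlled \<gamma> f (zero_off U g))"
  shows "weak_upper_gradient M p U (f :: 'a::metric_space \<Rightarrow> real) g"
  using M p U g
proof (rule weak_upper_gradientI)
  show "ae_curve M p U (\<lambda>\<gamma>. ennreal \<bar>f (\<gamma> 0) - f (\<gamma> 1)\<bar> \<le> curve_integral \<gamma> (zero_off U g))"
    using ctl
    by (rule ae_curve_mono)
      (use controlled_ends[OF _ g, of _ f] in \<open>auto simp: rectifiable_curve_iff dist_real_def\<close>)
qed

section \<open>Gluing\<close>

lemma curve_measure_singleton:
  assumes c: "rectifiable c" shows "emeasure (curve_measure c) {t} = 0"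
proof -
  have "(arc_length c \<longlongrightarrow> arc_length c t) (at_left t)"
    using arc_length_continuous_left[OF c, of t] by (simp add: continuous_within)
  then have "((\<lambda>s. ennreal (arc_length c t - arc_length c s)) \<longlongrightarrow> ennreal (arc_length c t - arc_length c t)) (at_left t)"
    by (intro tendsto_ennrealI tendsto_diff tendsto_const)
  moreover have "\<forall>\<^sub>F s in at_left t. emeasure (curve_measure c) {t} \<le> ennreal (arc_length c t - arc_length c s)"
    using eventually_at_left_real[of "t - 1" t, simplified]
  proof eventually_elim
    case (elim s)
    then have "emeasure (curve_measure c) {t} \<le> emeasure (curve_measure c) {s<..t}"
      by (intro emeasure_mono) auto
    also have "\<dots> = ennreal (arc_length c t - arc_length c s)"
      using elim by (intro emeasure_curve_measure_Ioc[OF c]) auto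
    finally show ?case .
  qed
  ultimately have "emeasure (curve_measure c) {t} \<le> ennreal (arc_length c t - arc_length c t)"
    by (rule tendsto_lowerbound) simp
  then show ?thesis by simp
qed

context
  fixes \<gamma> :: "real \<Rightarrow> 'a::metric_space" and g :: "'a \<Rightarrow> ennreal"
  assumes \<gamma>: "rectifiable \<gamma>" and g [measurable]: "g \<in> borel_measurable borel"
begin

definition weighted_measure :: "real measure" where
  "weighted_measure = density (curve_measure \<gamma>) (\<lambda>t. g (\<gamma> (unit_clamp t)))"

lemma sets_weighted_measure [measurable_cong, simp]: "sets weighted_measure = sets borel"
  by (simp add: weighted_measure_def)

lemma emeasure_weighted_measure:
  assumes [measurable]: "B \<in> sets borel"
  shows "emeasure weighted_measure B = (\<integral>\<^sup>+t\<in>B. g (\<gamma> (unit_clamp t)) \<partial>curve_measure \<gamma>)"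
proof -
  note [measurable] = measurable_curve_clamp[OF \<gamma>]
  show ?thesis unfolding weighted_measure_def by (rule emeasure_density) measurable
qed

lemma finite_measure_weighted_measure:
  assumes "curve_integral \<gamma> g < \<infinity>" shows "finite_measure weighted_measure"
  by (rule finite_measureI)
     (use assms in \<open>simp add: emeasure_weighted_measure curve_integral_eq[OF \<gamma> g] weighted_measure_def[THEN arg_cong, of space]\<close>)

lemma nn_integral_weighted_measure:
  assumes [measurable]: "f \<in> borel_measurable borel"
  shows "(\<integral>\<^sup>+t. f t \<partial>weighted_measure) = (\<integral>\<^sup>+t. g (\<gamma> (unit_clamp t)) * f t \<partial>curve_measure \<gamma>)"
proof -
  note [measurable] = measurable_curve_clamp[OF \<gamma>]
  show ?thesis unfolding weighted_measure_def by (rule nn_integral_density) measurable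
qed

lemma weighted_measure_singleton: "emeasure weighted_measure {t} = 0"
proof -
  have "(\<integral>\<^sup>+s\<in>{t}. g (\<gamma> (unit_clamp s)) \<partial>curve_measure \<gamma>) = (\<integral>\<^sup>+s. 0 \<partial>curve_measure \<gamma>)"
    by (rule nn_integral_cong_AE, rule AE_I'[of "{t}"])
       (auto simp: curve_measure_singleton[OF \<gamma>] null_sets_def indicator_def split: if_splits)
  then show ?thesis by (simp add: emeasure_weighted_measure)
qed

text \<open>The weighted arc length measure of \<open>\<gamma>\<close> bounds the increments of \<open>f \<circ> \<gamma>\<close>. Since it has no atoms,
  \<open>f \<circ> \<gamma>\<close> is continuous even if \<open>f\<close> is not.\<close>

lemma controlled_image:
  fixes f :: "'a \<Rightarrow> 'b::metric_space"
  assumes ctl: "controlled \<gamma> f g"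
  shows "finite_measure weighted_measure" "rectifiable (f \<circ> \<gamma>)"
    "\<And>a b. 0 \<le> a \<Longrightarrow> a \<le> b \<Longrightarrow> b \<le> 1 \<Longrightarrow>
      ennreal (dist ((f \<circ> \<gamma>) a) ((f \<circ> \<gamma>) b)) \<le> emeasure weighted_measure {a<..b}"
proof -
  show fin: "finite_measure weighted_measure"
    using ctl by (intro finite_measure_weighted_measure) (simp add: controlled_def)
  interpret finite_borel_measure weighted_measure
    by (intro finite_borel_measure.intro finite_borel_measure_axioms.intro fin)
      (simp add: weighted_measure_def)
  show dom: "ennreal (dist ((f \<circ> \<gamma>) a) ((f \<circ> \<gamma>) b)) \<le> emeasure weighted_measure {a<..b}"
    if "0 \<le> a" "a \<le> b" "b \<le> 1" for a b
    using controlledD[OF ctl that] by (simp add: emeasure_weighted_measure)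
  have "isCont (cdf weighted_measure) t" for t
    unfolding isCont_cdf by (simp add: measure_def weighted_measure_singleton)
  then have cont: "continuous_on {0..1} (cdf weighted_measure)"
    by (intro continuous_at_imp_continuous_on) auto
  have dist_le: "dist ((f \<circ> \<gamma>) a) ((f \<circ> \<gamma>) b) \<le> \<bar>cdf weighted_measure a - cdf weighted_measure b\<bar>"
    if ab: "a \<in> {0..1}" "b \<in> {0..1}" for a b
  proof -
    have "dist ((f \<circ> \<gamma>) a) ((f \<circ> \<gamma>) b) \<le> \<bar>cdf weighted_measure b - cdf weighted_measure a\<bar>"
      if "a < b" "0 \<le> a" "b \<le> 1" for a b
    proof -
      have "ennreal (dist ((f \<circ> \<gamma>) a) ((f \<circ> \<gamma>) b)) \<le> ennreal (measure weighted_measure {a<..b})"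
        using dom[of a b] that by (simp add: emeasure_eq_measure)
      then show ?thesis using cdf_diff_eq[OF \<open>a < b\<close>] by (simp add: ennreal_le_iff)
    qed
    from this[of a b] this[of b a] ab show ?thesis
      by (cases a b rule: linorder_cases) (auto simp: dist_commute abs_minus_commute)
  qed
  have "continuous_on {0..1} (f \<circ> \<gamma>)"
    unfolding continuous_on_iff
  proof (intro ballI allI impI)
    fix t e :: real assume t: "t \<in> {0..1}" and e: "0 < e"
    obtain d where d: "0 < d" "\<And>s. s \<in> {0..1} \<Longrightarrow> dist s t < d \<Longrightarrow> dist (cdf weighted_measure s) (cdf weighted_measure t) < e"
      using cont t e unfolding continuous_on_iff by blast
    show "\<exists>d>0. \<forall>s\<in>{0..1}. dist s t < d \<longrightarrow> dist ((f \<circ> \<gamma>) s) ((f \<circ> \<gamma>) t) < e"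
    proof (intro exI[of _ d] conjI ballI impI d(1))
      fix s assume s: "s \<in> {0..1}" "dist s t < d"
      then show "dist ((f \<circ> \<gamma>) s) ((f \<circ> \<gamma>) t) < e"
        using dist_le[OF s(1) t] d(2)[OF s] by (simp add: dist_real_def)
    qed
  qed
  then show "rectifiable (f \<circ> \<gamma>)"
    by (intro rectifiable_if_dominated[OF fin _ dom]) (auto simp: path_def)
qed

end

text \<open>The arc length measure of \<open>f \<circ> \<gamma>\<close> is bounded on all Borel sets of parameters by the measure weighted
  with \<open>g\<close>, and on those mapped into \<open>V\<close> by the one weighted with \<open>h\<close>. Splitting a parameter interval
  according to which weight is smaller combines the two bounds.\<close>

lemma controlled_glue:
  fixes f :: "'a::metric_space \<Rightarrow> 'b::metric_space"
  assumes \<gamma>: "rectifiable \<gamma>" and g [measurable]: "g \<in> borel_measurable borel" and h [measurable]: "h \<in> borel_measurable borel"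
    and ctl: "controlled \<gamma> f g" and fin: "curve_integral \<gamma> h < \<infinity>" and V: "open V"
    and loc: "\<And>a b. 0 \<le> a \<Longrightarrow> a \<le> b \<Longrightarrow> b \<le> 1 \<Longrightarrow> \<gamma> ` {a..b} \<subseteq> V \<Longrightarrow>
       ennreal (dist (f (\<gamma> a)) (f (\<gamma> b))) \<le> (\<integral>\<^sup>+t\<in>{a<..b}. h (\<gamma> (unit_clamp t)) \<partial>curve_measure \<gamma>)"
  shows "controlled \<gamma> f (\<lambda>x. if x \<in> V then min (g x) (h x) else g x)"
proof -
  note [measurable] = measurable_curve_clamp[OF \<gamma>]
  have V' [measurable]: "V \<in> sets borel" using V by simp
  define k where "k x = (if x \<in> V then min (g x) (h x) else g x)" for x
  have k [measurable]: "k \<in> borel_measurable borel" unfolding k_def[abs_def] by measurable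
  note img = controlled_image[OF \<gamma> g ctl]
  let ?c = "f \<circ> \<gamma>" and ?m = "weighted_measure \<gamma> g" and ?n = "weighted_measure \<gamma> h"
  define W where "W = (\<lambda>t. \<gamma> (unit_clamp t)) -` V"
  have W: "open W"
    unfolding W_def using \<gamma> V by (intro open_vimage continuous_on_unit_clamp) (auto simp: rectifiable_def)
  define A where "A = {t. \<gamma> (unit_clamp t) \<in> V \<and> h (\<gamma> (unit_clamp t)) < g (\<gamma> (unit_clamp t))}"
  have A [measurable]: "A \<in> sets borel" unfolding A_def by measurable
  have loc': "ennreal (dist (?c a) (?c b)) \<le> emeasure ?n {a<..b}"
    if "0 \<le> a" "a \<le> b" "b \<le> 1" "{a..b} \<subseteq> W" for a b
  proof -
    have "\<gamma> t \<in> V" if "t \<in> {a..b}" for t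
      using \<open>{a..b} \<subseteq> W\<close> that \<open>0 \<le> a\<close> \<open>b \<le> 1\<close> unit_clamp_simps(3)[of t] by (force simp: W_def)
    then have "\<gamma> ` {a..b} \<subseteq> V" by blast
    then show ?thesis using loc[of a b] that by (simp add: emeasure_weighted_measure[OF \<gamma> h])
  qed
  have "ennreal (dist (f (\<gamma> a)) (f (\<gamma> b))) \<le> (\<integral>\<^sup>+t\<in>{a<..b}. k (\<gamma> (unit_clamp t)) \<partial>curve_measure \<gamma>)"
    if ab: "0 \<le> a" "a \<le> b" "b \<le> 1" for a b
  proof -
    have "ennreal (dist (f (\<gamma> a)) (f (\<gamma> b))) \<le> ennreal (arc_length ?c b - arc_length ?c a)"
      using dist_le_arc_length[OF img(2) ab] by (intro ennreal_leI) simp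
    also have "\<dots> = emeasure (curve_measure ?c) {a<..b}"
      using ab by (intro emeasure_curve_measure_Ioc[OF img(2), symmetric])
    also have "{a<..b} = ({a<..b} \<inter> A) \<union> ({a<..b} - A)" by auto
    also have "emeasure (curve_measure ?c) \<dots> = emeasure (curve_measure ?c) ({a<..b} \<inter> A) + emeasure (curve_measure ?c) ({a<..b} - A)"
      by (intro plus_emeasure[symmetric]) auto
    also have "\<dots> \<le> emeasure ?n ({a<..b} \<inter> A) + emeasure ?m ({a<..b} - A)"
    proof (rule add_mono)
      show "emeasure (curve_measure ?c) ({a<..b} \<inter> A) \<le> emeasure ?n ({a<..b} \<inter> A)"
        by (rule curve_measure_le[OF img(2) finite_measure_weighted_measure[OF \<gamma> h fin] _ W loc'])
           (auto simp: sets_weighted_measure[OF \<gamma> h] A_def W_def)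
      show "emeasure (curve_measure ?c) ({a<..b} - A) \<le> emeasure ?m ({a<..b} - A)"
        by (rule curve_measure_le[OF img(2) img(1) _ open_UNIV img(3)])
           (auto simp: sets_weighted_measure[OF \<gamma> g])
    qed
    also have "\<dots> = (\<integral>\<^sup>+t\<in>{a<..b} \<inter> A. h (\<gamma> (unit_clamp t)) \<partial>curve_measure \<gamma>) + (\<integral>\<^sup>+t\<in>{a<..b} - A. g (\<gamma> (unit_clamp t)) \<partial>curve_measure \<gamma>)"
      by (simp add: emeasure_weighted_measure[OF \<gamma> g] emeasure_weighted_measure[OF \<gamma> h])
    also have "\<dots> = (\<integral>\<^sup>+t. h (\<gamma> (unit_clamp t)) * indicator ({a<..b} \<inter> A) t + g (\<gamma> (unit_clamp t)) * indicator ({a<..b} - A) t \<partial>curve_measure \<gamma>)"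
      by (intro nn_integral_add[symmetric]) auto
    also have "\<dots> = (\<integral>\<^sup>+t\<in>{a<..b}. k (\<gamma> (unit_clamp t)) \<partial>curve_measure \<gamma>)"
      by (intro nn_integral_cong) (auto simp: indicator_def k_def A_def min_def)
    finally show ?thesis .
  qed
  moreover have "curve_integral \<gamma> k < \<infinity>"
  proof -
    have "curve_integral \<gamma> k \<le> curve_integral \<gamma> g"
      by (rule curve_integral_mono) (auto simp: k_def)
    also have "\<dots> < \<infinity>" using ctl by (simp add: controlled_def)
    finally show ?thesis .
  qed
  ultimately have "controlled \<gamma> f k" by (simp add: controlled_def)
  then show ?thesis by (simp add: k_def[abs_def])
qed

section \<open>Minimal weak upper gradients\<close>

lemma energy_mono:
  assumes "0 \<le> p" "\<And>x. x \<in> U \<Longrightarrow> g x \<le> h x" "U \<subseteq> V"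
  shows "energy M p U g \<le> energy M p V h"
  unfolding energy_def using assms
  by (intro nn_integral_mono) (auto simp: indicator_def intro!: enn_powr_mono)

lemma weak_upper_gradient_subset:
  assumes "weak_upper_gradient M p U f g" "open U" "open V" "V \<subseteq> U"
  shows "weak_upper_gradient M p V f g"
proof -
  have "g \<in> borel_measurable (restrict_space borel V)"
    using assms by (intro measurable_restrict_mono[of g borel U borel V]) (auto simp: weak_upper_gradient_def)
  moreover have "rectifiable_curve U \<gamma>" if "rectifiable_curve V \<gamma>" for \<gamma>
    using that \<open>V \<subseteq> U\<close> by (auto simp: rectifiable_curve_def)
  ultimately show ?thesis using assms(1) unfolding weak_upper_gradient_def by blast
qed

context
  fixes M :: "'a::metric_space measure" and p :: real and U :: "'a set"
  assumes M [measurable_cong]: "sets M = sets borel" and p: "0 < p" and U: "open U"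
begin

lemma measurable_zero_off_weak:
  "weak_upper_gradient M p U f g \<Longrightarrow> zero_off U g \<in> borel_measurable borel"
  using U by (simp add: weak_upper_gradient_def measurable_zero_off_iff)

text \<open>Along a curve the smaller of two controls may be used on any open set on which both are valid. With
  \<open>V = U\<close> this is the lattice property of upper gradients, with smaller \<open>V\<close> their locality.\<close>

lemma weak_upper_gradient_glue:
  assumes g: "weak_upper_gradient M p U f g" "energy M p U g < \<infinity>"
    and h: "weak_upper_gradient M p V f h" "energy M p V h < \<infinity>"
    and V: "open V" "V \<subseteq> U"
  shows "weak_upper_gradient M p U f (\<lambda>x. if x \<in> V then min (g x) (h x) else g x)"
proof (rule weak_upper_gradient_if_controlled[OF M p U])
  have [measurable]: "zero_off U g \<in> borel_measurable borel" "zero_off V h \<in> borel_measurable borel" "V \<in> sets borel"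
    using g h V U by (auto simp: weak_upper_gradient_def measurable_zero_off_iff)
  have eq: "zero_off U (\<lambda>x. if x \<in> V then min (g x) (h x) else g x) =
      (\<lambda>x. if x \<in> V then min (zero_off U g x) (zero_off V h x) else zero_off U g x)"
    using V by (auto simp: zero_off_def fun_eq_iff indicator_def)
  show "zero_off U (\<lambda>x. if x \<in> V then min (g x) (h x) else g x) \<in> borel_measurable borel"
    unfolding eq by measurable
  have "ae_curve M p U (\<lambda>\<gamma>. curve_integral \<gamma> (zero_off V h) < \<infinity>)"
    by (rule ae_curve_finite_integral) (use h(2) in \<open>simp_all add: energy_zero_off\<close>)
  from ae_curve_conj[OF M p this ae_curve_conj[OF M p ae_curve_controlled[OF M p U g] ae_curve_local_control[OF M p V(1) h(1)]]]
  show "ae_curve M p U (\<lambda>\<gamma>. controlled \<gamma> f (zero_off U (\<lambda>x. if x \<in> V then min (g x) (h x) else g x)))"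
    unfolding eq by (rule ae_curve_mono) (auto intro!: controlled_glue V simp: rectifiable_curve_iff)
qed

lemma weak_upper_gradient_min:
  assumes "weak_upper_gradient M p U f g" "energy M p U g < \<infinity>"
    and "weak_upper_gradient M p U f h" "energy M p U h < \<infinity>"
  shows "weak_upper_gradient M p U f (\<lambda>x. min (g x) (h x))"
proof -
  have *: "zero_off U (\<lambda>x. if x \<in> U then min (g x) (h x) else g x) = zero_off U (\<lambda>x. min (g x) (h x))"
    by (auto simp: zero_off_def fun_eq_iff indicator_def)
  have w: "weak_upper_gradient M p U f (\<lambda>x. if x \<in> U then min (g x) (h x) else g x)"
    by (rule weak_upper_gradient_glue[OF assms U order_refl])
  have "energy M p U (\<lambda>x. if x \<in> U then min (g x) (h x) else g x) < \<infinity>"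
    using energy_mono[of p U "\<lambda>x. if x \<in> U then min (g x) (h x) else g x" g U M] p assms(2)
    by (auto intro: le_less_trans)
  from ae_curve_controlled[OF M p U w this] measurable_zero_off_weak[OF w] show ?thesis
    unfolding * by (intro weak_upper_gradient_if_controlled[OF M p U])
qed

lemma weak_upper_gradient_INF:
  fixes g :: "nat \<Rightarrow> 'a \<Rightarrow> ennreal"
  assumes g: "\<And>n. weak_upper_gradient M p U f (g n)" "\<And>n. energy M p U (g n) < \<infinity>"
    and dec: "\<And>n x. g (Suc n) x \<le> g n x"
  shows "weak_upper_gradient M p U f (\<lambda>x. INF n. g n x)"
proof (rule weak_upper_gradient_if_controlled[OF M p U])
  have meas [measurable]: "zero_off U (g n) \<in> borel_measurable borel" for n
    by (rule measurable_zero_off_weak[OF g(1)])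
  have eq: "zero_off U (\<lambda>x. INF n. g n x) = (\<lambda>x. INF n. zero_off U (g n) x)"
    by (auto simp: zero_off_def fun_eq_iff indicator_def)
  show lim [measurable]: "zero_off U (\<lambda>x. INF n. g n x) \<in> borel_measurable borel"
    unfolding eq by measurable
  have "ae_curve M p U (\<lambda>\<gamma>. \<forall>n. controlled \<gamma> f (zero_off U (g n)))"
    by (intro ae_curve_all M p ae_curve_controlled U g)
  then show "ae_curve M p U (\<lambda>\<gamma>. controlled \<gamma> f (zero_off U (\<lambda>x. INF n. g n x)))"
  proof (rule ae_curve_mono)
    fix \<gamma> assume "rectifiable_curve U \<gamma>" and ctl: "\<forall>n. controlled \<gamma> f (zero_off U (g n))"
    then have rect: "rectifiable \<gamma>" by (simp add: rectifiable_curve_iff)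
    note [measurable] = measurable_curve_clamp[OF rect]
    have dec': "zero_off U (g n) x \<le> zero_off U (g m) x" if "m \<le> n" for m n x
      using lift_Suc_antimono_le[of "\<lambda>n. g n x" m n] dec that by (auto simp: zero_off_def indicator_def)
    have fin: "curve_integral \<gamma> (zero_off U (g n)) < \<infinity>" for n
      using ctl by (simp add: controlled_def)
    show "controlled \<gamma> f (zero_off U (\<lambda>x. INF n. g n x))"
      unfolding controlled_def
    proof (intro conjI allI impI)
      have "curve_integral \<gamma> (zero_off U (\<lambda>x. INF n. g n x)) \<le> curve_integral \<gamma> (zero_off U (g 0))"
        unfolding eq by (intro curve_integral_mono INF_lower) simp
      also note fin
      finally show "curve_integral \<gamma> (zero_off U (\<lambda>x. INF n. g n x)) < \<infinity>" .
    next
      fix a b :: real assume ab: "0 \<le> a" "a \<le> b" "b \<le> 1"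
      have "ennreal (dist (f (\<gamma> a)) (f (\<gamma> b))) \<le> (INF n. \<integral>\<^sup>+t\<in>{a<..b}. zero_off U (g n) (\<gamma> (unit_clamp t)) \<partial>curve_measure \<gamma>)"
        using ctl ab by (intro INF_greatest) (simp add: controlledD)
      also have "\<dots> = (\<integral>\<^sup>+t. (INF n. zero_off U (g n) (\<gamma> (unit_clamp t)) * indicator {a<..b} t) \<partial>curve_measure \<gamma>)"
      proof (rule nn_integral_monotone_convergence_INF_decseq[symmetric])
        show "decseq (\<lambda>n t. zero_off U (g n) (\<gamma> (unit_clamp t)) * indicator {a<..b} t)"
          by (intro antimonoI le_funI mult_right_mono dec') auto
        have "(\<integral>\<^sup>+t\<in>{a<..b}. zero_off U (g 0) (\<gamma> (unit_clamp t)) \<partial>curve_measure \<gamma>) \<le> curve_integral \<gamma> (zero_off U (g 0))"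
          unfolding curve_integral_eq[OF rect meas] by (intro nn_integral_mono) (auto simp: indicator_def)
        also note fin
        finally show "(\<integral>\<^sup>+t\<in>{a<..b}. zero_off U (g 0) (\<gamma> (unit_clamp t)) \<partial>curve_measure \<gamma>) < \<infinity>" .
      qed measurable
      also have "\<dots> = (\<integral>\<^sup>+t\<in>{a<..b}. zero_off U (\<lambda>x. INF n. g n x) (\<gamma> (unit_clamp t)) \<partial>curve_measure \<gamma>)"
        unfolding eq by (intro nn_integral_cong) (auto simp: indicator_def)
      finally show "ennreal (dist (f (\<gamma> a)) (f (\<gamma> b)))
         \<le> (\<integral>\<^sup>+t\<in>{a<..b}. zero_off U (\<lambda>x. INF n. g n x) (\<gamma> (unit_clamp t)) \<partial>curve_measure \<gamma>)" .
    qed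
  qed simp
qed

text \<open>Almost no curve spends positive length in a given null set.\<close>

lemma weak_upper_gradient_AE_mono:
  assumes g: "weak_upper_gradient M p U f g" "energy M p U g < \<infinity>"
    and h [measurable]: "zero_off U h \<in> borel_measurable borel"
    and le: "AE x in M. x \<in> U \<longrightarrow> g x \<le> h x"
  shows "weak_upper_gradient M p U f h"
proof (rule weak_upper_gradientI[OF M p U h])
  have meas [measurable]: "zero_off U g \<in> borel_measurable borel" by (rule measurable_zero_off_weak[OF g(1)])
  have "AE x in M. zero_off U g x \<le> zero_off U h x"
    using le by eventually_elim (auto simp: zero_off_def indicator_def)
  then have N: "{x. \<not> zero_off U g x \<le> zero_off U h x} \<in> null_sets M"
    by (subst (asm) AE_iff_null) (use sets_eq_imp_space_eq[OF M] in auto)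
  from ae_curve_conj[OF M p ae_curve_AE[OF M N] ae_curve_controlled[OF M p U g]]
  show "ae_curve M p U (\<lambda>\<gamma>. ennreal \<bar>f (\<gamma> 0) - f (\<gamma> 1)\<bar> \<le> curve_integral \<gamma> (zero_off U h))"
  proof (rule ae_curve_mono)
    fix \<gamma> assume \<gamma>: "rectifiable_curve U \<gamma>" and
      *: "(AE t in curve_measure \<gamma>. \<gamma> (unit_clamp t) \<notin> {x. \<not> zero_off U g x \<le> zero_off U h x}) \<and> controlled \<gamma> f (zero_off U g)"
    then have rect: "rectifiable \<gamma>" by (simp add: rectifiable_curve_iff)
    have "ennreal \<bar>f (\<gamma> 0) - f (\<gamma> 1)\<bar> \<le> curve_integral \<gamma> (zero_off U g)"
      using controlled_ends[OF rect meas, of f] * by (simp add: dist_real_def)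
    also have "\<dots> \<le> curve_integral \<gamma> (zero_off U h)"
      unfolding curve_integral_eq[OF rect meas] curve_integral_eq[OF rect h]
      using * by (intro nn_integral_mono_AE) auto
    finally show "ennreal \<bar>f (\<gamma> 0) - f (\<gamma> 1)\<bar> \<le> curve_integral \<gamma> (zero_off U h)" .
  qed simp
qed

end

text \<open>The common weak upper gradients of a family \<open>F\<close>. For \<open>F = {f}\<close> these are the upper gradients of a
  function, for the distance functions of a map those of the map.\<close>

definition common_ug ::
  "'a::metric_space measure \<Rightarrow> real \<Rightarrow> 'a set \<Rightarrow> ('a \<Rightarrow> real) set \<Rightarrow> ('a \<Rightarrow> ennreal) set" where
  "common_ug M p U F = {g. (\<forall>f\<in>F. weak_upper_gradient M p U f g) \<and> energy M p U g < \<infinity>}"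

definition least_ug ::
  "'a::metric_space measure \<Rightarrow> real \<Rightarrow> 'a set \<Rightarrow> ('a \<Rightarrow> real) set \<Rightarrow> ('a \<Rightarrow> ennreal) \<Rightarrow> bool" where
  "least_ug M p U F g \<longleftrightarrow> g \<in> common_ug M p U F \<and>
     (\<forall>h\<in>common_ug M p U F. AE x in M. x \<in> U \<longrightarrow> g x \<le> h x)"

context
  fixes M :: "'a::metric_space measure" and p :: real and U :: "'a set" and F :: "('a \<Rightarrow> real) set"
  assumes M [measurable_cong]: "sets M = sets borel" and p: "0 < p" and U: "open U" and F: "F \<noteq> {}"
begin

lemma common_ug_measurable: "g \<in> common_ug M p U F \<Longrightarrow> zero_off U g \<in> borel_measurable borel"
  using F U by (auto simp: common_ug_def weak_upper_gradient_def measurable_zero_off_iff)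

lemma common_ug_min:
  assumes "g \<in> common_ug M p U F" "h \<in> common_ug M p U F"
  shows "(\<lambda>x. min (g x) (h x)) \<in> common_ug M p U F"
proof -
  have "energy M p U (\<lambda>x. min (g x) (h x)) \<le> energy M p U g"
    using p by (intro energy_mono) auto
  then show ?thesis
    using assms weak_upper_gradient_min[OF M p U] by (auto simp: common_ug_def intro: le_less_trans)
qed

lemma common_ug_glue:
  assumes g: "g \<in> common_ug M p U F" and h: "h \<in> common_ug M p V F" and V: "open V" "V \<subseteq> U"
  shows "(\<lambda>x. if x \<in> V then min (g x) (h x) else g x) \<in> common_ug M p U F"
proof -
  have "energy M p U (\<lambda>x. if x \<in> V then min (g x) (h x) else g x) \<le> energy M p U g"
    using p by (intro energy_mono) auto
  then show ?thesis
    using g h weak_upper_gradient_glue[OF M p U _ _ _ _ V] by (auto simp: common_ug_def intro: le_less_trans)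
qed

text \<open>The energies of \<open>g\<close> and of \<open>min g h \<le> g\<close> are then equal and finite.\<close>

lemma energy_eq_imp_AE_le:
  assumes g: "g \<in> common_ug M p U F" and h: "h \<in> common_ug M p U F"
    and le: "energy M p U g \<le> energy M p U (\<lambda>x. min (g x) (h x))"
  shows "AE x in M. x \<in> U \<longrightarrow> g x \<le> h x"
proof -
  have [measurable]: "zero_off U g \<in> borel_measurable borel" "zero_off U h \<in> borel_measurable borel"
    using g h by (auto intro: common_ug_measurable)
  define G where "G x = enn_powr (zero_off U g x) p" for x
  define H where "H x = enn_powr (min (zero_off U g x) (zero_off U h x)) p" for x
  have meas [measurable]: "G \<in> borel_measurable M" "H \<in> borel_measurable M"
    unfolding G_def[abs_def] H_def[abs_def] by measurable
  have HG: "H x \<le> G x" for x unfolding H_def G_def using p by (intro enn_powr_mono) auto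
  have intG: "(\<integral>\<^sup>+x. G x \<partial>M) = energy M p U g" by (simp add: G_def energy_zero_off)
  have intH: "(\<integral>\<^sup>+x. H x \<partial>M) = energy M p U (\<lambda>x. min (g x) (h x))"
    unfolding energy_zero_off[symmetric] H_def
    by (intro nn_integral_cong) (auto simp: zero_off_def indicator_def)
  have fin: "(\<integral>\<^sup>+x. G x \<partial>M) < \<infinity>" using g by (simp add: intG common_ug_def)
  have "(\<integral>\<^sup>+x. H x \<partial>M) \<noteq> \<infinity>" using nn_integral_mono[of M H G] HG fin by (auto simp: top_unique)
  then have "(\<integral>\<^sup>+x. G x - H x \<partial>M) = (\<integral>\<^sup>+x. G x \<partial>M) - (\<integral>\<^sup>+x. H x \<partial>M)"
    by (intro nn_integral_diff) (auto simp: HG)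
  also have "\<dots> = 0"
    using le fin intG intH by (simp add: diff_eq_0_iff_ennreal less_top[symmetric])
  finally have "AE x in M. G x - H x = 0" by (subst (asm) nn_integral_0_iff_AE) auto
  moreover have "AE x in M. G x \<noteq> \<infinity>" using fin by (intro nn_integral_PInf_AE) auto
  ultimately show ?thesis
  proof eventually_elim
    case (elim x)
    then have "G x \<le> H x" by (auto simp: diff_eq_0_iff_ennreal)
    then have "zero_off U g x \<le> min (zero_off U g x) (zero_off U h x)"
      unfolding G_def H_def by (simp only: enn_powr_le_iff[OF p])
    then show ?case by (auto simp: zero_off_def)
  qed
qed

text \<open>By the lattice property a sequence minimising the energy may be taken decreasing; its limit is a
  common upper gradient by monotone convergence along curves.\<close>

lemma ex_least_ug:
  assumes ne: "common_ug M p U F \<noteq> {}"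
  shows "\<exists>g. least_ug M p U F g"
proof -
  define I where "I = (INF g\<in>common_ug M p U F. energy M p U g)"
  have I_fin: "I < \<infinity>"
  proof -
    obtain g where "g \<in> common_ug M p U F" using ne by blast
    then have "I \<le> energy M p U g" "energy M p U g < \<infinity>" unfolding I_def
      by (auto intro: INF_lower simp: common_ug_def)
    then show ?thesis by simp
  qed
  have "\<exists>g. g \<in> common_ug M p U F \<and> energy M p U g < I + ennreal (1 / real (Suc n))" for n
  proof -
    have "I < I + ennreal (1 / real (Suc n))" using I_fin by (cases I) (auto simp: ennreal_less_iff simp flip: ennreal_plus)
    then show ?thesis unfolding I_def INF_less_iff by blast
  qed
  then obtain g where g: "\<And>n. g n \<in> common_ug M p U F \<and> energy M p U (g n) < I + ennreal (1 / real (Suc n))"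
    by (rule that[OF someI_ex])
  define m where "m = rec_nat (g 0) (\<lambda>n k x. min (k x) (g (Suc n) x))"
  have m_simps: "m 0 = g 0" "m (Suc n) = (\<lambda>x. min (m n x) (g (Suc n) x))" for n
    by (simp_all add: m_def)
  have m: "m n \<in> common_ug M p U F" for n
    by (induction n) (use g in \<open>auto simp: m_simps intro!: common_ug_min\<close>)
  have m_le: "m n x \<le> g n x" for n x by (cases n) (auto simp: m_simps)
  define l where "l x = (INF n. m n x)" for x
  have energy_l: "energy M p U l \<le> energy M p U (g n)" for n
    unfolding l_def using p by (intro energy_mono INF_lower2[of n] m_le) auto
  have l: "l \<in> common_ug M p U F"
    unfolding common_ug_def
  proof (intro CollectI conjI ballI)
    fix f assume "f \<in> F"
    then show "weak_upper_gradient M p U f l"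
      unfolding l_def using m by (intro weak_upper_gradient_INF[OF M p U]) (simp_all add: common_ug_def m_simps)
  next
    show "energy M p U l < \<infinity>"
      using energy_l[of 0] g[of 0] by (auto simp: common_ug_def)
  qed
  have "energy M p U l \<le> I + ennreal e" if e: "0 < e" for e :: real
  proof -
    obtain n where n: "1 / real (Suc n) < e" using nat_approx_posE[OF e] by auto
    have "energy M p U l \<le> energy M p U (g n)" by (rule energy_l)
    also have "\<dots> \<le> I + ennreal (1 / real (Suc n))"
      using g[of n] by (blast intro: less_imp_le)
    also have "\<dots> \<le> I + ennreal e" using n by (intro add_left_mono ennreal_leI) simp
    finally show ?thesis .
  qed
  then have "energy M p U l \<le> I" by (rule ennreal_le_epsilon)
  then have least: "energy M p U l \<le> energy M p U h" if "h \<in> common_ug M p U F" for h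
    using that \<open>energy M p U l \<le> I\<close> INF_lower[of h "common_ug M p U F" "energy M p U"]
    unfolding I_def by (blast intro: order_trans)
  show ?thesis
    unfolding least_ug_def
  proof (intro exI[of _ l] conjI ballI l)
    fix h assume h: "h \<in> common_ug M p U F"
    show "AE x in M. x \<in> U \<longrightarrow> l x \<le> h x"
      using l h least[OF common_ug_min[OF l h]] by (rule energy_eq_imp_AE_le)
  qed
qed

lemma energy_le_if_least_ug:
  assumes g: "least_ug M p U F g" and h: "h \<in> common_ug M p U F"
  shows "energy M p U g \<le> energy M p U h"
proof -
  have "AE x in M. x \<in> U \<longrightarrow> g x \<le> h x" using g h by (simp add: least_ug_def)
  then have "AE x in M. enn_powr (g x) p * indicator U x \<le> enn_powr (h x) p * indicator U x"
    by eventually_elim (use p in \<open>auto simp: indicator_def intro: enn_powr_mono\<close>)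
  then show ?thesis unfolding energy_def by (rule nn_integral_mono_AE)
qed

text \<open>Minimality of the norm, as required of \<open>|D_min \<phi>|\<close>, and pointwise minimality, as required of
  the minimal upper gradient of a function, amount to the same.\<close>

lemma least_ug_iff_energy:
  "least_ug M p U F g \<longleftrightarrow> g \<in> common_ug M p U F \<and> (\<forall>h\<in>common_ug M p U F. energy M p U g \<le> energy M p U h)"
proof (intro iffI conjI ballI)
  assume *: "g \<in> common_ug M p U F \<and> (\<forall>h\<in>common_ug M p U F. energy M p U g \<le> energy M p U h)"
  show "least_ug M p U F g"
    unfolding least_ug_def
  proof (intro conjI ballI)
    fix h assume h: "h \<in> common_ug M p U F"
    then show "AE x in M. x \<in> U \<longrightarrow> g x \<le> h x"
      using * common_ug_min[of g h] by (intro energy_eq_imp_AE_le) blast+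
  qed (use * in blast)
next
  assume "least_ug M p U F g"
  then show "g \<in> common_ug M p U F" by (simp add: least_ug_def)
  show "energy M p U g \<le> energy M p U h" if "h \<in> common_ug M p U F" for h
    using \<open>least_ug M p U F g\<close> that by (rule energy_le_if_least_ug)
qed

lemma common_ug_subset:
  assumes "g \<in> common_ug M p U F" "open V" "V \<subseteq> U" shows "g \<in> common_ug M p V F"
proof -
  have "energy M p V g \<le> energy M p U g" using p assms(3) by (intro energy_mono) auto
  then show ?thesis
    using assms weak_upper_gradient_subset[of M p U _ g V] U le_less_trans
    unfolding common_ug_def by blast
qed

text \<open>A smaller upper gradient on \<open>V\<close> could be glued in and would improve the one on \<open>U\<close>.\<close>

lemma least_ug_subset:
  assumes g: "least_ug M p U F g" and V: "open V" "V \<subseteq> U"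
  shows "least_ug M p V F g"
  unfolding least_ug_def
proof (intro conjI ballI)
  have gU: "g \<in> common_ug M p U F" using g unfolding least_ug_def by blast
  show "g \<in> common_ug M p V F" by (rule common_ug_subset[OF gU V])
  fix h assume h: "h \<in> common_ug M p V F"
  have "(\<lambda>x. if x \<in> V then min (g x) (h x) else g x) \<in> common_ug M p U F"
    by (rule common_ug_glue[OF gU h V])
  then have "AE x in M. x \<in> U \<longrightarrow> g x \<le> (if x \<in> V then min (g x) (h x) else g x)"
    using g unfolding least_ug_def by (elim conjE bspec)
  then show "AE x in M. x \<in> V \<longrightarrow> g x \<le> h x"
    by eventually_elim (use V in auto)
qed

end

lemma Lp_weak_upper_gradient_iff: "Lp_weak_upper_gradient M p U f g \<longleftrightarrow> g \<in> common_ug M p U {f}"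
  by (simp add: Lp_weak_upper_gradient_def common_ug_def Lp_norm_eq)

lemma minimal_weak_upper_gradient_iff: "minimal_weak_upper_gradient M p U f g \<longleftrightarrow> least_ug M p U {f} g"
  by (simp add: minimal_weak_upper_gradient_def least_ug_def Lp_weak_upper_gradient_iff Ball_def)

lemma grad_min_least:
  assumes "sets M = sets borel" "0 < p" "open U" "Lp_weak_upper_gradient M p U f g"
  shows "least_ug M p U {f} (grad_min M p U f)"
proof -
  have "\<exists>g. least_ug M p U {f} g"
    using assms by (intro ex_least_ug) (auto simp: Lp_weak_upper_gradient_iff)
  then show ?thesis unfolding grad_min_def minimal_weak_upper_gradient_iff by (rule someI_ex)
qed

definition distance_functions :: "'a::metric_space set \<Rightarrow> ('a \<Rightarrow> 'a) \<Rightarrow> ('a \<Rightarrow> real) set" where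
  "distance_functions \<Omega>' \<phi> = (\<lambda>z x. dist (\<phi> x) z) ` \<Omega>'"

lemma Lp_map_upper_gradient_iff:
  "Lp_map_upper_gradient M p U \<Omega>' \<phi> g \<longleftrightarrow> g \<in> common_ug M p U (distance_functions \<Omega>' \<phi>)"
  by (auto simp: Lp_map_upper_gradient_def common_ug_def Lp_norm_eq distance_functions_def)

lemma minimal_map_upper_gradient_iff:
  assumes "sets M = sets borel" "0 < p" "open U" "\<Omega>' \<noteq> {}"
  shows "minimal_map_upper_gradient M p U \<Omega>' \<phi> g \<longleftrightarrow> least_ug M p U (distance_functions \<Omega>' \<phi>) g"
proof -
  have "distance_functions \<Omega>' \<phi> \<noteq> {}" using assms(4) by (simp add: distance_functions_def)
  from least_ug_iff_energy[OF assms(1-3) this] show ?thesis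
    using assms(2) enn_powr_le_iff[of "1 / p"]
    by (simp add: minimal_map_upper_gradient_def Lp_map_upper_gradient_iff Lp_norm_eq Ball_def)
qed

section \<open>Doubling measures\<close>

locale doubling_measure =
  fixes M :: "'a::metric_space measure" and C :: real
  assumes sets_M [measurable_cong, simp]: "sets M = sets borel"
    and ball_pos: "0 < r \<Longrightarrow> 0 < emeasure M (ball x r)"
    and ball_fin: "0 < r \<Longrightarrow> emeasure M (ball x r) < \<infinity>"
    and C_ge_1: "1 \<le> C"
    and doubling: "0 < r \<Longrightarrow> emeasure M (ball x (2 * r)) \<le> ennreal C * emeasure M (ball x r)"
begin

lemma space_M [simp]: "space M = UNIV"
  by (simp add: sets_eq_imp_space_eq[OF sets_M])

lemma doubling_power:
  assumes "0 < r" shows "emeasure M (ball x (2 ^ n * r)) \<le> ennreal (C ^ n) * emeasure M (ball x r)"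
proof (induction n)
  case (Suc n)
  have "emeasure M (ball x (2 * (2 ^ n * r))) \<le> ennreal C * emeasure M (ball x (2 ^ n * r))"
    using assms by (intro doubling) simp
  also have "\<dots> \<le> ennreal C * (ennreal (C ^ n) * emeasure M (ball x r))"
    by (intro mult_left_mono Suc.IH) simp
  finally show ?case using C_ge_1 by (simp add: mult_ac ennreal_mult)
qed simp

lemma emeasure_bounded_finite:
  assumes "bounded S" shows "emeasure M S < \<infinity>"
proof -
  obtain x e where "S \<subseteq> cball x e" using assms bounded_subset_cball by (metis bounded_def mem_cball subsetI)
  then have "S \<subseteq> ball x (\<bar>e\<bar> + 1)" by auto
  then have "emeasure M S \<le> emeasure M (ball x (\<bar>e\<bar> + 1))" by (intro emeasure_mono) auto
  also have "\<dots> < \<infinity>" by (rule ball_fin) simp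
  finally show ?thesis .
qed

text \<open>Disjoint balls of radius \<open>e/2\<close> around the points of a separated set in a ball have measures bounded
  below by the doubling condition, so that only finitely many fit into a bounded set.\<close>

lemma finite_separated:
  fixes x0 :: 'a
  assumes e: "0 < e" and R: "0 < R" and S: "S \<subseteq> ball x0 R"
    and sep: "\<And>x y. x \<in> S \<Longrightarrow> y \<in> S \<Longrightarrow> x \<noteq> y \<Longrightarrow> e \<le> dist x y"
  shows "finite S"
proof (rule ccontr)
  assume inf: "infinite S"
  obtain n :: nat where n: "2 * R / (e / 2) < 2 ^ n" using real_arch_pow[of 2] by auto
  define a where "a = measure M (ball x0 R) / C ^ n"
  have fin: "emeasure M (ball x r) = ennreal (measure M (ball x r))" if "0 < r" for x r
    using ball_fin[OF that, of x] by (simp add: emeasure_eq_ennreal_measure)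
  have "0 < measure M (ball x0 R)" using ball_pos[OF R, of x0] fin[OF R, of x0] by auto
  then have a: "0 < a" using C_ge_1 by (simp add: a_def)
  have lower: "a \<le> measure M (ball x (e/2))" if x: "x \<in> S" for x
  proof -
    have "ball x0 R \<subseteq> ball x (2 ^ n * (e/2))"
    proof
      fix y assume "y \<in> ball x0 R"
      then have "dist x y < R + R" using S x dist_triangle_less_add[of x x0 R y R] by (auto simp: dist_commute)
      moreover have "2 * R < 2 ^ n * (e/2)" using n e by (simp add: field_simps)
      ultimately show "y \<in> ball x (2 ^ n * (e/2))" by simp
    qed
    then have "emeasure M (ball x0 R) \<le> emeasure M (ball x (2 ^ n * (e/2)))" by (intro emeasure_mono) auto
    also have "\<dots> \<le> ennreal (C ^ n) * emeasure M (ball x (e/2))" using e by (intro doubling_power) simp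
    finally have "ennreal (measure M (ball x0 R)) \<le> ennreal (C ^ n * measure M (ball x (e/2)))"
      using fin[OF R, of x0] fin[of "e/2" x] e C_ge_1 by (simp add: ennreal_mult)
    then have "measure M (ball x0 R) \<le> C ^ n * measure M (ball x (e/2))"
      using C_ge_1 by (simp add: ennreal_le_iff)
    then show ?thesis using C_ge_1 by (simp add: a_def field_simps)
  qed
  obtain k :: nat where k: "measure M (ball x0 (R + e)) / a < k" using reals_Archimedean2 by blast
  obtain T where T: "finite T" "card T = k" "T \<subseteq> S" using infinite_arbitrarily_large[OF inf] by blast
  have "real k * a = (\<Sum>x\<in>T. a)" using T by simp
  also have "\<dots> \<le> (\<Sum>x\<in>T. measure M (ball x (e/2)))" using T by (intro sum_mono lower) auto
  also have "\<dots> = measure M (\<Union>x\<in>T. ball x (e/2))"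
  proof (rule measure_finite_Union[symmetric])
    show "disjoint_family_on (\<lambda>x. ball x (e/2)) T"
    proof (unfold disjoint_family_on_def, intro ballI impI equals0I)
      fix x y z assume "x \<in> T" "y \<in> T" "x \<noteq> y" "z \<in> ball x (e/2) \<inter> ball y (e/2)"
      then have "dist x y < e/2 + e/2" using dist_triangle_less_add[of x z "e/2" y "e/2"] by (auto simp: dist_commute)
      then show False using sep[of x y] \<open>x \<in> T\<close> \<open>y \<in> T\<close> \<open>x \<noteq> y\<close> T by auto
    qed
  qed (use T e ball_fin in \<open>auto simp: less_top[symmetric]\<close>)
  also have "\<dots> \<le> measure M (ball x0 (R + e))"
  proof (rule measure_mono_fmeasurable)
    show "(\<Union>x\<in>T. ball x (e/2)) \<subseteq> ball x0 (R + e)"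
    proof (intro UN_least subsetI)
      fix x y assume "x \<in> T" "y \<in> ball x (e/2)"
      then have "dist x0 y < R + e/2" using T S dist_triangle_less_add[of x0 x R y "e/2"] by (auto simp: dist_commute)
      then show "y \<in> ball x0 (R + e)" using e by simp
    qed
    show "ball x0 (R + e) \<in> fmeasurable M" using ball_fin[of "R + e" x0] R e by (auto simp: fmeasurable_def)
    show "(\<Union>x\<in>T. ball x (e/2)) \<in> sets M" by (simp add: borel_open open_UN)
  qed
  finally have "real k \<le> measure M (ball x0 (R + e)) / a" using a by (simp add: field_simps)
  with k show False by simp
qed

lemma separable: "\<exists>D::'a set. countable D \<and> (\<forall>x. \<forall>e>0. \<exists>d\<in>D. dist x d < e)"
proof -
  have "\<exists>S::'a set. countable S \<and> (\<forall>x. \<exists>d\<in>S. dist x d < e)" if e: "0 < e" for e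
  proof -
    let ?A = "{S::'a set. \<forall>x\<in>S. \<forall>y\<in>S. x \<noteq> y \<longrightarrow> e \<le> dist x y}"
    have "\<exists>S\<in>?A. \<forall>T\<in>?A. S \<subseteq> T \<longrightarrow> T = S"
    proof (rule subset_Zorn')
      fix \<C> assume \<C>: "subset.chain ?A \<C>"
      show "\<Union>\<C> \<in> ?A"
      proof (intro CollectI ballI impI)
        fix x y assume "x \<in> \<Union>\<C>" "y \<in> \<Union>\<C>" "x \<noteq> y"
        then obtain S T where "S \<in> \<C>" "x \<in> S" "T \<in> \<C>" "y \<in> T" by blast
        moreover have "S \<subseteq> T \<or> T \<subseteq> S" "S \<in> ?A" "T \<in> ?A"
          using \<C> \<open>S \<in> \<C>\<close> \<open>T \<in> \<C>\<close> by (auto simp: subset_chain_def)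
        ultimately show "e \<le> dist x y" using \<open>x \<noteq> y\<close> by blast
      qed
    qed
    then obtain S where S: "S \<in> ?A" and max: "\<forall>T\<in>?A. S \<subseteq> T \<longrightarrow> T = S" by (rule bexE)
    have net: "\<exists>d\<in>S. dist x d < e" for x
    proof (rule ccontr)
      assume *: "\<not> (\<exists>d\<in>S. dist x d < e)"
      then have "insert x S \<in> ?A" using S(1) by (auto simp: dist_commute not_less)
      from bspec[OF max this] have "x \<in> S" by blast
      with * e show False by auto
    qed
    have S_eq: "S = (\<Union>n. S \<inter> ball undefined (real (Suc n)))"
    proof (intro set_eqI iffI)
      fix x assume "x \<in> S"
      moreover obtain n :: nat where "dist undefined x < n" using reals_Archimedean2 by blast
      ultimately have "x \<in> S \<inter> ball undefined (real (Suc n))" by auto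
      then show "x \<in> (\<Union>n. S \<inter> ball undefined (real (Suc n)))" by blast
    qed auto
    have "finite (S \<inter> ball undefined (real (Suc n)))" for n
      using S(1) e by (intro finite_separated[of e "real (Suc n)" _ undefined]) auto
    then have "countable (\<Union>n. S \<inter> ball undefined (real (Suc n)))"
      by (intro countable_UN) (auto intro: countable_finite)
    then have "countable S" using S_eq by simp
    then show ?thesis using net by blast
  qed
  then have "\<forall>n. \<exists>S::'a set. countable S \<and> (\<forall>x. \<exists>d\<in>S. dist x d < 1 / real (Suc n))" by simp
  then obtain S where S: "\<And>n. countable (S n :: 'a set)" "\<And>n x. \<exists>d\<in>S n. dist x d < 1 / real (Suc n)"
    by metis
  show ?thesis
  proof (intro exI[of _ "\<Union>n. S n"] conjI allI impI)
    show "countable (\<Union>n. S n)" using S by auto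
    fix x :: 'a and e :: real assume "0 < e"
    then obtain n where n: "1 / real (Suc n) < e" using nat_approx_posE by blast
    obtain d where "d \<in> S n" "dist x d < 1 / real (Suc n)" using S(2) by blast
    then show "\<exists>d\<in>\<Union>n. S n. dist x d < e" using n by (intro bexI[of _ d]) auto
  qed
qed

lemma countable_disjoint_balls:
  assumes pos: "\<And>b. b \<in> G \<Longrightarrow> 0 < snd b"
    and disj: "\<And>b c. b \<in> G \<Longrightarrow> c \<in> G \<Longrightarrow> b \<noteq> c \<Longrightarrow> ball (fst b) (snd b) \<inter> ball (fst c) (snd c) = ({} :: 'a set)"
  shows "countable G"
proof -
  obtain D :: "'a set" where D: "countable D" "\<And>x e. 0 < e \<Longrightarrow> \<exists>d\<in>D. dist x d < e" using separable by blast
  have "\<forall>b\<in>G. \<exists>d\<in>D. d \<in> ball (fst b) (snd b)" using D(2) pos by simp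
  then obtain f where f: "\<And>b. b \<in> G \<Longrightarrow> f b \<in> D" "\<And>b. b \<in> G \<Longrightarrow> f b \<in> ball (fst b) (snd b)" by metis
  have "inj_on f G"
  proof (rule inj_onI, rule ccontr)
    fix b c assume "b \<in> G" "c \<in> G" "f b = f c" "b \<noteq> c"
    then show False using f(2)[of b] f(2)[of c] disj[of b c] by auto
  qed
  have "f ` G \<subseteq> D" using f(1) by blast
  then have "countable (f ` G)" using D(1) by (rule countable_subset)
  then show ?thesis using \<open>inj_on f G\<close> by (rule countable_image_inj_on)
qed

end

section \<open>A covering lemma\<close>

text \<open>Among the subfamilies of disjoint balls in which every ball of \<open>K\<close> that meets one of them meets one
  of at least half its radius, a maximal one meets every ball of \<open>K\<close>: otherwise a ball of nearly maximal
  radius among those that are missed could be added.\<close>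

lemma Vitali_disjoint_balls:
  fixes K :: "('a::metric_space \<times> real) set"
  assumes r: "\<And>b. b \<in> K \<Longrightarrow> 0 < snd b \<and> snd b \<le> R"
  obtains G where "G \<subseteq> K"
    "\<And>b c. b \<in> G \<Longrightarrow> c \<in> G \<Longrightarrow> b \<noteq> c \<Longrightarrow> ball (fst b) (snd b) \<inter> ball (fst c) (snd c) = {}"
    "\<And>b. b \<in> K \<Longrightarrow> \<exists>c\<in>G. ball (fst b) (snd b) \<subseteq> ball (fst c) (5 * snd c)"
proof -
  define meets where "meets b c \<longleftrightarrow> ball (fst b) (snd b) \<inter> ball (fst c) (snd c) \<noteq> {}" for b c :: "'a \<times> real"
  define \<G> where "\<G> = {G. G \<subseteq> K \<and> (\<forall>b\<in>G. \<forall>c\<in>G. b \<noteq> c \<longrightarrow> \<not> meets b c) \<and>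
     (\<forall>b\<in>K. (\<exists>c\<in>G. meets b c) \<longrightarrow> (\<exists>c\<in>G. meets b c \<and> snd b \<le> 2 * snd c))}"
  have "\<exists>G\<in>\<G>. \<forall>H\<in>\<G>. G \<subseteq> H \<longrightarrow> H = G"
  proof (rule subset_Zorn')
    fix \<C> assume \<C>: "subset.chain \<G> \<C>"
    then have sub: "\<And>G. G \<in> \<C> \<Longrightarrow> G \<in> \<G>" by (auto simp: subset_chain_def)
    have "\<Union>\<C> \<subseteq> K" using sub unfolding \<G>_def by blast
    moreover have "\<not> meets b c" if bc: "b \<in> \<Union>\<C>" "c \<in> \<Union>\<C>" "b \<noteq> c" for b c
    proof -
      obtain G H where GH: "G \<in> \<C>" "b \<in> G" "H \<in> \<C>" "c \<in> H" using bc by blast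
      then have "G \<subseteq> H \<or> H \<subseteq> G" using \<C> by (auto simp: subset_chain_def)
      then obtain L where "L \<in> \<C>" "b \<in> L" "c \<in> L" using GH by blast
      then show ?thesis using sub[of L] bc(3) unfolding \<G>_def by blast
    qed
    moreover have "\<exists>c\<in>\<Union>\<C>. meets b c \<and> snd b \<le> 2 * snd c" if bc: "b \<in> K" "\<exists>c\<in>\<Union>\<C>. meets b c" for b
    proof -
      obtain G where G: "G \<in> \<C>" "\<exists>c\<in>G. meets b c" using bc(2) by blast
      then have "\<exists>c\<in>G. meets b c \<and> snd b \<le> 2 * snd c" using sub[of G] bc(1) unfolding \<G>_def by blast
      then show ?thesis using G(1) by blast
    qed
    ultimately show "\<Union>\<C> \<in> \<G>" unfolding \<G>_def by blast
  qed
  then obtain G where G: "G \<in> \<G>" and max: "\<forall>H\<in>\<G>. G \<subseteq> H \<longrightarrow> H = G" by (rule bexE)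
  have GK: "G \<subseteq> K" and disj: "\<And>b c. b \<in> G \<Longrightarrow> c \<in> G \<Longrightarrow> b \<noteq> c \<Longrightarrow> \<not> meets b c"
    and large: "\<And>b. b \<in> K \<Longrightarrow> \<exists>c\<in>G. meets b c \<Longrightarrow> \<exists>c\<in>G. meets b c \<and> snd b \<le> 2 * snd c"
    using G unfolding \<G>_def by simp_all
  have meets_self: "meets b b" if "b \<in> K" for b
  proof -
    have "fst b \<in> ball (fst b) (snd b)" using r[OF that] by simp
    then show ?thesis by (auto simp: meets_def)
  qed
  have all: "\<exists>c\<in>G. meets b c" if "b \<in> K" for b
  proof (rule ccontr)
    define K' where "K' = {b\<in>K. \<not> (\<exists>c\<in>G. meets b c)}"
    assume "\<not> (\<exists>c\<in>G. meets b c)"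
    then have b: "b \<in> K'" using that by (simp add: K'_def)
    define s where "s = Sup (snd ` K')"
    have bdd: "bdd_above (snd ` K')"
    proof (rule bdd_aboveI)
      fix t assume "t \<in> snd ` K'"
      then obtain c where "c \<in> K" "t = snd c" by (auto simp: K'_def)
      then show "t \<le> R" using r[of c] by simp
    qed
    have le_s: "snd c \<le> s" if "c \<in> K'" for c
      unfolding s_def using that bdd by (intro cSup_upper) auto
    have "0 < s" using le_s[OF b] r[of b] that by auto
    then have "s / 2 < Sup (snd ` K')" by (simp add: s_def[symmetric])
    then have "\<exists>t\<in>snd ` K'. s / 2 < t" using b by (intro less_cSupD) auto
    then obtain d where d: "d \<in> K'" "s / 2 < snd d" by blast
    have d_miss: "\<not> meets d c" if "c \<in> G" for c using d(1) that by (simp add: K'_def)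
    have "insert d G \<in> \<G>"
    proof -
      have "insert d G \<subseteq> K" using d GK by (auto simp: K'_def)
      moreover have "\<not> meets u v" if "u \<in> insert d G" "v \<in> insert d G" "u \<noteq> v" for u v
      proof -
        have "meets u v = meets v u" by (simp add: meets_def Int_commute)
        then show ?thesis using that d_miss disj by blast
      qed
      moreover have "\<exists>c\<in>insert d G. meets u c \<and> snd u \<le> 2 * snd c" if "u \<in> K" "\<exists>c\<in>insert d G. meets u c" for u
      proof (cases "\<exists>c\<in>G. meets u c")
        case True
        then show ?thesis using large[OF that(1)] by blast
      next
        case False
        then have u: "u \<in> K'" "meets u d" using that by (simp add: K'_def, blast)
        moreover have "snd u \<le> 2 * snd d" using le_s[OF u(1)] d(2) by simp
        ultimately show ?thesis by blast
      qed
      ultimately show ?thesis unfolding \<G>_def by blast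
    qed
    from bspec[OF max this] have "d \<in> G" by blast
    moreover have "meets d d" using d(1) by (intro meets_self) (simp add: K'_def)
    ultimately show False using d_miss by blast
  qed
  show thesis
  proof (rule that[OF GK])
    show "ball (fst b) (snd b) \<inter> ball (fst c) (snd c) = {}" if "b \<in> G" "c \<in> G" "b \<noteq> c" for b c
      using disj[OF that] by (simp add: meets_def)
    fix b assume b: "b \<in> K"
    obtain c where c: "c \<in> G" "meets b c" "snd b \<le> 2 * snd c" using large[OF b all[OF b]] by blast
    obtain z where z: "dist (fst b) z < snd b" "dist (fst c) z < snd c" using c(2) by (auto simp: meets_def)
    have "ball (fst b) (snd b) \<subseteq> ball (fst c) (5 * snd c)"
    proof
      fix y assume "y \<in> ball (fst b) (snd b)"
      moreover have "dist (fst c) y \<le> dist (fst c) z + dist (fst b) z + dist (fst b) y"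
        using dist_triangle[of "fst c" y z] dist_triangle[of z y "fst b"] by (simp add: dist_commute)
      ultimately show "y \<in> ball (fst c) (5 * snd c)" using z c(3) by simp
    qed
    then show "\<exists>c\<in>G. ball (fst b) (snd b) \<subseteq> ball (fst c) (5 * snd c)" using c(1) by blast
  qed
qed

section \<open>Regularity of finite Borel measures\<close>

text \<open>The sets that can be approximated form a sigma-algebra. It contains the open sets, because in a
  metric space these are increasing unions of closed sets.\<close>

lemma finite_borel_measure_regular:
  fixes m :: "'a::metric_space measure"
  assumes m: "finite_measure m" "sets m = sets borel" and B: "B \<in> sets borel" and e: "0 < (e::real)"
  shows "\<exists>F U. closed F \<and> F \<subseteq> B \<and> B \<subseteq> U \<and> open U \<and> emeasure m (U - F) < ennreal e"
proof -
  interpret finite_measure m by fact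
  note [measurable_cong] = m(2)
  have "B \<in> sigma_sets UNIV {S. open S}" using B by (simp add: borel_def)
  then have "\<forall>e>0. \<exists>F U. closed F \<and> F \<subseteq> B \<and> B \<subseteq> U \<and> open U \<and> emeasure m (U - F) < ennreal e"
  proof induction
    case (Basic a)
    then have a: "open a" by simp
    show ?case
    proof (intro allI impI)
      fix e :: real assume e: "0 < e"
      define F where "F n = {x. ball x (1 / real (Suc n)) \<subseteq> a}" for n
      have closed: "closed (F n)" for n
        unfolding closed_sequential_limits
      proof (intro allI impI)
        fix x l assume "(\<forall>k. x k \<in> F n) \<and> x \<longlonglongrightarrow> l"
        then have x: "\<And>k. ball (x k) (1 / real (Suc n)) \<subseteq> a" and lim: "x \<longlonglongrightarrow> l" by (auto simp: F_def)
        have "y \<in> a" if y: "dist l y < 1 / real (Suc n)" for y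
        proof -
          have "\<forall>\<^sub>F k in sequentially. dist (x k) l < 1 / real (Suc n) - dist l y"
            using lim y unfolding tendsto_iff by simp
          then obtain k where "dist (x k) l < 1 / real (Suc n) - dist l y"
            by (auto simp: eventually_sequentially)
          then have "dist (x k) y < 1 / real (Suc n)" using dist_triangle[of "x k" y l] by linarith
          then show ?thesis using x[of k] by auto
        qed
        then show "l \<in> F n" by (auto simp: F_def)
      qed
      have sub: "F n \<subseteq> a" for n
      proof
        fix x assume "x \<in> F n"
        moreover have "x \<in> ball x (1 / real (Suc n))" by simp
        ultimately show "x \<in> a" unfolding F_def by blast
      qed
      have inc: "F n \<subseteq> F k" if "n \<le> k" for n k
      proof -
        have "1 / real (Suc k) \<le> 1 / real (Suc n)" using that by (simp add: frac_le)
        then have "ball x (1 / real (Suc k)) \<subseteq> ball x (1 / real (Suc n))" for x by (rule subset_ball)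
        then show ?thesis unfolding F_def by blast
      qed
      have un: "(\<Union>n. F n) = a"
      proof (intro equalityI UN_least sub subsetI)
        fix x assume "x \<in> a"
        then obtain d where d: "0 < d" "ball x d \<subseteq> a" using a open_contains_ball by blast
        obtain n where "1 / real (Suc n) < d" using nat_approx_posE[OF d(1)] by blast
        then have "ball x (1 / real (Suc n)) \<subseteq> a" using d(2) subset_ball[of "1 / real (Suc n)" d x] by auto
        then show "x \<in> (\<Union>n. F n)" by (auto simp: F_def)
      qed
      have "(\<lambda>n. emeasure m (a - F n)) \<longlonglongrightarrow> emeasure m (\<Inter>n. a - F n)"
      proof (rule Lim_emeasure_decseq)
        show "decseq (\<lambda>n. a - F n)" using inc by (auto simp: decseq_def)
      qed (use a closed m(2) in auto)
      moreover have "(\<Inter>n. a - F n) = {}" using un by blast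
      ultimately have "(\<lambda>n. emeasure m (a - F n)) \<longlonglongrightarrow> 0" by (simp only: emeasure_empty)
      then have "\<forall>\<^sub>F n in sequentially. emeasure m (a - F n) < ennreal e"
        using e by (intro order_tendstoD(2)[of _ 0]) simp_all
      then obtain n where "emeasure m (a - F n) < ennreal e" by (auto simp: eventually_sequentially)
      then show "\<exists>F U. closed F \<and> F \<subseteq> a \<and> a \<subseteq> U \<and> open U \<and> emeasure m (U - F) < ennreal e"
        using a closed sub by (intro exI[of _ "F n"] exI[of _ a]) auto
    qed
  next
    case Empty
    show ?case by (intro allI impI exI[of _ "{}"]) auto
  next
    case (Compl a)
    show ?case
    proof (intro allI impI)
      fix e :: real assume "0 < e"
      then obtain F U where FU: "closed F" "F \<subseteq> a" "a \<subseteq> U" "open U" "emeasure m (U - F) < ennreal e"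
        using Compl.IH[rule_format, OF \<open>0 < e\<close>] by (elim exE conjE)
      moreover have "- F - (- U) = U - F" by auto
      ultimately show "\<exists>F U. closed F \<and> F \<subseteq> UNIV - a \<and> UNIV - a \<subseteq> U \<and> open U \<and> emeasure m (U - F) < ennreal e"
        by (intro exI[of _ "- U"] exI[of _ "- F"]) auto
    qed
  next
    case (Union a)
    show ?case
    proof (intro allI impI)
      fix e :: real assume e: "0 < e"
      have "\<forall>i. \<exists>F U. closed F \<and> F \<subseteq> a i \<and> a i \<subseteq> U \<and> open U \<and> emeasure m (U - F) < ennreal (e / 4 * (1/2)^i)"
        using Union.IH e by simp
      then obtain F U where F: "\<And>i. closed (F i)" "\<And>i. F i \<subseteq> a i"
          and U: "\<And>i. a i \<subseteq> U i" "\<And>i. open (U i)"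
          and FU: "\<And>i. emeasure m (U i - F i) < ennreal (e / 4 * (1/2)^i)"
        by metis
      have meas: "U i - F i \<in> sets m" "F i \<in> sets m" "U i \<in> sets m" for i using U(2)[of i] F(1)[of i] m(2) by auto
      define V where "V = (\<Union>i. U i)"
      have V: "open V" unfolding V_def using U by auto
      have "emeasure m (V - (\<Union>i. F i)) \<le> emeasure m (\<Union>i. U i - F i)"
        using meas by (intro emeasure_mono) (auto simp: V_def)
      also have "\<dots> \<le> (\<Sum>i. emeasure m (U i - F i))"
        using meas by (intro emeasure_subadditive_countably) auto
      also have "\<dots> \<le> (\<Sum>i. ennreal (e / 4 * (1/2)^i))"
        using FU by (intro suminf_le less_imp_le) auto
      also have "\<dots> = ennreal (\<Sum>i. e / 4 * (1/2)^i)"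
        using e by (intro suminf_ennreal2 summable_mult) auto
      also have "(\<Sum>i. e / 4 * (1/2::real)^i) = e / 2"
        by (subst suminf_mult) (auto simp: suminf_geometric)
      also have "ennreal (e / 2) < ennreal e" using e by (simp add: ennreal_lessI)
      finally have small: "emeasure m (V - (\<Union>i. F i)) < ennreal e" .
      have "(\<lambda>n. emeasure m (V - (\<Union>i\<le>n. F i))) \<longlonglongrightarrow> emeasure m (\<Inter>n. V - (\<Union>i\<le>n. F i))"
      proof (rule Lim_emeasure_decseq)
        show "decseq (\<lambda>n. V - (\<Union>i\<le>n. F i))" by (fastforce simp: decseq_def)
        show "range (\<lambda>n. V - (\<Union>i\<le>n. F i)) \<subseteq> sets m" using V meas m(2) by (auto intro!: sets.Diff sets.finite_UN)
      qed auto
      moreover have "(\<Inter>n. V - (\<Union>i\<le>n. F i)) = V - (\<Union>i. F i)" by auto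
      ultimately have "(\<lambda>n. emeasure m (V - (\<Union>i\<le>n. F i))) \<longlonglongrightarrow> emeasure m (V - (\<Union>i. F i))"
        by (simp only:)
      then have "\<forall>\<^sub>F n in sequentially. emeasure m (V - (\<Union>i\<le>n. F i)) < ennreal e"
        using small by (rule order_tendstoD(2))
      then obtain n where n: "emeasure m (V - (\<Union>i\<le>n. F i)) < ennreal e" by (auto simp: eventually_sequentially)
      show "\<exists>F U. closed F \<and> F \<subseteq> (\<Union>i. a i) \<and> (\<Union>i. a i) \<subseteq> U \<and> open U \<and> emeasure m (U - F) < ennreal e"
      proof (intro exI conjI)
        show "closed (\<Union>i\<le>n. F i)" using F(1) by auto
        show "(\<Union>i\<le>n. F i) \<subseteq> (\<Union>i. a i)" using F(2) by blast
        show "(\<Union>i. a i) \<subseteq> V" unfolding V_def using U(1) by blast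
      qed (use V n in auto)
    qed
  qed
  then show ?thesis using e by blast
qed

section \<open>Differentiation of measures\<close>

context doubling_measure
begin

lemma emeasure_UN_le_count_space:
  assumes G: "countable G" and B: "\<And>c. c \<in> G \<Longrightarrow> B c \<in> sets M"
  shows "emeasure M (\<Union>c\<in>G. B c) \<le> (\<integral>\<^sup>+c. emeasure M (B c) \<partial>count_space G)"
proof (cases "G = {}")
  case False
  have UN: "(\<Union>c\<in>G. B c) \<in> sets M" using G B by (intro sets.countable_UN') auto
  have "emeasure M (\<Union>c\<in>G. B c) = (\<integral>\<^sup>+x. indicator (\<Union>c\<in>G. B c) x \<partial>M)" using UN by simp
  also have "\<dots> \<le> (\<integral>\<^sup>+x. (\<integral>\<^sup>+c. indicator (B c) x \<partial>count_space G) \<partial>M)"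
  proof (intro nn_integral_mono)
    fix x
    show "indicator (\<Union>c\<in>G. B c) x \<le> (\<integral>\<^sup>+c. indicator (B c) x \<partial>count_space G)"
    proof (cases "x \<in> (\<Union>c\<in>G. B c)")
      case True
      then obtain c where "c \<in> G" "x \<in> B c" by blast
      then show ?thesis using nn_integral_ge_point[of c G "\<lambda>c. indicator (B c) x"] by (auto simp: indicator_def)
    qed simp
  qed
  also have "\<dots> = (\<integral>\<^sup>+c. (\<integral>\<^sup>+x. indicator (B c) x \<partial>M) \<partial>count_space G)"
    using G B by (intro nn_integral_count_space_nn_integral) auto
  also have "\<dots> = (\<integral>\<^sup>+c. emeasure M (B c) \<partial>count_space G)"
    using B by (intro nn_integral_cong) auto
  finally show ?thesis .
qed simp

text \<open>The balls of a disjoint subfamily, enlarged to cover \<open>A\<close>, gain at most a factor in measure by the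
  doubling condition, while the disjoint balls themselves share the mass of \<open>W\<close>.\<close>

lemma covering_estimate:
  assumes \<nu>: "sets \<nu> = sets borel" and W: "open W"
    and A: "\<And>x. x \<in> A \<Longrightarrow> \<exists>r>0. r \<le> 1 \<and> ball x r \<subseteq> W \<and> ennreal t * emeasure M (ball x r) \<le> emeasure \<nu> (ball x r)"
  obtains S where "S \<in> sets borel" "A \<subseteq> S" "ennreal t * emeasure M S \<le> ennreal (C ^ 3) * emeasure \<nu> W"
proof -
  define K where "K = {b. fst b \<in> A \<and> 0 < snd b \<and> snd b \<le> 1 \<and> ball (fst b) (snd b) \<subseteq> W \<and>
     ennreal t * emeasure M (ball (fst b) (snd b)) \<le> emeasure \<nu> (ball (fst b) (snd b))}"
  obtain G where G: "G \<subseteq> K"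
    "\<And>b c. b \<in> G \<Longrightarrow> c \<in> G \<Longrightarrow> b \<noteq> c \<Longrightarrow> ball (fst b) (snd b) \<inter> ball (fst c) (snd c) = {}"
    "\<And>b. b \<in> K \<Longrightarrow> \<exists>c\<in>G. ball (fst b) (snd b) \<subseteq> ball (fst c) (5 * snd c)"
    by (rule Vitali_disjoint_balls[of K 1]) (auto simp: K_def)
  have GK: "0 < snd c" "ball (fst c) (snd c) \<subseteq> W"
    "ennreal t * emeasure M (ball (fst c) (snd c)) \<le> emeasure \<nu> (ball (fst c) (snd c))" if "c \<in> G" for c
    using that G(1) by (auto simp: K_def)
  have cG: "countable G" using GK(1) G(2) by (rule countable_disjoint_balls)
  \<comment> \<open>the factor 5 of the covering lemma is rounded up to a power of 2, for three doublings\<close>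
  define S where "S = (\<Union>c\<in>G. ball (fst c) (2 ^ 3 * snd c))"
  have "open S" by (auto simp: S_def)
  have disj: "disjoint_family_on (\<lambda>c. ball (fst c) (snd c)) G" using G(2) by (auto simp: disjoint_family_on_def)
  show thesis
  proof (rule that)
    show "S \<in> sets borel" using \<open>open S\<close> by simp
    show "A \<subseteq> S"
    proof
      fix x assume "x \<in> A"
      then obtain r where r: "0 < r" "r \<le> 1" "ball x r \<subseteq> W" "ennreal t * emeasure M (ball x r) \<le> emeasure \<nu> (ball x r)"
        using A by blast
      then have "(x, r) \<in> K" using \<open>x \<in> A\<close> by (simp add: K_def)
      then obtain c where c: "c \<in> G" "ball x r \<subseteq> ball (fst c) (5 * snd c)" using G(3) by fastforce
      moreover have "x \<in> ball x r" using r by simp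
      moreover have "ball (fst c) (5 * snd c) \<subseteq> ball (fst c) (2 ^ 3 * snd c)"
        using GK(1)[OF c(1)] by (intro subset_ball) simp
      ultimately show "x \<in> S" unfolding S_def by blast
    qed
    have "ennreal t * emeasure M S \<le> ennreal t * (\<integral>\<^sup>+c. emeasure M (ball (fst c) (2 ^ 3 * snd c)) \<partial>count_space G)"
      unfolding S_def using cG by (intro mult_left_mono emeasure_UN_le_count_space) auto
    also have "\<dots> \<le> ennreal t * (\<integral>\<^sup>+c. ennreal (C ^ 3) * emeasure M (ball (fst c) (snd c)) \<partial>count_space G)"
      using GK(1) by (intro mult_left_mono nn_integral_mono doubling_power) auto
    also have "\<dots> = ennreal (C ^ 3) * (\<integral>\<^sup>+c. ennreal t * emeasure M (ball (fst c) (snd c)) \<partial>count_space G)"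
      by (simp add: nn_integral_cmult mult.left_commute)
    also have "\<dots> \<le> ennreal (C ^ 3) * (\<integral>\<^sup>+c. emeasure \<nu> (ball (fst c) (snd c)) \<partial>count_space G)"
      using GK(3) by (intro mult_left_mono nn_integral_mono) auto
    also have "(\<integral>\<^sup>+c. emeasure \<nu> (ball (fst c) (snd c)) \<partial>count_space G) = emeasure \<nu> (\<Union>c\<in>G. ball (fst c) (snd c))"
      using cG \<nu> disj by (intro emeasure_UN_countable[symmetric]) auto
    also have "ennreal (C ^ 3) * \<dots> \<le> ennreal (C ^ 3) * emeasure \<nu> W"
      using GK(2) W \<nu> by (intro mult_left_mono emeasure_mono) auto
    finally show "ennreal t * emeasure M S \<le> ennreal (C ^ 3) * emeasure \<nu> W" .
  qed
qed

text \<open>At each exceptional point there are arbitrarily small balls on which the mean density exceeds some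
  \<open>t > 0\<close>. These balls may be chosen in an open neighbourhood of \<open>F\<close> of small mass, and the covering
  lemma bounds the measure of their union by a multiple of this mass.\<close>

lemma density_zero_on_null_set:
  assumes \<nu>: "finite_measure \<nu>" "sets \<nu> = sets borel" and F: "F \<in> sets borel" "emeasure \<nu> F = 0"
  shows "AE x in M. x \<in> F \<longrightarrow>
    (\<forall>k. \<forall>\<^sub>F r in at_right 0. emeasure \<nu> (ball x r) \<le> ennreal (1 / real (Suc k)) * emeasure M (ball x r))"
proof -
  have "AE x in M. \<not> (x \<in> F \<and> \<not> (\<forall>\<^sub>F r in at_right 0. emeasure \<nu> (ball x r) \<le> ennreal t * emeasure M (ball x r)))"
    if t: "0 < t" for t
  proof -
    define A where "A = {x\<in>F. \<not> (\<forall>\<^sub>F r in at_right 0. emeasure \<nu> (ball x r) \<le> ennreal t * emeasure M (ball x r))}"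
    have "\<exists>S. S \<in> sets borel \<and> A \<subseteq> S \<and> ennreal t * emeasure M S \<le> ennreal (C ^ 3) * ennreal (1 / real (Suc n))" for n
    proof -
      obtain F' W where W: "closed F'" "F' \<subseteq> F" "F \<subseteq> W" "open W" "emeasure \<nu> (W - F') < ennreal (1 / real (Suc n))"
        using finite_borel_measure_regular[OF \<nu> F(1), of "1 / real (Suc n)"] by auto
      have "emeasure \<nu> W \<le> emeasure \<nu> (F \<union> (W - F'))" using W F \<nu>(2) by (intro emeasure_mono) auto
      also have "\<dots> \<le> emeasure \<nu> F + emeasure \<nu> (W - F')" using W F \<nu>(2) by (intro emeasure_subadditive) auto
      also have "\<dots> \<le> ennreal (1 / real (Suc n))" using W(5) F(2) by simp
      finally have \<nu>W: "emeasure \<nu> W \<le> ennreal (1 / real (Suc n))" .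
      have "\<exists>r>0. r \<le> 1 \<and> ball x r \<subseteq> W \<and> ennreal t * emeasure M (ball x r) \<le> emeasure \<nu> (ball x r)" if x: "x \<in> A" for x
      proof -
        have "x \<in> W" using x W(3) by (auto simp: A_def)
        then obtain d where d: "0 < d" "ball x d \<subseteq> W" using W(4) open_contains_ball by blast
        have "\<not> (\<forall>r>0. r < min d 1 \<longrightarrow> emeasure \<nu> (ball x r) \<le> ennreal t * emeasure M (ball x r))"
        proof
          assume *: "\<forall>r>0. r < min d 1 \<longrightarrow> emeasure \<nu> (ball x r) \<le> ennreal t * emeasure M (ball x r)"
          have "\<forall>\<^sub>F r in at_right 0. r \<in> {0<..<min d 1}" by (rule eventually_at_right_real) (use d in auto)
          then have "\<forall>\<^sub>F r in at_right 0. emeasure \<nu> (ball x r) \<le> ennreal t * emeasure M (ball x r)"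
            by eventually_elim (use * in auto)
          with x show False by (simp add: A_def)
        qed
        then obtain r where r: "0 < r" "r < min d 1" "\<not> emeasure \<nu> (ball x r) \<le> ennreal t * emeasure M (ball x r)" by blast
        moreover have "ball x r \<subseteq> W" using d(2) subset_ball[of r d x] r(2) by auto
        ultimately show ?thesis by (intro exI[of _ r]) auto
      qed
      then obtain S where "S \<in> sets borel" "A \<subseteq> S" "ennreal t * emeasure M S \<le> ennreal (C ^ 3) * emeasure \<nu> W"
        by (rule covering_estimate[OF \<nu>(2) W(4)])
      moreover have "ennreal (C ^ 3) * emeasure \<nu> W \<le> ennreal (C ^ 3) * ennreal (1 / real (Suc n))"
        by (intro mult_left_mono \<nu>W) simp
      ultimately show ?thesis using order_trans by blast
    qed
    then obtain S where S: "\<And>n. S n \<in> sets borel \<and> A \<subseteq> S n \<and> ennreal t * emeasure M (S n) \<le> ennreal (C ^ 3) * ennreal (1 / real (Suc n))"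
      by (rule that[OF someI_ex])
    have meas: "(\<Inter>n. S n) \<in> sets M" using S by auto
    have "ennreal t * emeasure M (\<Inter>n. S n) \<le> 0 + ennreal e" if e: "0 < e" for e :: real
    proof -
      obtain n where n: "1 / real (Suc n) < e / C ^ 3" using nat_approx_posE[of "e / C ^ 3"] e C_ge_1 by auto
      have "ennreal t * emeasure M (\<Inter>n. S n) \<le> ennreal t * emeasure M (S n)"
        using S by (intro mult_left_mono emeasure_mono) auto
      also have "\<dots> \<le> ennreal (C ^ 3 * (1 / real (Suc n)))" 
        using S[of n] ennreal_mult''[of "1 / real (Suc n)" "C ^ 3"] by simp
      also have "\<dots> \<le> ennreal e"
      proof (rule ennreal_leI)
        have "C ^ 3 * (1 / real (Suc n)) \<le> C ^ 3 * (e / C ^ 3)" using n C_ge_1 by (intro mult_left_mono) auto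
        then show "C ^ 3 * (1 / real (Suc n)) \<le> e" using C_ge_1 by simp
      qed
      finally show ?thesis by simp
    qed
    then have "ennreal t * emeasure M (\<Inter>n. S n) \<le> 0" by (rule ennreal_le_epsilon)
    then have "emeasure M (\<Inter>n. S n) = 0" using t by simp
    then have "(\<Inter>n. S n) \<in> null_sets M" using meas by auto
    then show ?thesis
      by (rule AE_I') (use S in \<open>auto simp: A_def\<close>)
  qed
  then have "AE x in M. \<not> (x \<in> F \<and> \<not> (\<forall>\<^sub>F r in at_right 0. emeasure \<nu> (ball x r) \<le> ennreal (1 / real (Suc k)) * emeasure M (ball x r)))" for k
    by simp
  then have "AE x in M. \<forall>k. \<not> (x \<in> F \<and> \<not> (\<forall>\<^sub>F r in at_right 0. emeasure \<nu> (ball x r) \<le> ennreal (1 / real (Suc k)) * emeasure M (ball x r)))"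
    unfolding AE_all_countable by blast
  then show ?thesis by eventually_elim auto
qed

end

context doubling_measure
begin

text \<open>On the set where \<open>q \<le> J < q + d\<close> the quotients are up to small errors between \<open>q\<close> and
  \<open>q + d\<close>: both \<open>\<mu>\<close> and the measure with density \<open>J\<close>, restricted to the complement of this set, have
  density zero at almost all of its points. Countably many such sets suffice.\<close>

theorem Lebesgue_differentiation:
  assumes J [measurable]: "J \<in> borel_measurable borel" and fin: "finite_measure (density M J)"
    and W: "open W" "bounded W"
  shows "AE x in M. x \<in> W \<longrightarrow>
    ((\<lambda>r. emeasure (density M J) (ball x r) / emeasure M (ball x r)) \<longlongrightarrow> J x) (at_right 0)"
proof -
  define \<nu> where "\<nu> = density M J"
  have \<nu>_fin: "finite_measure \<nu>" using fin by (simp add: \<nu>_def)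
  have sets_\<nu>: "sets \<nu> = sets borel" by (simp add: \<nu>_def)
  have W' [measurable]: "W \<in> sets borel" using W by simp
  define F where "F j k = {x\<in>W. ennreal (real j / real (Suc k)) \<le> J x \<and> J x < ennreal (real (Suc j) / real (Suc k))}" for j k
  have F [measurable]: "F j k \<in> sets borel" for j k unfolding F_def by measurable
  have zero1: "AE x in M. x \<in> F j k \<longrightarrow> (\<forall>n. \<forall>\<^sub>F r in at_right 0.
      emeasure \<nu> (ball x r - F j k) \<le> ennreal (1 / real (Suc n)) * emeasure M (ball x r))" for j k
  proof -
    have em: "emeasure (density \<nu> (indicator (- F j k))) B = emeasure \<nu> (B - F j k)" if "B \<in> sets borel" for B
    proof -
      have "emeasure (density \<nu> (indicator (- F j k))) B = emeasure \<nu> (- F j k \<inter> B)"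
        using that sets_\<nu> F by (subst emeasure_density) (auto simp flip: indicator_inter_arith)
      also have "- F j k \<inter> B = B - F j k" by auto
      finally show ?thesis .
    qed
    have "finite_measure (density \<nu> (indicator (- F j k)))"
    proof (rule finite_measureI)
      have "emeasure (density \<nu> (indicator (- F j k))) UNIV = emeasure \<nu> (UNIV - F j k)" by (rule em) simp
      then show "emeasure (density \<nu> (indicator (- F j k))) (space (density \<nu> (indicator (- F j k)))) \<noteq> \<infinity>"
        using finite_measure.emeasure_finite[OF \<nu>_fin] by (simp add: \<nu>_def)
    qed
    from density_zero_on_null_set[OF this, of "F j k"] show ?thesis
      using em sets_\<nu> by simp
  qed
  have zero2: "AE x in M. x \<in> F j k \<longrightarrow> (\<forall>n. \<forall>\<^sub>F r in at_right 0.
      emeasure M (ball x r \<inter> W - F j k) \<le> ennreal (1 / real (Suc n)) * emeasure M (ball x r))" for j k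
  proof -
    have em: "emeasure (density M (indicator (W - F j k))) B = emeasure M (B \<inter> W - F j k)" if "B \<in> sets borel" for B
    proof -
      have "emeasure (density M (indicator (W - F j k))) B = emeasure M ((W - F j k) \<inter> B)"
        using that by (subst emeasure_density) (auto simp flip: indicator_inter_arith)
      also have "(W - F j k) \<inter> B = B \<inter> W - F j k" by auto
      finally show ?thesis .
    qed
    have "finite_measure (density M (indicator (W - F j k)))"
    proof (rule finite_measureI)
      have "emeasure (density M (indicator (W - F j k))) UNIV = emeasure M (UNIV \<inter> W - F j k)" by (rule em) simp
      also have "\<dots> \<le> emeasure M W" by (intro emeasure_mono) auto
      also have "\<dots> < \<infinity>" by (rule emeasure_bounded_finite[OF W(2)])
      finally show "emeasure (density M (indicator (W - F j k))) (space (density M (indicator (W - F j k)))) \<noteq> \<infinity>"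
        by simp
    qed
    from density_zero_on_null_set[OF this, of "F j k"] show ?thesis
      using em[of "F j k"] em by (simp add: Diff_eq_empty_iff[THEN iffD2, OF Int_lower1])
  qed
  have J_fin: "AE x in M. J x \<noteq> \<infinity>"
  proof (rule nn_integral_PInf_AE)
    have "(\<integral>\<^sup>+x. J x \<partial>M) = emeasure \<nu> UNIV" unfolding \<nu>_def by (subst emeasure_density) auto
    then show "(\<integral>\<^sup>+x. J x \<partial>M) \<noteq> \<infinity>" using finite_measure.emeasure_finite[OF \<nu>_fin] by simp
  qed measurable
  from zero1 have "AE x in M. \<forall>j k. x \<in> F j k \<longrightarrow> (\<forall>n. \<forall>\<^sub>F r in at_right 0.
      emeasure \<nu> (ball x r - F j k) \<le> ennreal (1 / real (Suc n)) * emeasure M (ball x r))"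
    unfolding AE_all_countable by blast
  moreover from zero2 have "AE x in M. \<forall>j k. x \<in> F j k \<longrightarrow> (\<forall>n. \<forall>\<^sub>F r in at_right 0.
      emeasure M (ball x r \<inter> W - F j k) \<le> ennreal (1 / real (Suc n)) * emeasure M (ball x r))"
    unfolding AE_all_countable by blast
  ultimately show ?thesis
    using J_fin
  proof eventually_elim
    case (elim x)
    show ?case
    proof
      assume x: "x \<in> W"
      obtain d where d: "0 < d" "ball x d \<subseteq> W" using x W(1) open_contains_ball by blast
      obtain y where y: "J x = ennreal y" "0 \<le> y" using elim(3) by (cases "J x") auto
      define q where "q r = measure \<nu> (ball x r) / measure M (ball x r)" for r
      have Mb: "emeasure M (ball x r) = ennreal (measure M (ball x r))" "0 < measure M (ball x r)" if "0 < r" for r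
      proof -
        show *: "emeasure M (ball x r) = ennreal (measure M (ball x r))"
          using ball_fin[OF that, of x] by (simp add: emeasure_eq_ennreal_measure)
        show "0 < measure M (ball x r)" using ball_pos[OF that, of x] * by simp
      qed
      have \<nu>b: "emeasure \<nu> B = ennreal (measure \<nu> B)" for B
        using finite_measure.emeasure_eq_measure[OF \<nu>_fin] .
      have quot: "emeasure \<nu> (ball x r) / emeasure M (ball x r) = ennreal (q r)" if "0 < r" for r
        unfolding q_def \<nu>b Mb(1)[OF that] using Mb(2)[OF that] by (intro divide_ennreal) auto
      \<comment> \<open>\<open>j / (k + 1)\<close> is the grid point below \<open>J x\<close>\<close>
      have bounds: "\<forall>\<^sub>F r in at_right 0. q r \<le> real (Suc j) / real (Suc k) + 1 / real (Suc k) \<and>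
          real j / real (Suc k) - real j / real (Suc k) * (1 / real (Suc n)) \<le> q r"
        if j: "real j / real (Suc k) \<le> y" "y < real (Suc j) / real (Suc k)" for j k n
      proof -
        have xF: "x \<in> F j k" using x j y by (simp add: F_def ennreal_less_iff ennreal_le_iff)
        have "\<forall>\<^sub>F r in at_right 0. emeasure \<nu> (ball x r - F j k) \<le> ennreal (1 / real (Suc k)) * emeasure M (ball x r)"
          using elim(1) xF by blast
        moreover have "\<forall>\<^sub>F r in at_right 0. emeasure M (ball x r \<inter> W - F j k) \<le> ennreal (1 / real (Suc n)) * emeasure M (ball x r)"
          using elim(2) xF by blast
        moreover have "\<forall>\<^sub>F r in at_right 0. r \<in> {0<..<d}" by (rule eventually_at_right_real[OF d(1)])
        ultimately show ?thesis
        proof eventually_elim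
          case (elim r)
          then have r: "0 < r" "r < d" by auto
          have BW: "ball x r \<subseteq> W" using d(2) subset_ball[of r d x] r by auto
          define b where "b = measure M (ball x r)"
          have b: "0 < b" using Mb(2)[OF r(1)] by (simp add: b_def)
          have Mfin: "emeasure M B = ennreal (measure M B)" if "B \<subseteq> ball x r" "B \<in> sets borel" for B
          proof -
            have "emeasure M B \<le> emeasure M (ball x r)" using that by (intro emeasure_mono) auto
            also have "\<dots> < \<infinity>" using r(1) by (rule ball_fin)
            finally show ?thesis by (simp add: emeasure_eq_ennreal_measure)
          qed
          have splitM: "b = measure M (ball x r \<inter> F j k) + measure M (ball x r - F j k)"
          proof -
            have "emeasure M (ball x r) = emeasure M (ball x r \<inter> F j k) + emeasure M (ball x r - F j k)"
              by (subst plus_emeasure) (auto intro!: arg_cong[where f = "emeasure M"])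
            then show ?thesis
              using Mfin[of "ball x r \<inter> F j k"] Mfin[of "ball x r - F j k"] Mb(1)[OF r(1)]
              by (simp add: b_def flip: ennreal_plus)
          qed
          have split\<nu>: "measure \<nu> (ball x r) = measure \<nu> (ball x r \<inter> F j k) + measure \<nu> (ball x r - F j k)"
          proof -
            have "emeasure \<nu> (ball x r) = emeasure \<nu> (ball x r \<inter> F j k) + emeasure \<nu> (ball x r - F j k)"
              using sets_\<nu> by (subst plus_emeasure) (auto intro!: arg_cong[where f = "emeasure \<nu>"])
            then show ?thesis unfolding \<nu>b by (simp flip: ennreal_plus)
          qed
          have e1: "measure \<nu> (ball x r - F j k) \<le> 1 / real (Suc k) * b"
          proof -
            have "ennreal (measure \<nu> (ball x r - F j k)) \<le> ennreal (1 / real (Suc k) * b)"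
              using elim(1) b unfolding \<nu>b Mb(1)[OF r(1)] by (simp add: b_def ennreal_mult' flip: ennreal_mult')
            then show ?thesis using b by (subst (asm) ennreal_le_iff) auto
          qed
          have e2: "measure M (ball x r - F j k) \<le> 1 / real (Suc n) * b"
          proof -
            have "ball x r \<inter> W - F j k = ball x r - F j k" using BW by auto
            then have "ennreal (measure M (ball x r - F j k)) \<le> ennreal (1 / real (Suc n) * b)"
              using elim(2) b Mfin[of "ball x r - F j k"] unfolding Mb(1)[OF r(1)] by (simp add: b_def ennreal_mult' flip: ennreal_mult')
            then show ?thesis using b by (subst (asm) ennreal_le_iff) auto
          qed
          have eq: "emeasure \<nu> (ball x r \<inter> F j k) = (\<integral>\<^sup>+u. J u * indicator (ball x r \<inter> F j k) u \<partial>M)"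
            unfolding \<nu>_def by (subst emeasure_density) auto
          have MF: "emeasure M (ball x r \<inter> F j k) = ennreal (measure M (ball x r \<inter> F j k))"
            by (rule Mfin) auto
          have up: "measure \<nu> (ball x r \<inter> F j k) \<le> real (Suc j) / real (Suc k) * measure M (ball x r \<inter> F j k)"
          proof -
            have "emeasure \<nu> (ball x r \<inter> F j k) \<le> (\<integral>\<^sup>+u. ennreal (real (Suc j) / real (Suc k)) * indicator (ball x r \<inter> F j k) u \<partial>M)"
              unfolding eq by (intro nn_integral_mono) (auto simp: indicator_def F_def intro: less_imp_le)
            also have "\<dots> = ennreal (real (Suc j) / real (Suc k)) * emeasure M (ball x r \<inter> F j k)"
              by (subst nn_integral_cmult_indicator) auto
            also have "\<dots> = ennreal (real (Suc j) / real (Suc k) * measure M (ball x r \<inter> F j k))"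
              unfolding MF by (rule ennreal_mult''[symmetric]) simp
            finally show ?thesis unfolding \<nu>b by (subst (asm) ennreal_le_iff) auto
          qed
          have low: "real j / real (Suc k) * measure M (ball x r \<inter> F j k) \<le> measure \<nu> (ball x r \<inter> F j k)"
          proof -
            have "ennreal (real j / real (Suc k) * measure M (ball x r \<inter> F j k)) = ennreal (real j / real (Suc k)) * emeasure M (ball x r \<inter> F j k)"
              unfolding MF by (rule ennreal_mult'') simp
            also have "\<dots> = (\<integral>\<^sup>+u. ennreal (real j / real (Suc k)) * indicator (ball x r \<inter> F j k) u \<partial>M)"
              by (subst nn_integral_cmult_indicator) auto
            also have "\<dots> \<le> emeasure \<nu> (ball x r \<inter> F j k)"
              unfolding eq by (intro nn_integral_mono) (auto simp: indicator_def F_def)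
            finally show ?thesis unfolding \<nu>b by (subst (asm) ennreal_le_iff) auto
          qed
          have "measure \<nu> (ball x r) \<le> real (Suc j) / real (Suc k) * measure M (ball x r \<inter> F j k) + 1 / real (Suc k) * b"
            using split\<nu> up e1 by linarith
          also have "\<dots> \<le> real (Suc j) / real (Suc k) * b + 1 / real (Suc k) * b"
            using splitM by (intro add_right_mono mult_left_mono) auto
          also have "\<dots> = (real (Suc j) / real (Suc k) + 1 / real (Suc k)) * b" by (simp add: distrib_right)
          finally have upper: "q r \<le> real (Suc j) / real (Suc k) + 1 / real (Suc k)"
            using b unfolding q_def b_def[symmetric] by (simp only: pos_divide_le_eq)
          have "(real j / real (Suc k) - real j / real (Suc k) * (1 / real (Suc n))) * b
              = real j / real (Suc k) * (b - 1 / real (Suc n) * b)" by (simp add: algebra_simps)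
          also have "\<dots> \<le> real j / real (Suc k) * measure M (ball x r \<inter> F j k)"
            using splitM e2 by (intro mult_left_mono) auto
          also have "\<dots> \<le> measure \<nu> (ball x r)" using low split\<nu> measure_nonneg[of \<nu> "ball x r - F j k"] by linarith
          finally have "real j / real (Suc k) - real j / real (Suc k) * (1 / real (Suc n)) \<le> q r"
            using b unfolding q_def b_def[symmetric] by (simp only: pos_le_divide_eq)
          with upper show ?case by blast
        qed
      qed
      have "(q \<longlongrightarrow> y) (at_right 0)"
      proof (rule tendstoI)
        fix e :: real assume e: "0 < e"
        obtain k where k: "1 / real (Suc k) < e / 4" using nat_approx_posE[of "e / 4"] e by auto
        obtain n where n: "1 / real (Suc n) < e / (4 * (y + 1))" using nat_approx_posE[of "e / (4 * (y + 1))"] e y(2) by auto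
        define j where "j = nat \<lfloor>y * real (Suc k)\<rfloor>"
        have "real j \<le> y * real (Suc k)" "y * real (Suc k) < real (Suc j)"
          using y(2) unfolding j_def by (simp_all add: of_nat_nat) linarith+
        then have j: "real j / real (Suc k) \<le> y" "y < real (Suc j) / real (Suc k)"
          by (simp_all add: pos_divide_le_eq pos_less_divide_eq)
        have j2: "real (Suc j) / real (Suc k) = real j / real (Suc k) + 1 / real (Suc k)"
          by (simp add: add_divide_distrib)
        have "real j / real (Suc k) * (1 / real (Suc n)) \<le> y * (e / (4 * (y + 1)))"
          using j(1) n y(2) e by (intro mult_mono) auto
        also have "\<dots> \<le> e / 4" using y(2) e by (simp add: divide_simps)
        finally have small: "real j / real (Suc k) * (1 / real (Suc n)) \<le> e / 4" .
        show "\<forall>\<^sub>F r in at_right 0. dist (q r) y < e"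
          using bounds[OF j, of n]
        proof eventually_elim
          case (elim r)
          then have "q r \<le> y + 2 * (1 / real (Suc k))" "y - 1 / real (Suc k) - e / 4 \<le> q r"
            using j j2 small by linarith+
          then show ?case using k e unfolding dist_real_def abs_less_iff by linarith
        qed
      qed
      then have "((\<lambda>r. ennreal (q r)) \<longlongrightarrow> J x) (at_right 0)" unfolding y(1) by (rule tendsto_ennrealI)
      moreover have "\<forall>\<^sub>F r in at_right 0. ennreal (q r) = emeasure \<nu> (ball x r) / emeasure M (ball x r)"
        using eventually_at_right_real[OF zero_less_one] by eventually_elim (simp add: quot)
      ultimately have "((\<lambda>r. emeasure \<nu> (ball x r) / emeasure M (ball x r)) \<longlongrightarrow> J x) (at_right 0)"
        by (rule Lim_transform_eventually)
      then show "((\<lambda>r. emeasure (density M J) (ball x r) / emeasure M (ball x r)) \<longlongrightarrow> J x) (at_right 0)"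
        by (simp add: \<nu>_def)
    qed
  qed
qed

end

section \<open>Change of variables\<close>

locale bimeasurable_homeomorphism = doubling_measure M C
  for M :: "'a::metric_space measure" and C +
  fixes p :: real and \<Omega> \<Omega>' :: "'a set" and \<phi> \<psi> :: "'a \<Rightarrow> 'a"
  assumes p: "1 < p"
    and \<Omega>: "open \<Omega>" "\<Omega> \<noteq> {}" "bounded \<Omega>"
    and \<Omega>': "open \<Omega>'" "\<Omega>' \<noteq> {}" "bounded \<Omega>'"
    and homeo: "homeomorphism \<Omega> \<Omega>' \<phi> \<psi>"
    and bimeas: "bi_measurable M \<Omega> \<Omega>' \<phi>"
begin

lemma p_pos: "0 < p" using p by simp

lemma \<phi>_in: "x \<in> \<Omega> \<Longrightarrow> \<phi> x \<in> \<Omega>'" and \<psi>_in: "y \<in> \<Omega>' \<Longrightarrow> \<psi> y \<in> \<Omega>"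
  and \<psi>_\<phi>: "x \<in> \<Omega> \<Longrightarrow> \<psi> (\<phi> x) = x" and \<phi>_\<psi>: "y \<in> \<Omega>' \<Longrightarrow> \<phi> (\<psi> y) = y"
  and \<phi>_cont: "continuous_on \<Omega> \<phi>" and \<psi>_cont: "continuous_on \<Omega>' \<psi>"
  using homeo by (auto simp: homeomorphism_def)

lemma Borel_\<Omega> [measurable, simp]: "\<Omega> \<in> sets borel" "\<Omega>' \<in> sets borel"
  using \<Omega> \<Omega>' by auto

lemma emeasure_\<Omega>_finite: "emeasure M \<Omega> < \<infinity>" "emeasure M \<Omega>' < \<infinity>"
  using emeasure_bounded_finite[OF \<Omega>(3)] emeasure_bounded_finite[OF \<Omega>'(3)] by auto

text \<open>Total Borel versions of the homeomorphism and its inverse.\<close>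

definition \<phi>0 :: "'a \<Rightarrow> 'a" where "\<phi>0 x = (if x \<in> \<Omega> then \<phi> x else undefined)"
definition \<psi>0 :: "'a \<Rightarrow> 'a" where "\<psi>0 y = (if y \<in> \<Omega>' then \<psi> y else undefined)"

lemma \<phi>0_measurable [measurable]: "\<phi>0 \<in> borel_measurable borel"
  unfolding \<phi>0_def[abs_def]
  by (subst measurable_If_restrict_space_iff) (auto intro!: borel_measurable_continuous_on_restrict \<phi>_cont)

lemma \<psi>0_measurable [measurable]: "\<psi>0 \<in> borel_measurable borel"
  unfolding \<psi>0_def[abs_def]
  by (subst measurable_If_restrict_space_iff) (auto intro!: borel_measurable_continuous_on_restrict \<psi>_cont)

text \<open>The measure \<open>E \<mapsto> \<mu>(\<phi>(E \<inter> \<Omega>))\<close>. By the Luzin condition it has a density, which is the Jacobian.\<close>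

definition image_volume :: "'a measure" where
  "image_volume = distr (density M (indicator \<Omega>')) borel \<psi>0"

definition J0 :: "'a \<Rightarrow> ennreal" where
  "J0 = RN_deriv M image_volume"

lemma sets_image_volume [simp, measurable_cong]: "sets image_volume = sets borel"
  by (simp add: image_volume_def)

lemma emeasure_image_volume:
  assumes E [measurable]: "E \<in> sets borel"
  shows "emeasure image_volume E = emeasure M (\<psi>0 -` E \<inter> \<Omega>')"
proof -
  have V: "\<psi>0 -` E \<in> sets borel" using measurable_sets[OF \<psi>0_measurable E] by simp
  have "emeasure image_volume E = emeasure (density M (indicator \<Omega>')) (\<psi>0 -` E)"
    unfolding image_volume_def by (subst emeasure_distr) auto
  also have "\<dots> = emeasure M (\<Omega>' \<inter> \<psi>0 -` E)"
    using V by (subst emeasure_density) (auto simp flip: indicator_inter_arith)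
  finally show ?thesis by (simp add: Int_commute)
qed

lemma preimage_eq_image: "\<psi>0 -` E \<inter> \<Omega>' = \<phi> ` (E \<inter> \<Omega>)"
proof (intro equalityI subsetI)
  fix y assume "y \<in> \<psi>0 -` E \<inter> \<Omega>'"
  then have "\<psi> y \<in> E \<inter> \<Omega>" "y = \<phi> (\<psi> y)" using \<psi>_in \<phi>_\<psi> by (auto simp: \<psi>0_def)
  then show "y \<in> \<phi> ` (E \<inter> \<Omega>)" by blast
next
  fix y assume "y \<in> \<phi> ` (E \<inter> \<Omega>)"
  then show "y \<in> \<psi>0 -` E \<inter> \<Omega>'" using \<phi>_in \<psi>_\<phi> by (auto simp: \<psi>0_def)
qed

lemma finite_measure_image_volume: "finite_measure image_volume"
proof (rule finite_measureI)
  have "emeasure image_volume UNIV = emeasure M \<Omega>'" by (simp add: emeasure_image_volume)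
  then show "emeasure image_volume (space image_volume) \<noteq> \<infinity>"
    using emeasure_\<Omega>_finite by (simp add: image_volume_def)
qed

lemma sigma_finite_M: "sigma_finite_measure M"
proof
  let ?A = "range (\<lambda>n. ball (undefined :: 'a) (real (Suc n)))"
  have "x \<in> \<Union>?A" for x
  proof -
    obtain n :: nat where "dist undefined x < real n" using reals_Archimedean2 by blast
    then have "x \<in> ball undefined (real (Suc n))" by simp
    then show ?thesis by blast
  qed
  then have "\<Union>?A = space M" by auto
  moreover have "\<forall>a\<in>?A. emeasure M a \<noteq> \<infinity>"
    using ball_fin[of "real (Suc n)" undefined for n] by (auto simp: less_top[symmetric])
  ultimately show "\<exists>A. countable A \<and> A \<subseteq> sets M \<and> \<Union>A = space M \<and> (\<forall>a\<in>A. emeasure M a \<noteq> \<infinity>)"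
    by (intro exI[of _ ?A]) auto
qed

lemma null_sets_completion_Borel:
  assumes "E \<in> sets borel" shows "E \<in> null_sets (completion M) \<longleftrightarrow> E \<in> null_sets M"
  using assms by (intro null_sets_completion_iff) simp

lemma J0_measurable [measurable]: "J0 \<in> borel_measurable borel"
proof -
  have "J0 \<in> borel_measurable M" unfolding J0_def by simp
  then show ?thesis using measurable_cong_sets[OF sets_M refl] by blast
qed

lemma density_J0: "density M J0 = image_volume"
  unfolding J0_def
proof (rule sigma_finite_measure.density_RN_deriv[OF sigma_finite_M])
  show "absolutely_continuous M image_volume"
    unfolding absolutely_continuous_def
  proof
    fix N assume N: "N \<in> null_sets M"
    then have N': "N \<in> sets borel" by auto
    have "N \<inter> \<Omega> \<in> null_sets M" using N by (intro null_set_Int2) auto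
    then have "N \<inter> \<Omega> \<in> null_sets (completion M)" by (rule null_sets_completionI)
    moreover have "\<forall>E. E \<subseteq> \<Omega> \<longrightarrow> E \<in> null_sets (completion M) \<longrightarrow> \<phi> ` E \<in> null_sets (completion M)"
      using bimeas unfolding bi_measurable_def by (rule conjunct1)
    ultimately have "\<phi> ` (N \<inter> \<Omega>) \<in> null_sets (completion M)" by simp
    then have "\<psi>0 -` N \<inter> \<Omega>' \<in> null_sets (completion M)" by (simp add: preimage_eq_image)
    moreover have "\<psi>0 -` N \<inter> \<Omega>' \<in> sets borel" using measurable_sets[OF \<psi>0_measurable N'] by simp
    ultimately have "\<psi>0 -` N \<inter> \<Omega>' \<in> null_sets M" by (simp add: null_sets_completion_Borel)
    then show "N \<in> null_sets image_volume" using N' by (auto simp: null_sets_def emeasure_image_volume)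
  qed
qed simp

lemma measurable_comp_\<phi>:
  "H \<in> borel_measurable borel \<Longrightarrow> zero_off \<Omega> (\<lambda>x. H (\<phi> x)) \<in> borel_measurable borel"
proof -
  assume [measurable]: "H \<in> borel_measurable borel"
  have "zero_off \<Omega> (\<lambda>x. H (\<phi> x)) = zero_off \<Omega> (\<lambda>x. H (\<phi>0 x))"
    by (auto simp: zero_off_def \<phi>0_def indicator_def fun_eq_iff)
  also have "\<dots> \<in> borel_measurable borel" unfolding zero_off_def[abs_def] by measurable
  finally show ?thesis .
qed

lemma change_of_variables:
  assumes H [measurable]: "H \<in> borel_measurable borel"
  shows "(\<integral>\<^sup>+x\<in>\<Omega>. H (\<phi> x) * J0 x \<partial>M) = (\<integral>\<^sup>+y\<in>\<Omega>'. H y \<partial>M)"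
proof -
  note [measurable] = measurable_comp_\<phi>[OF H]
  have "(\<integral>\<^sup>+x\<in>\<Omega>. H (\<phi> x) * J0 x \<partial>M) = (\<integral>\<^sup>+x. J0 x * zero_off \<Omega> (\<lambda>x. H (\<phi> x)) x \<partial>M)"
    by (intro nn_integral_cong) (simp add: zero_off_def mult_ac)
  also have "\<dots> = (\<integral>\<^sup>+x. zero_off \<Omega> (\<lambda>x. H (\<phi> x)) x \<partial>image_volume)"
    unfolding density_J0[symmetric] by (rule nn_integral_density[symmetric]) auto
  also have "\<dots> = (\<integral>\<^sup>+y. zero_off \<Omega> (\<lambda>x. H (\<phi> x)) (\<psi>0 y) \<partial>density M (indicator \<Omega>'))"
    unfolding image_volume_def by (rule nn_integral_distr) auto
  also have "\<dots> = (\<integral>\<^sup>+y. indicator \<Omega>' y * zero_off \<Omega> (\<lambda>x. H (\<phi> x)) (\<psi>0 y) \<partial>M)"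
    by (rule nn_integral_density) auto
  also have "\<dots> = (\<integral>\<^sup>+y\<in>\<Omega>'. H y \<partial>M)"
    by (intro nn_integral_cong) (auto simp: indicator_def zero_off_def \<psi>0_def \<phi>_\<psi> \<psi>_in)
  finally show ?thesis .
qed

text \<open>For small \<open>r\<close> the ball lies in \<open>\<Omega>\<close>, and the quotient in the definition of the metric Jacobian is that
  of the measure with density \<open>J0\<close>.\<close>

lemma J0_eq_metric_Jacobian: "AE x in M. x \<in> \<Omega> \<longrightarrow> metric_Jacobian M \<phi> x = J0 x"
proof -
  have "finite_measure (density M J0)" by (simp add: density_J0 finite_measure_image_volume)
  from Lebesgue_differentiation[OF J0_measurable this \<Omega>(1,3)] show ?thesis
  proof eventually_elim
    case (elim x)
    show ?case
    proof
      assume x: "x \<in> \<Omega>"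
      then obtain d where d: "0 < d" "ball x d \<subseteq> \<Omega>" using \<Omega>(1) open_contains_ball by blast
      have "\<forall>\<^sub>F r in at_right 0. emeasure (density M J0) (ball x r) / emeasure M (ball x r)
         = emeasure M (\<phi> ` ball x r) / emeasure M (ball x r)"
        using eventually_at_right_real[OF d(1)]
      proof eventually_elim
        case (elim r)
        then have "ball x r \<subseteq> \<Omega>" using d(2) subset_ball[of r d x] by auto
        then have "ball x r \<inter> \<Omega> = ball x r" by blast
        then show ?case by (simp add: density_J0 emeasure_image_volume preimage_eq_image)
      qed
      with elim[rule_format, OF x] have "((\<lambda>r. emeasure M (\<phi> ` ball x r) / emeasure M (ball x r)) \<longlongrightarrow> J0 x) (at_right 0)"
        by (rule Lim_transform_eventually)
      then show "metric_Jacobian M \<phi> x = J0 x"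
        unfolding metric_Jacobian_def by (rule tendsto_Lim[rotated]) simp
    qed
  qed
qed

lemma J0_finite: "AE x in M. J0 x < \<infinity>"
proof -
  have "(\<integral>\<^sup>+x. J0 x \<partial>M) = emeasure image_volume UNIV"
    unfolding density_J0[symmetric] by (subst emeasure_density) auto
  also have "\<dots> \<noteq> \<infinity>" using finite_measure.emeasure_finite[OF finite_measure_image_volume] by simp
  finally have "AE x in M. J0 x \<noteq> \<infinity>" by (intro nn_integral_PInf_AE) auto
  then show ?thesis by eventually_elim (simp add: less_top[symmetric])
qed

text \<open>An estimate of energies over preimages of closed sets by volumes extends to Borel sets by
  regularity and can then be differentiated.\<close>

lemma le_Jacobian_if_le_on_closed:
  assumes G [measurable]: "zero_off \<Omega> G \<in> borel_measurable borel" and fin: "(\<integral>\<^sup>+x\<in>\<Omega>. G x \<partial>M) < \<infinity>"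
    and k: "0 \<le> k"
    and le: "\<And>F. closed F \<Longrightarrow> (\<integral>\<^sup>+x\<in>\<Omega>. G x * indicator F (\<phi> x) \<partial>M) \<le> ennreal k * emeasure M (F \<inter> \<Omega>')"
  shows "AE x in M. x \<in> \<Omega> \<longrightarrow> G x \<le> ennreal k * J0 x"
proof -
  define m where "m = distr (density M (zero_off \<Omega> G)) borel \<phi>0"
  have sets_m: "sets m = sets borel" by (simp add: m_def)
  have em: "emeasure m A = (\<integral>\<^sup>+x\<in>\<Omega>. G x * indicator A (\<phi> x) \<partial>M)" if A: "A \<in> sets borel" for A
  proof -
    have V: "\<phi>0 -` A \<in> sets borel" using measurable_sets[OF \<phi>0_measurable A] by simp
    have "emeasure m A = emeasure (density M (zero_off \<Omega> G)) (\<phi>0 -` A)"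
      unfolding m_def using A by (subst emeasure_distr) auto
    also have "\<dots> = (\<integral>\<^sup>+x\<in>\<phi>0 -` A. zero_off \<Omega> G x \<partial>M)" using V by (subst emeasure_density) auto
    also have "\<dots> = (\<integral>\<^sup>+x\<in>\<Omega>. G x * indicator A (\<phi> x) \<partial>M)"
      by (intro nn_integral_cong) (auto simp: zero_off_def \<phi>0_def indicator_def)
    finally show ?thesis .
  qed
  have m_fin: "finite_measure m"
  proof (rule finite_measureI)
    show "emeasure m (space m) \<noteq> \<infinity>" using em[of UNIV] fin by (simp add: m_def)
  qed
  have m_le: "emeasure m A \<le> ennreal k * emeasure M (A \<inter> \<Omega>')" if A: "A \<in> sets borel" for A
  proof (rule ennreal_le_epsilon)
    fix e :: real assume e: "0 < e"
    obtain F U where F: "closed F" "F \<subseteq> A" "A \<subseteq> U" "open U" "emeasure m (U - F) < ennreal e"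
      using finite_borel_measure_regular[OF m_fin sets_m A e] by (elim exE conjE)
    have "emeasure m A \<le> emeasure m (F \<union> (U - F))" using F sets_m by (intro emeasure_mono) auto
    also have "\<dots> \<le> emeasure m F + emeasure m (U - F)" using F sets_m by (intro emeasure_subadditive) auto
    also have "\<dots> \<le> ennreal k * emeasure M (F \<inter> \<Omega>') + ennreal e"
      using F le[OF F(1)] em[of F] by (intro add_mono) auto
    also have "\<dots> \<le> ennreal k * emeasure M (A \<inter> \<Omega>') + ennreal e"
      using F A by (intro add_right_mono mult_left_mono emeasure_mono) auto
    finally show "emeasure m A \<le> ennreal k * emeasure M (A \<inter> \<Omega>') + ennreal e" .
  qed
  define H where "H x = ennreal k * J0 x" for x
  have H [measurable]: "H \<in> borel_measurable borel" unfolding H_def[abs_def] by measurable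
  \<comment> \<open>the set where the claim fails; its image \<open>A\<close> is a Borel set of volume \<open>\<integral>\<^sub>B J\<close>\<close>
  define B where "B = {x\<in>\<Omega>. H x < zero_off \<Omega> G x}"
  have B [measurable]: "B \<in> sets borel" unfolding B_def by measurable
  define A where "A = \<psi>0 -` B \<inter> \<Omega>'"
  have A: "A \<in> sets borel" unfolding A_def using measurable_sets[OF \<psi>0_measurable B] by simp
  have A_iff: "\<phi> x \<in> A \<longleftrightarrow> x \<in> B" if "x \<in> \<Omega>" for x
    using that \<phi>_in \<psi>_\<phi> by (auto simp: A_def \<psi>0_def)
  have "(\<integral>\<^sup>+x\<in>B. zero_off \<Omega> G x \<partial>M) = emeasure m A"
    unfolding em[OF A] by (intro nn_integral_cong) (auto simp: zero_off_def indicator_def A_iff B_def)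
  also have "\<dots> \<le> ennreal k * emeasure M (A \<inter> \<Omega>')" by (rule m_le[OF A])
  also have "emeasure M (A \<inter> \<Omega>') = emeasure image_volume B"
    by (simp add: emeasure_image_volume A_def Int_assoc)
  also have "ennreal k * \<dots> = (\<integral>\<^sup>+x\<in>B. H x \<partial>M)"
    unfolding density_J0[symmetric] H_def
    by (simp add: emeasure_density nn_integral_cmult mult.assoc)
  finally have le_int: "(\<integral>\<^sup>+x\<in>B. zero_off \<Omega> G x \<partial>M) \<le> (\<integral>\<^sup>+x\<in>B. H x \<partial>M)" .
  have "(\<integral>\<^sup>+x\<in>B. zero_off \<Omega> G x \<partial>M) < \<infinity>"
  proof -
    have "(\<integral>\<^sup>+x\<in>B. zero_off \<Omega> G x \<partial>M) \<le> (\<integral>\<^sup>+x\<in>\<Omega>. G x \<partial>M)"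
      by (intro nn_integral_mono) (auto simp: zero_off_def indicator_def)
    with fin show ?thesis by simp
  qed
  moreover have HG: "H x * indicator B x \<le> zero_off \<Omega> G x * indicator B x" for x
    by (auto simp: B_def indicator_def)
  then have "(\<integral>\<^sup>+x\<in>B. H x \<partial>M) \<le> (\<integral>\<^sup>+x\<in>B. zero_off \<Omega> G x \<partial>M)" by (rule nn_integral_mono)
  ultimately have finH: "(\<integral>\<^sup>+x\<in>B. H x \<partial>M) \<noteq> \<infinity>" by auto
  have "(\<integral>\<^sup>+x. zero_off \<Omega> G x * indicator B x - H x * indicator B x \<partial>M)
      = (\<integral>\<^sup>+x\<in>B. zero_off \<Omega> G x \<partial>M) - (\<integral>\<^sup>+x\<in>B. H x \<partial>M)"
    using finH HG by (intro nn_integral_diff) auto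
  also have "\<dots> = 0" using le_int finH by (auto simp: diff_eq_0_iff_ennreal less_top[symmetric] top_unique)
  finally have "AE x in M. zero_off \<Omega> G x * indicator B x - H x * indicator B x = 0"
    by (subst (asm) nn_integral_0_iff_AE) auto
  moreover have "AE x in M. zero_off \<Omega> G x \<noteq> \<infinity>"
  proof (rule nn_integral_PInf_AE)
    show "(\<integral>\<^sup>+x. zero_off \<Omega> G x \<partial>M) \<noteq> \<infinity>" using fin by (simp add: zero_off_def)
  qed measurable
  ultimately show ?thesis
  proof eventually_elim
    case (elim x)
    have "x \<notin> B"
    proof
      assume x: "x \<in> B"
      then have "zero_off \<Omega> G x - H x = 0" using elim(1) by simp
      then have "zero_off \<Omega> G x \<le> H x" using elim(2) by (simp add: diff_eq_0_iff_ennreal less_top[symmetric])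
      with x show False by (auto simp: B_def)
    qed
    then show ?case by (auto simp: B_def zero_off_def H_def)
  qed
qed

end

lemma least_ug_AE_cong:
  assumes M: "sets M = sets borel" and p: "0 < p" and U: "open U"
    and g: "least_ug M p U F g" and h: "zero_off U h \<in> borel_measurable borel"
    and eq: "AE x in M. x \<in> U \<longrightarrow> g x = h x"
  shows "least_ug M p U F h"
proof -
  have gU: "g \<in> common_ug M p U F" and g_le: "\<forall>k\<in>common_ug M p U F. AE x in M. x \<in> U \<longrightarrow> g x \<le> k x"
    using g unfolding least_ug_def by blast+
  have le: "AE x in M. x \<in> U \<longrightarrow> g x \<le> h x" using eq by eventually_elim auto
  have "energy M p U h = energy M p U g"
    unfolding energy_def by (rule nn_integral_cong_AE) (use eq in eventually_elim, auto simp: indicator_def)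
  then have "h \<in> common_ug M p U F"
    using gU weak_upper_gradient_AE_mono[OF M p U _ _ h le] by (auto simp: common_ug_def)
  moreover have "AE x in M. x \<in> U \<longrightarrow> h x \<le> k x" if "k \<in> common_ug M p U F" for k
    using eq bspec[OF g_le that] by eventually_elim auto
  ultimately show ?thesis unfolding least_ug_def by blast
qed

lemma least_ug_unique:
  assumes "least_ug M p U F g" "least_ug M p U F h"
  shows "AE x in M. x \<in> U \<longrightarrow> g x = h x"
proof -
  have "AE x in M. x \<in> U \<longrightarrow> g x \<le> h x" "AE x in M. x \<in> U \<longrightarrow> h x \<le> g x"
    using assms unfolding least_ug_def by blast+
  then show ?thesis by eventually_elim auto
qed

lemma upper_gradient_imp_weak:
  assumes "upper_gradient U f g" shows "weak_upper_gradient M p U f g"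
proof -
  have "modulus M p {} \<le> (\<integral>\<^sup>+x. enn_powr ((\<lambda>_. 0) x) p \<partial>M)"
    unfolding modulus_def by (rule INF_lower) simp
  then have "modulus M p {} = 0" by simp
  then show ?thesis using assms unfolding weak_upper_gradient_def upper_gradient_def by blast
qed

section \<open>An exhaustion by sets compactly inside a domain\<close>

text \<open>The points at distance more than \<open>1 / (k + 1)\<close> from the complement, described by balls so that a
  set with empty complement needs no special treatment.\<close>

definition inner_part :: "'a::metric_space set \<Rightarrow> nat \<Rightarrow> 'a set" where
  "inner_part \<Omega> k = {x. \<exists>d>1 / real (Suc k). ball x d \<subseteq> \<Omega>}"

lemma ball_subset_shift: "dist x y \<le> e \<Longrightarrow> ball y (d - e) \<subseteq> ball x (d :: real)"
proof
  fix z assume "dist x y \<le> e" "z \<in> ball y (d - e)"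
  then show "z \<in> ball x d" using dist_triangle[of x z y] by simp
qed

lemma open_inner_part: "open (inner_part \<Omega> k)"
  unfolding open_contains_ball
proof
  fix x assume "x \<in> inner_part \<Omega> k"
  then obtain d where d: "1 / real (Suc k) < d" "ball x d \<subseteq> \<Omega>" by (auto simp: inner_part_def)
  define e where "e = (d - 1 / real (Suc k)) / 2"
  have e: "0 < e" "1 / real (Suc k) < d - e" using d(1) unfolding e_def by argo+
  have "y \<in> inner_part \<Omega> k" if "y \<in> ball x e" for y
  proof -
    have "ball y (d - e) \<subseteq> ball x d" using that by (intro ball_subset_shift) simp
    then show ?thesis using e d unfolding inner_part_def by blast
  qed
  then show "\<exists>e>0. ball x e \<subseteq> inner_part \<Omega> k" using e by blast
qed

lemma inner_part_subset: "inner_part \<Omega> k \<subseteq> \<Omega>"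
proof
  fix x assume "x \<in> inner_part \<Omega> k"
  then obtain d where d: "1 / real (Suc k) < d" "ball x d \<subseteq> \<Omega>" by (auto simp: inner_part_def)
  have "0 < 1 / real (Suc k)" by simp
  then have "0 < d" using d(1) by linarith
  then have "x \<in> ball x d" by simp
  then show "x \<in> \<Omega>" using d(2) by blast
qed

lemma inner_part_mono: "j \<le> k \<Longrightarrow> inner_part \<Omega> j \<subseteq> inner_part \<Omega> k"
proof
  fix x assume "j \<le> k" "x \<in> inner_part \<Omega> j"
  then obtain d where d: "1 / real (Suc j) < d" "ball x d \<subseteq> \<Omega>" by (auto simp: inner_part_def)
  have "1 / real (Suc k) \<le> 1 / real (Suc j)" using \<open>j \<le> k\<close> by (simp add: frac_le)
  then have "1 / real (Suc k) < d" using d(1) by linarith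
  then show "x \<in> inner_part \<Omega> k" using d(2) unfolding inner_part_def by blast
qed

lemma UN_inner_part: "open \<Omega> \<Longrightarrow> (\<Union>k. inner_part \<Omega> k) = \<Omega>"
proof (intro equalityI UN_least inner_part_subset subsetI)
  fix x assume "open \<Omega>" "x \<in> \<Omega>"
  then obtain d where d: "0 < d" "ball x d \<subseteq> \<Omega>" using open_contains_ball by blast
  obtain k where "1 / real (Suc k) < d" using nat_approx_posE[OF d(1)] by blast
  then have "x \<in> inner_part \<Omega> k" using d(2) unfolding inner_part_def by blast
  then show "x \<in> (\<Union>k. inner_part \<Omega> k)" by blast
qed

lemma compactly_inside_inner_part:
  assumes "bounded \<Omega>" shows "compactly_inside (inner_part \<Omega> k) \<Omega>"
  unfolding compactly_inside_def
proof (intro conjI open_inner_part)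
  show "bounded (inner_part \<Omega> k)" using assms inner_part_subset by (rule bounded_subset)
  show "closure (inner_part \<Omega> k) \<subseteq> \<Omega>"
  proof
    fix x assume "x \<in> closure (inner_part \<Omega> k)"
    then obtain y where y: "y \<in> inner_part \<Omega> k" "dist y x < 1 / real (Suc k)"
      unfolding closure_approachable by (metis of_nat_0_less_iff zero_less_Suc zero_less_divide_1_iff)
    then obtain d where d: "1 / real (Suc k) < d" "ball y d \<subseteq> \<Omega>" by (auto simp: inner_part_def)
    then have "x \<in> ball y d" using y(2) by simp
    then show "x \<in> \<Omega>" using d(2) by blast
  qed
qed

lemma compact_subset_inner_part:
  assumes "compact K" "K \<subseteq> \<Omega>" "open \<Omega>" shows "\<exists>k. K \<subseteq> inner_part \<Omega> k"
proof -
  have "K \<subseteq> \<Union>(range (inner_part \<Omega>))" using assms(2) UN_inner_part[OF assms(3)] by simp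
  then obtain \<F> where F: "\<F> \<subseteq> range (inner_part \<Omega>)" "finite \<F>" "K \<subseteq> \<Union>\<F>"
    using compactE[OF assms(1)] open_inner_part by (metis (no_types, lifting) rangeE)
  then obtain I where I: "finite I" "\<F> = inner_part \<Omega> ` I" by (meson finite_subset_image)
  show ?thesis
  proof (cases "I = {}")
    case False
    have "inner_part \<Omega> i \<subseteq> inner_part \<Omega> (Max I)" if "i \<in> I" for i
      using I(1) that by (intro inner_part_mono) simp
    then show ?thesis using F(3) I(2) by blast
  qed (use F I in auto)
qed

text \<open>The least upper gradients on the sets of the exhaustion agree almost everywhere on overlaps, and a
  function that agrees with all of them is least on every set compactly inside \<open>\<Omega>\<close>.\<close>

lemma ex_local_least_ug:
  fixes M :: "'a::metric_space measure"
  assumes M [measurable_cong]: "sets M = sets borel" and p: "0 < p" and \<Omega>: "open \<Omega>" "bounded \<Omega>" and F: "F \<noteq> {}"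
    and ne: "\<And>U. compactly_inside U \<Omega> \<Longrightarrow> common_ug M p U F \<noteq> {}"
  shows "\<exists>D. \<forall>U. compactly_inside U \<Omega> \<longrightarrow> least_ug M p U F D"
proof -
  let ?U = "inner_part \<Omega>"
  have "\<exists>g. least_ug M p (?U k) F g" for k
    by (intro ex_least_ug M p open_inner_part F ne compactly_inside_inner_part \<Omega>)
  then obtain g where g: "\<And>k. least_ug M p (?U k) F (g k)" by metis
  have U_borel [measurable]: "?U k \<in> sets borel" for k by (rule borel_open[OF open_inner_part])
  have [measurable]: "zero_off (?U k) (g k) \<in> borel_measurable borel" for k
    using g[of k] by (intro common_ug_measurable[OF M p open_inner_part F]) (simp add: least_ug_def)
  define D where "D x = (SUP k. zero_off (disjointed ?U k) (zero_off (?U k) (g k)) x)" for x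
  have dis [measurable]: "disjointed ?U k \<in> sets borel" for k
  proof -
    have "range ?U \<subseteq> sets borel" using U_borel by blast
    then have "range (disjointed ?U) \<subseteq> sets borel" by (rule sets.range_disjointed_sets)
    then show ?thesis by blast
  qed
  have D_meas: "D \<in> borel_measurable borel" unfolding D_def[abs_def] zero_off_def[of "disjointed _ _"] by measurable
  have D_eq: "D x = g k x" if x: "x \<in> disjointed ?U k" for x k
  proof (rule antisym)
    have "x \<in> ?U k" using x disjointed_subset[of ?U k] by blast
    then have k: "zero_off (disjointed ?U k) (zero_off (?U k) (g k)) x = g k x" using x by (simp add: zero_off_def)
    show "g k x \<le> D x" unfolding D_def k[symmetric] by (rule SUP_upper) simp
    have "zero_off (disjointed ?U j) (zero_off (?U j) (g j)) x \<le> g k x" for j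
    proof (cases "j = k")
      case False
      then have "x \<notin> disjointed ?U j" using x disjoint_family_disjointed[of ?U] by (auto simp: disjoint_family_on_def)
      then show ?thesis by (simp add: zero_off_def)
    qed (use k in simp)
    then show "D x \<le> g k x" unfolding D_def by (intro SUP_least)
  qed
  have agree: "AE x in M. x \<in> ?U j \<longrightarrow> h x = g j x" if h: "least_ug M p U F h" "open U" and sub: "?U j \<subseteq> U" for j h U
    by (rule least_ug_unique[OF least_ug_subset[OF M p h(2) F h(1) open_inner_part sub] g])
  show ?thesis
  proof (intro exI[of _ D] allI impI)
    fix U assume U: "compactly_inside U \<Omega>"
    then have oU: "open U" and sub: "U \<subseteq> \<Omega>" using closure_subset by (auto simp: compactly_inside_def)
    obtain h where h: "least_ug M p U F h" using ex_least_ug[OF M p oU F ne[OF U]] by blast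
    have "AE x in M. x \<in> U \<inter> ?U j \<longrightarrow> h x = g j x" for j
    proof (rule least_ug_unique[of M p _ F])
      have o: "open (U \<inter> ?U j)" using oU open_inner_part by auto
      show "least_ug M p (U \<inter> ?U j) F h" by (rule least_ug_subset[OF M p oU F h o]) auto
      show "least_ug M p (U \<inter> ?U j) F (g j)" by (rule least_ug_subset[OF M p open_inner_part F g o]) auto
    qed
    then have "AE x in M. \<forall>j. x \<in> U \<inter> ?U j \<longrightarrow> h x = g j x" unfolding AE_all_countable by blast
    then have "AE x in M. x \<in> U \<longrightarrow> h x = D x"
    proof eventually_elim
      case (elim x)
      show ?case
      proof
        assume "x \<in> U"
        then have "x \<in> (\<Union>k. disjointed ?U k)" unfolding UN_disjointed_eq using sub UN_inner_part[OF \<Omega>(1)] by blast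
        then obtain k where k: "x \<in> disjointed ?U k" by blast
        then have "x \<in> ?U k" using disjointed_subset[of ?U k] by blast
        then show "h x = D x" using elim \<open>x \<in> U\<close> D_eq[OF k] by simp
      qed
    qed
    moreover have "zero_off U D \<in> borel_measurable borel"
    proof -
      note [measurable] = D_meas borel_open[OF oU]
      show ?thesis unfolding zero_off_def[abs_def] by measurable
    qed
    ultimately show "least_ug M p U F D"
      using least_ug_AE_cong[OF M p oU h] by blast
  qed
qed

section \<open>The chain rule\<close>

context bimeasurable_homeomorphism
begin

abbreviation "dist_fns \<equiv> distance_functions \<Omega>' \<phi>"

lemma dist_fns_ne: "dist_fns \<noteq> {}"
  using \<Omega>' by (simp add: distance_functions_def)

lemma D_min_least:
  assumes ne: "\<And>U. compactly_inside U \<Omega> \<Longrightarrow> common_ug M p U dist_fns \<noteq> {}"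
    and U: "compactly_inside U \<Omega>"
  shows "least_ug M p U dist_fns (D_min M p \<Omega> \<Omega>' \<phi>)"
proof -
  have eq: "(\<forall>U. compactly_inside U \<Omega> \<longrightarrow> minimal_map_upper_gradient M p U \<Omega>' \<phi> D) \<longleftrightarrow>
      (\<forall>U. compactly_inside U \<Omega> \<longrightarrow> least_ug M p U dist_fns D)" for D
    using minimal_map_upper_gradient_iff[OF sets_M p_pos _ \<Omega>'(2)] by (auto simp: compactly_inside_def)
  have "\<exists>D. \<forall>U. compactly_inside U \<Omega> \<longrightarrow> least_ug M p U dist_fns D"
    by (rule ex_local_least_ug[OF sets_M p_pos \<Omega>(1,3) dist_fns_ne ne])
  from someI_ex[OF this] show ?thesis using U unfolding D_min_def eq by blast
qed

lemma locally_common_ug_measurable: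
  assumes D: "\<And>k. D \<in> common_ug M p (inner_part \<Omega> k) dist_fns"
  shows "zero_off \<Omega> D \<in> borel_measurable borel"
proof -
  have [measurable]: "zero_off (inner_part \<Omega> k) D \<in> borel_measurable borel" for k
    by (rule common_ug_measurable[OF sets_M p_pos open_inner_part dist_fns_ne D])
  have "zero_off \<Omega> D x = (SUP k. zero_off (inner_part \<Omega> k) D x)" for x
  proof (cases "x \<in> \<Omega>")
    case True
    then obtain k where k: "x \<in> inner_part \<Omega> k" using UN_inner_part[OF \<Omega>(1)] by blast
    show ?thesis
    proof (rule antisym)
      show "zero_off \<Omega> D x \<le> (SUP k. zero_off (inner_part \<Omega> k) D x)"
        using k True by (intro SUP_upper2[of k]) (auto simp: zero_off_def)
      show "(SUP k. zero_off (inner_part \<Omega> k) D x) \<le> zero_off \<Omega> D x"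
        using True by (intro SUP_least) (auto simp: zero_off_def indicator_def)
    qed
  next
    case False
    then have "x \<notin> inner_part \<Omega> k" for k using inner_part_subset by blast
    then show ?thesis using False by (simp add: zero_off_def)
  qed
  then have "zero_off \<Omega> D = (\<lambda>x. SUP k. zero_off (inner_part \<Omega> k) D x)" by blast
  then show ?thesis by simp
qed

text \<open>Distances to the points of a countable dense subset of the target determine the metric. So almost
  every curve is controlled by \<open>D\<close> for all these distances at once, hence for \<open>\<phi>\<close> itself.\<close>

lemma ae_curve_map_controlled:
  assumes D: "\<And>k. D \<in> common_ug M p (inner_part \<Omega> k) dist_fns"
  shows "ae_curve M p \<Omega> (\<lambda>\<gamma>. controlled \<gamma> \<phi> (zero_off \<Omega> D))"
proof -
  let ?U = "inner_part \<Omega>"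
  obtain Q :: "'a set" where Q: "countable Q" "\<forall>x. \<forall>e>0. \<exists>d\<in>Q. dist x d < e" using separable by blast
  define Z where "Z = Q \<inter> \<Omega>'"
  have dense: "\<exists>z\<in>Z. dist y z < e" if y: "y \<in> \<Omega>'" and e: "0 < e" for y e
  proof -
    obtain d where d: "0 < d" "ball y d \<subseteq> \<Omega>'" using y \<Omega>'(1) open_contains_ball by blast
    obtain z where z: "z \<in> Q" "dist y z < min d e" using Q(2) d(1) e by (meson min_less_iff_conj)
    then have "z \<in> ball y d" by simp
    then show ?thesis using z d(2) by (intro bexI[of _ z]) (auto simp: Z_def)
  qed
  have Z: "countable Z" "Z \<noteq> {}" using Q(1) dense[of _ 1] \<Omega>'(2) by (auto simp: Z_def)
  define z where "z = from_nat_into Z"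
  have z_range: "range z = Z" unfolding z_def by (rule range_from_nat_into[OF Z(2,1)])
  have zZ: "z n \<in> \<Omega>'" for n using z_range by (auto simp: Z_def)
  have D_meas [measurable]: "zero_off (?U k) D \<in> borel_measurable borel" for k
    by (rule common_ug_measurable[OF sets_M p_pos open_inner_part dist_fns_ne D])
  have "ae_curve M p \<Omega> (\<lambda>\<gamma>. \<forall>k. curve_integral \<gamma> (zero_off (?U k) D) < \<infinity>)"
  proof (rule ae_curve_all[OF sets_M p_pos], rule ae_curve_finite_integral[OF D_meas])
    show "(\<integral>\<^sup>+x. enn_powr (zero_off (?U k) D x) p \<partial>M) < \<infinity>" for k
      using D[of k] by (simp add: energy_zero_off common_ug_def)
  qed
  moreover have "ae_curve M p \<Omega> (\<lambda>\<gamma>. \<forall>k n. \<forall>a b. 0 \<le> a \<longrightarrow> a \<le> b \<longrightarrow> b \<le> 1 \<longrightarrow> \<gamma> ` {a..b} \<subseteq> ?U k \<longrightarrow>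
     ennreal (dist (dist (\<phi> (\<gamma> a)) (z n)) (dist (\<phi> (\<gamma> b)) (z n)))
       \<le> (\<integral>\<^sup>+t\<in>{a<..b}. zero_off (?U k) D (\<gamma> (unit_clamp t)) \<partial>curve_measure \<gamma>))"
  proof (intro ae_curve_all[OF sets_M p_pos])
    fix k n
    have "weak_upper_gradient M p (?U k) (\<lambda>x. dist (\<phi> x) (z n)) D"
      using D[of k] zZ[of n] by (auto simp: common_ug_def distance_functions_def)
    then show "ae_curve M p \<Omega> (\<lambda>\<gamma>. \<forall>a b. 0 \<le> a \<longrightarrow> a \<le> b \<longrightarrow> b \<le> 1 \<longrightarrow> \<gamma> ` {a..b} \<subseteq> ?U k \<longrightarrow>
     ennreal (dist (dist (\<phi> (\<gamma> a)) (z n)) (dist (\<phi> (\<gamma> b)) (z n)))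
       \<le> (\<integral>\<^sup>+t\<in>{a<..b}. zero_off (?U k) D (\<gamma> (unit_clamp t)) \<partial>curve_measure \<gamma>))"
      by (rule ae_curve_local_control[OF sets_M p_pos open_inner_part])
  qed
  ultimately have "ae_curve M p \<Omega> (\<lambda>\<gamma>. (\<forall>k. curve_integral \<gamma> (zero_off (?U k) D) < \<infinity>) \<and>
    (\<forall>k n. \<forall>a b. 0 \<le> a \<longrightarrow> a \<le> b \<longrightarrow> b \<le> 1 \<longrightarrow> \<gamma> ` {a..b} \<subseteq> ?U k \<longrightarrow>
     ennreal (dist (dist (\<phi> (\<gamma> a)) (z n)) (dist (\<phi> (\<gamma> b)) (z n)))
       \<le> (\<integral>\<^sup>+t\<in>{a<..b}. zero_off (?U k) D (\<gamma> (unit_clamp t)) \<partial>curve_measure \<gamma>)))"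
    by (rule ae_curve_conj[OF sets_M p_pos])
  then show ?thesis
  proof (rule ae_curve_mono)
    fix \<gamma> assume \<gamma>: "rectifiable_curve \<Omega> \<gamma>" and *: "(\<forall>k. curve_integral \<gamma> (zero_off (?U k) D) < \<infinity>) \<and>
    (\<forall>k n. \<forall>a b. 0 \<le> a \<longrightarrow> a \<le> b \<longrightarrow> b \<le> 1 \<longrightarrow> \<gamma> ` {a..b} \<subseteq> ?U k \<longrightarrow>
     ennreal (dist (dist (\<phi> (\<gamma> a)) (z n)) (dist (\<phi> (\<gamma> b)) (z n)))
       \<le> (\<integral>\<^sup>+t\<in>{a<..b}. zero_off (?U k) D (\<gamma> (unit_clamp t)) \<partial>curve_measure \<gamma>))"
    then have rect: "rectifiable \<gamma>" and im: "path_image \<gamma> \<subseteq> \<Omega>" by (auto simp: rectifiable_curve_iff)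
    have "compact (path_image \<gamma>)" using rect by (intro compact_path_image) (simp add: rectifiable_def)
    then obtain k where k: "path_image \<gamma> \<subseteq> ?U k" using compact_subset_inner_part[OF _ im \<Omega>(1)] by blast
    have in_U: "\<gamma> t \<in> ?U k" if "t \<in> {0..1}" for t using k that by (auto simp: path_image_def)
    have eq: "zero_off (?U k) D x = zero_off \<Omega> D x" if "x \<in> ?U k" for x
      using that inner_part_subset[of \<Omega> k] by (auto simp: zero_off_def)
    have eq': "zero_off (?U k) D (\<gamma> (unit_clamp t)) = zero_off \<Omega> D (\<gamma> (unit_clamp t))" for t
      by (intro eq in_U) simp
    show "controlled \<gamma> \<phi> (zero_off \<Omega> D)"
      unfolding controlled_def
    proof (intro conjI allI impI)
      have "curve_integral \<gamma> (zero_off \<Omega> D) = curve_integral \<gamma> (zero_off (?U k) D)"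
        using k by (intro curve_integral_cong[OF rect] eq[symmetric]) auto
      then show "curve_integral \<gamma> (zero_off \<Omega> D) < \<infinity>" using * by simp
      fix a b :: real assume ab: "0 \<le> a" "a \<le> b" "b \<le> 1"
      define I where "I = (\<integral>\<^sup>+t\<in>{a<..b}. zero_off \<Omega> D (\<gamma> (unit_clamp t)) \<partial>curve_measure \<gamma>)"
      have "\<gamma> ` {a..b} \<subseteq> ?U k" using ab in_U by auto
      then have zn: "ennreal (dist (dist (\<phi> (\<gamma> a)) (z n)) (dist (\<phi> (\<gamma> b)) (z n))) \<le> I" for n
        using * ab unfolding I_def eq'[symmetric] by blast
      have "ennreal (dist (\<phi> (\<gamma> a)) (\<phi> (\<gamma> b))) \<le> I"
      proof (rule ennreal_le_epsilon)
        fix e :: real assume e: "0 < e"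
        have "\<phi> (\<gamma> b) \<in> \<Omega>'" using in_U[of b] ab inner_part_subset[of \<Omega> k] by (intro \<phi>_in) auto
        then obtain n where n: "dist (\<phi> (\<gamma> b)) (z n) < e / 2"
          using dense[of "\<phi> (\<gamma> b)" "e / 2"] e z_range by auto
        have "dist (\<phi> (\<gamma> a)) (\<phi> (\<gamma> b)) \<le> dist (dist (\<phi> (\<gamma> a)) (z n)) (dist (\<phi> (\<gamma> b)) (z n)) + e"
          using dist_triangle2[of "\<phi> (\<gamma> a)" "\<phi> (\<gamma> b)" "z n"] n by (simp add: dist_real_def)
        then have "ennreal (dist (\<phi> (\<gamma> a)) (\<phi> (\<gamma> b))) \<le> ennreal (dist (dist (\<phi> (\<gamma> a)) (z n)) (dist (\<phi> (\<gamma> b)) (z n))) + ennreal e"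
          using e by (simp flip: ennreal_plus)
        also have "\<dots> \<le> I + ennreal e" by (intro add_right_mono zn)
        finally show "ennreal (dist (\<phi> (\<gamma> a)) (\<phi> (\<gamma> b))) \<le> I + ennreal e" .
      qed
      then show "ennreal (dist (\<phi> (\<gamma> a)) (\<phi> (\<gamma> b))) \<le> (\<integral>\<^sup>+t\<in>{a<..b}. zero_off \<Omega> D (\<gamma> (unit_clamp t)) \<partial>curve_measure \<gamma>)"
        by (simp add: I_def)
    qed
  qed simp
qed

text \<open>The measure on the parameter line with density \<open>D\<close> along \<open>\<gamma>\<close> dominates the arc length measure of
  \<open>\<phi> \<circ> \<gamma>\<close>; integrating \<open>H \<circ> \<phi>\<close> against both is the chain rule for line integrals.\<close>

lemma curve_integral_image_le:
  assumes \<gamma>: "rectifiable_curve \<Omega> \<gamma>" and ctl: "controlled \<gamma> \<phi> (zero_off \<Omega> D)"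
    and D [measurable]: "zero_off \<Omega> D \<in> borel_measurable borel"
    and H [measurable]: "H \<in> borel_measurable borel"
  shows "rectifiable_curve \<Omega>' (\<phi> \<circ> \<gamma>)"
    and "curve_integral (\<phi> \<circ> \<gamma>) H \<le> curve_integral \<gamma> (zero_off \<Omega> (\<lambda>x. H (\<phi> x) * D x))"
proof -
  have rect: "rectifiable \<gamma>" and im: "path_image \<gamma> \<subseteq> \<Omega>" using \<gamma> by (auto simp: rectifiable_curve_iff)
  note [measurable] = measurable_curve_clamp[OF rect] measurable_comp_\<phi>[OF H]
  note img = controlled_image[OF rect D ctl]
  have in_\<Omega>: "\<gamma> (unit_clamp t) \<in> \<Omega>" for t using im by (auto simp: path_image_def image_subset_iff)
  show "rectifiable_curve \<Omega>' (\<phi> \<circ> \<gamma>)"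
    using img(2) im \<phi>_in by (auto simp: rectifiable_curve_iff path_image_def)
  have comp: "(\<lambda>t. H ((\<phi> \<circ> \<gamma>) (unit_clamp t))) = (\<lambda>t. zero_off \<Omega> (\<lambda>x. H (\<phi> x)) (\<gamma> (unit_clamp t)))"
    using in_\<Omega> by (auto simp: zero_off_def)
  have meas: "(\<lambda>t. H ((\<phi> \<circ> \<gamma>) (unit_clamp t))) \<in> borel_measurable borel" unfolding comp by measurable
  have split: "zero_off \<Omega> (\<lambda>x. H (\<phi> x) * D x) = (\<lambda>x. zero_off \<Omega> (\<lambda>x. H (\<phi> x)) x * zero_off \<Omega> D x)"
    by (auto simp: zero_off_def indicator_def)
  have meas2: "zero_off \<Omega> (\<lambda>x. H (\<phi> x) * D x) \<in> borel_measurable borel" unfolding split by measurable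
  have "curve_integral (\<phi> \<circ> \<gamma>) H \<le> (\<integral>\<^sup>+t. H ((\<phi> \<circ> \<gamma>) (unit_clamp t)) \<partial>weighted_measure \<gamma> (zero_off \<Omega> D))"
    using img(3) by (intro curve_integral_le_dominated[OF img(2,1)] H) (auto simp: sets_weighted_measure[OF rect D])
  also have "\<dots> = (\<integral>\<^sup>+t. zero_off \<Omega> D (\<gamma> (unit_clamp t)) * H ((\<phi> \<circ> \<gamma>) (unit_clamp t)) \<partial>curve_measure \<gamma>)"
    by (rule nn_integral_weighted_measure[OF rect D meas])
  also have "\<dots> = (\<integral>\<^sup>+t. zero_off \<Omega> (\<lambda>x. H (\<phi> x) * D x) (\<gamma> (unit_clamp t)) \<partial>curve_measure \<gamma>)"
    using in_\<Omega> by (intro nn_integral_cong) (auto simp: zero_off_def mult_ac)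
  also have "\<dots> = curve_integral \<gamma> (zero_off \<Omega> (\<lambda>x. H (\<phi> x) * D x))"
    by (rule curve_integral_eq[OF rect meas2, symmetric])
  finally show "curve_integral (\<phi> \<circ> \<gamma>) H \<le> curve_integral \<gamma> (zero_off \<Omega> (\<lambda>x. H (\<phi> x) * D x))" .
qed

lemma energy_pullback_le:
  assumes H [measurable]: "H \<in> borel_measurable borel" and k: "0 \<le> k"
    and DJ: "AE x in M. x \<in> \<Omega> \<longrightarrow> enn_powr (D x) p \<le> ennreal k * J0 x"
  shows "energy M p \<Omega> (\<lambda>x. H (\<phi> x) * D x) \<le> ennreal k * energy M p \<Omega>' H"
proof -
  have "energy M p \<Omega> (\<lambda>x. H (\<phi> x) * D x) \<le> (\<integral>\<^sup>+x. ennreal k * ((enn_powr (H (\<phi> x)) p * J0 x) * indicator \<Omega> x) \<partial>M)"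
    unfolding energy_def
  proof (rule nn_integral_mono_AE)
    show "AE x in M. enn_powr (H (\<phi> x) * D x) p * indicator \<Omega> x \<le> ennreal k * ((enn_powr (H (\<phi> x)) p * J0 x) * indicator \<Omega> x)"
      using DJ
    proof eventually_elim
      case (elim x)
      show ?case
      proof (cases "x \<in> \<Omega>")
        case True
        then have "enn_powr (H (\<phi> x)) p * enn_powr (D x) p \<le> enn_powr (H (\<phi> x)) p * (ennreal k * J0 x)"
          using elim by (intro mult_left_mono) auto
        then show ?thesis using True by (simp add: enn_powr_mult mult_ac)
      qed simp
    qed
  qed
  also have "\<dots> = ennreal k * (\<integral>\<^sup>+x\<in>\<Omega>. enn_powr (H (\<phi> x)) p * J0 x \<partial>M)"
  proof (rule nn_integral_cmult)
    have eq: "(\<lambda>x. enn_powr (H (\<phi> x)) p * J0 x * indicator \<Omega> x) = (\<lambda>x. zero_off \<Omega> (\<lambda>x. enn_powr (H (\<phi> x)) p) x * J0 x)"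
      by (auto simp: zero_off_def mult_ac)
    note [measurable] = measurable_comp_\<phi>[of "\<lambda>y. enn_powr (H y) p"]
    show "(\<lambda>x. enn_powr (H (\<phi> x)) p * J0 x * indicator \<Omega> x) \<in> borel_measurable M"
      unfolding eq by measurable
  qed
  also have "(\<integral>\<^sup>+x\<in>\<Omega>. enn_powr (H (\<phi> x)) p * J0 x \<partial>M) = energy M p \<Omega>' H"
    unfolding energy_def by (rule change_of_variables) measurable
  finally show ?thesis .
qed

text \<open>If \<open>\<eta>\<close> describes the exceptional curves in \<open>\<Omega>'\<close>, then \<open>(\<eta> \<circ> \<phi>) D\<close> describes their preimages and
  again has finite energy.\<close>

lemma ae_curve_pullback:
  assumes D: "\<And>k. D \<in> common_ug M p (inner_part \<Omega> k) dist_fns" and k: "0 \<le> k"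
    and DJ: "AE x in M. x \<in> \<Omega> \<longrightarrow> enn_powr (D x) p \<le> ennreal k * J0 x"
    and ae: "ae_curve M p \<Omega>' P"
  shows "ae_curve M p \<Omega> (\<lambda>\<gamma>. controlled \<gamma> \<phi> (zero_off \<Omega> D) \<and> P (\<phi> \<circ> \<gamma>))"
proof -
  have D_meas [measurable]: "zero_off \<Omega> D \<in> borel_measurable borel"
    using D by (rule locally_common_ug_measurable)
  obtain \<eta> where \<eta>: "\<eta> \<in> borel_measurable borel" "(\<integral>\<^sup>+x. enn_powr (\<eta> x) p \<partial>M) < \<infinity>"
     "\<And>\<gamma>. rectifiable_curve \<Omega>' \<gamma> \<Longrightarrow> curve_integral \<gamma> \<eta> < \<infinity> \<Longrightarrow> P \<gamma>"
    using ae unfolding ae_curve_def by blast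
  have split: "zero_off \<Omega> (\<lambda>x. \<eta> (\<phi> x) * D x) = (\<lambda>x. zero_off \<Omega> (\<lambda>x. \<eta> (\<phi> x)) x * zero_off \<Omega> D x)"
    by (auto simp: zero_off_def indicator_def)
  have meas: "zero_off \<Omega> (\<lambda>x. \<eta> (\<phi> x) * D x) \<in> borel_measurable borel"
    unfolding split by (intro borel_measurable_times_ennreal measurable_comp_\<phi> \<eta>(1) D_meas)
  have "energy M p \<Omega>' \<eta> \<le> (\<integral>\<^sup>+x. enn_powr (\<eta> x) p \<partial>M)"
    unfolding energy_def by (intro nn_integral_mono) (auto simp: indicator_def)
  then have "ennreal k * energy M p \<Omega>' \<eta> < \<infinity>"
    using \<eta>(2) by (auto simp: ennreal_mult_less_top)
  then have "energy M p \<Omega> (\<lambda>x. \<eta> (\<phi> x) * D x) < \<infinity>"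
    using energy_pullback_le[OF \<eta>(1) k DJ] by (rule le_less_trans[rotated])
  then have "(\<integral>\<^sup>+x. enn_powr (zero_off \<Omega> (\<lambda>x. \<eta> (\<phi> x) * D x) x) p \<partial>M) < \<infinity>" by (simp add: energy_zero_off)
  then have "ae_curve M p \<Omega> (\<lambda>\<gamma>. curve_integral \<gamma> (zero_off \<Omega> (\<lambda>x. \<eta> (\<phi> x) * D x)) < \<infinity>)"
    by (rule ae_curve_finite_integral[OF meas])
  from ae_curve_conj[OF sets_M p_pos this ae_curve_map_controlled[OF D]] show ?thesis
  proof (rule ae_curve_mono)
    fix \<gamma> assume \<gamma>: "rectifiable_curve \<Omega> \<gamma>"
      and *: "curve_integral \<gamma> (zero_off \<Omega> (\<lambda>x. \<eta> (\<phi> x) * D x)) < \<infinity> \<and> controlled \<gamma> \<phi> (zero_off \<Omega> D)"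
    note img = curve_integral_image_le[OF \<gamma> conjunct2[OF *] D_meas \<eta>(1)]
    have "P (\<phi> \<circ> \<gamma>)" using img(1) le_less_trans[OF img(2) conjunct1[OF *]] by (rule \<eta>(3))
    then show "controlled \<gamma> \<phi> (zero_off \<Omega> D) \<and> P (\<phi> \<circ> \<gamma>)" using * by blast
  qed simp
qed

lemma weak_upper_gradient_comp:
  assumes D: "\<And>k. D \<in> common_ug M p (inner_part \<Omega> k) dist_fns" and k: "0 \<le> k"
    and DJ: "AE x in M. x \<in> \<Omega> \<longrightarrow> enn_powr (D x) p \<le> ennreal k * J0 x"
    and g: "g \<in> common_ug M p \<Omega>' {f}"
  shows "(\<lambda>x. g (\<phi> x) * D x) \<in> common_ug M p \<Omega> {f \<circ> \<phi>}"
    and "energy M p \<Omega> (\<lambda>x. g (\<phi> x) * D x) \<le> ennreal k * energy M p \<Omega>' g"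
proof -
  define H where "H = zero_off \<Omega>' g"
  have H: "H \<in> borel_measurable borel"
    unfolding H_def by (rule common_ug_measurable[OF sets_M p_pos \<Omega>'(1) _ g]) simp
  have D_meas [measurable]: "zero_off \<Omega> D \<in> borel_measurable borel"
    using D by (rule locally_common_ug_measurable)
  have Hg: "H (\<phi> x) = g (\<phi> x)" if "x \<in> \<Omega>" for x using \<phi>_in[OF that] by (simp add: H_def zero_off_def)
  have zo: "zero_off \<Omega> (\<lambda>x. g (\<phi> x) * D x) = zero_off \<Omega> (\<lambda>x. H (\<phi> x) * D x)"
    using Hg by (auto simp: zero_off_def indicator_def)
  have split: "zero_off \<Omega> (\<lambda>x. H (\<phi> x) * D x) = (\<lambda>x. zero_off \<Omega> (\<lambda>x. H (\<phi> x)) x * zero_off \<Omega> D x)"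
    by (auto simp: zero_off_def indicator_def)
  have meas: "zero_off \<Omega> (\<lambda>x. g (\<phi> x) * D x) \<in> borel_measurable borel"
    unfolding zo split by (intro borel_measurable_times_ennreal measurable_comp_\<phi> H D_meas)
  have "energy M p \<Omega> (\<lambda>x. g (\<phi> x) * D x) = energy M p \<Omega> (\<lambda>x. H (\<phi> x) * D x)"
    unfolding energy_zero_off[symmetric] zo ..
  also have "\<dots> \<le> ennreal k * energy M p \<Omega>' H" by (rule energy_pullback_le[OF H k DJ])
  also have "energy M p \<Omega>' H = energy M p \<Omega>' g"
    unfolding energy_def H_def by (intro nn_integral_cong) (auto simp: zero_off_def indicator_def)
  finally show en: "energy M p \<Omega> (\<lambda>x. g (\<phi> x) * D x) \<le> ennreal k * energy M p \<Omega>' g" .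
  have "weak_upper_gradient M p \<Omega>' f g" using g by (simp add: common_ug_def)
  then have "ae_curve M p \<Omega>' (upper_gradient_ineq f g)"
    unfolding weak_upper_gradient_def ae_curve_iff_modulus[OF sets_M p_pos] by blast
  from ae_curve_pullback[OF D k DJ this]
  have "ae_curve M p \<Omega> (\<lambda>\<gamma>. ennreal \<bar>(f \<circ> \<phi>) (\<gamma> 0) - (f \<circ> \<phi>) (\<gamma> 1)\<bar> \<le> curve_integral \<gamma> (zero_off \<Omega> (\<lambda>x. g (\<phi> x) * D x)))"
  proof (rule ae_curve_mono)
    fix \<gamma> assume \<gamma>: "rectifiable_curve \<Omega> \<gamma>"
      and *: "controlled \<gamma> \<phi> (zero_off \<Omega> D) \<and> upper_gradient_ineq f g (\<phi> \<circ> \<gamma>)"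
    note img = curve_integral_image_le[OF \<gamma> conjunct1[OF *] D_meas H]
    have "ennreal \<bar>(f \<circ> \<phi>) (\<gamma> 0) - (f \<circ> \<phi>) (\<gamma> 1)\<bar> \<le> curve_integral (\<phi> \<circ> \<gamma>) g"
      using * by (simp add: upper_gradient_ineq_def pathstart_def pathfinish_def)
    also have "\<dots> = curve_integral (\<phi> \<circ> \<gamma>) H"
      unfolding H_def by (rule curve_integral_zero_off[OF img(1), symmetric])
    also note img(2)
    finally show "ennreal \<bar>(f \<circ> \<phi>) (\<gamma> 0) - (f \<circ> \<phi>) (\<gamma> 1)\<bar> \<le> curve_integral \<gamma> (zero_off \<Omega> (\<lambda>x. g (\<phi> x) * D x))"
      unfolding zo .
  qed simp
  then have "weak_upper_gradient M p \<Omega> (f \<circ> \<phi>) (\<lambda>x. g (\<phi> x) * D x)"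
    by (rule weak_upper_gradientI[OF sets_M p_pos \<Omega>(1) meas])
  moreover have "ennreal k * energy M p \<Omega>' g < \<infinity>" using g by (simp add: common_ug_def ennreal_mult_less_top)
  ultimately show "(\<lambda>x. g (\<phi> x) * D x) \<in> common_ug M p \<Omega> {f \<circ> \<phi>}"
    using le_less_trans[OF en] by (simp add: common_ug_def)
qed

text \<open>Up to null sets measurable sets are Borel, and the second Luzin condition applies to null sets.\<close>

lemma completion_preimage:
  assumes "A \<in> sets (completion M)" "A \<subseteq> \<Omega>'"
  shows "\<phi> -` A \<inter> \<Omega> \<in> sets (completion M)"
proof -
  obtain B N N' where A: "A = B \<union> N" "N \<subseteq> N'" "N' \<in> null_sets M" "B \<in> sets M"
    using sets_completionE[OF assms(1)] by metis
  have "\<phi>0 -` B \<in> sets borel" using measurable_sets[OF \<phi>0_measurable, of B] A(4) by simp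
  moreover have "\<phi> -` B \<inter> \<Omega> = \<phi>0 -` B \<inter> \<Omega>" by (auto simp: \<phi>0_def)
  ultimately have 1: "\<phi> -` B \<inter> \<Omega> \<in> sets (completion M)" by (intro sets_completionI_sets) simp
  have N: "N \<in> null_sets (completion M)" "N \<subseteq> \<Omega>'"
    using A assms(2) by (auto intro: null_sets_completion_subset null_sets_completionI)
  have "\<forall>E. E \<subseteq> \<Omega>' \<longrightarrow> E \<in> null_sets (completion M) \<longrightarrow> \<phi> -` E \<inter> \<Omega> \<in> null_sets (completion M)"
    using bimeas unfolding bi_measurable_def by (rule conjunct2)
  then have 2: "\<phi> -` N \<inter> \<Omega> \<in> sets (completion M)" using N by blast
  have "\<phi> -` A \<inter> \<Omega> = (\<phi> -` B \<inter> \<Omega>) \<union> (\<phi> -` N \<inter> \<Omega>)" using A(1) by blast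
  then show ?thesis using 1 2 by simp
qed

lemma Borel_\<Omega>_completion [measurable, simp]: "\<Omega> \<in> sets (completion M)" "\<Omega>' \<in> sets (completion M)"
  by (auto intro: sets_completionI_sets)

lemma measurable_comp:
  assumes f: "f \<in> borel_measurable (restrict_space (completion M) \<Omega>')"
  shows "f \<circ> \<phi> \<in> borel_measurable (restrict_space (completion M) \<Omega>)"
proof (rule measurableI)
  fix S :: "'b set" assume "S \<in> sets borel"
  then have "f -` S \<inter> \<Omega>' \<in> sets (restrict_space (completion M) \<Omega>')"
    using measurable_sets[OF f] by (simp add: space_restrict_space)
  then have "f -` S \<inter> \<Omega>' \<in> sets (completion M)" by (subst (asm) sets_restrict_space_iff) auto
  then have "\<phi> -` (f -` S \<inter> \<Omega>') \<inter> \<Omega> \<in> sets (completion M)" by (rule completion_preimage) simp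
  moreover have "\<phi> -` (f -` S \<inter> \<Omega>') \<inter> \<Omega> = (f \<circ> \<phi>) -` S \<inter> space (restrict_space (completion M) \<Omega>)"
    using \<phi>_in by (auto simp: space_restrict_space)
  ultimately show "(f \<circ> \<phi>) -` S \<inter> space (restrict_space (completion M) \<Omega>) \<in> sets (restrict_space (completion M) \<Omega>)"
    by (subst sets_restrict_space_iff) (auto simp: space_restrict_space)
qed simp

end

section \<open>Local integrability\<close>

lemma weak_upper_gradient_contraction:
  assumes "weak_upper_gradient M p U f g" and h: "\<And>a b. \<bar>h a - h b\<bar> \<le> \<bar>a - b :: real\<bar>"
  shows "weak_upper_gradient M p U (\<lambda>x. h (f x)) g"
proof -
  have "upper_gradient_ineq (\<lambda>x. h (f x)) g \<gamma>" if "upper_gradient_ineq f g \<gamma>" for \<gamma>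
    using that h[of "f (pathstart \<gamma>)" "f (pathfinish \<gamma>)"] unfolding upper_gradient_ineq_def
    by (meson ennreal_leI order_trans)
  then show ?thesis using assms(1) unfolding weak_upper_gradient_def by blast
qed

context doubling_measure
begin

lemma sets_completion_Borel: "A \<in> sets borel \<Longrightarrow> A \<in> sets (completion M)"
  by (intro sets_completionI_sets) simp

text \<open>The Poincare inequality, applied to the truncations of \<open>u\<close>, bounds their mean oscillations on a ball
  uniformly. Their means are bounded as well, since \<open>u\<close> itself is bounded on a subset of positive
  measure, and the truncations increase to \<open>u\<close> in absolute value.\<close>

lemma integrable_on_ball_if_Poincare:
  assumes p: "0 < p" and \<sigma>: "1 < \<sigma>" and Cp: "0 < Cp" and r: "0 < r"
    and poincare: "\<And>f g. set_integrable (completion M) (ball x (\<sigma> * r)) f \<Longrightarrow>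
        weak_upper_gradient M p (ball x (\<sigma> * r)) f g \<Longrightarrow>
        (\<integral>\<^sup>+y\<in>ball x r. ennreal \<bar>f y - mean_value M (ball x r) f\<bar> \<partial>completion M) / emeasure M (ball x r)
          \<le> ennreal (Cp * diameter (ball x r)) *
             enn_powr ((\<integral>\<^sup>+y\<in>ball x (\<sigma> * r). enn_powr (g y) p \<partial>completion M) / emeasure M (ball x (\<sigma> * r))) (1 / p)"
    and u: "u \<in> borel_measurable (restrict_space (completion M) W)"
    and g: "g \<in> common_ug M p W {u}" and W: "open W" "ball x (\<sigma> * r) \<subseteq> W"
  shows "set_integrable (completion M) (ball x r) u"
proof -
  define B where "B = ball x r"
  define B' where "B' = ball x (\<sigma> * r)"
  have sr: "0 < \<sigma> * r" using \<sigma> r by simp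
  have "r \<le> \<sigma> * r" using \<sigma> r by simp
  then have BB': "B \<subseteq> B'" unfolding B_def B'_def by (rule subset_ball)
  have B'W: "B' \<subseteq> W" using W(2) by (simp add: B'_def)
  have [measurable]: "B \<in> sets (completion M)" "B' \<in> sets (completion M)" "W \<in> sets (completion M)"
    using W(1) by (auto simp: B_def B'_def intro: sets_completion_Borel)
  have B_fin: "emeasure M B < \<infinity>" "emeasure M B' < \<infinity>" and B_pos: "0 < emeasure M B" "0 < emeasure M B'"
    using ball_fin[OF r] ball_fin[OF sr] ball_pos[OF r] ball_pos[OF sr] by (auto simp: B_def B'_def)
  have uW: "(\<lambda>y. indicator W y *\<^sub>R u y) \<in> borel_measurable (completion M)"
  proof -
    have "W \<inter> space (completion M) \<in> sets (completion M)" by simp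
    then show ?thesis using u by (rule borel_measurable_restrict_space_iff[THEN iffD1])
  qed
  have uB' [measurable]: "(\<lambda>y. indicator B' y *\<^sub>R u y) \<in> borel_measurable (completion M)"
  proof -
    have "(\<lambda>y. indicator B' y *\<^sub>R u y) = (\<lambda>y. indicator B' y *\<^sub>R (indicator W y *\<^sub>R u y))"
    proof
      fix y show "indicator B' y *\<^sub>R u y = indicator B' y *\<^sub>R (indicator W y *\<^sub>R u y)"
        using B'W by (cases "y \<in> B'") auto
    qed
    moreover have "(\<lambda>y. indicator B' y *\<^sub>R (indicator W y *\<^sub>R u y)) \<in> borel_measurable (completion M)"
      by (rule borel_measurable_scaleR[OF borel_measurable_indicator uW]) simp
    ultimately show ?thesis by (simp only:)
  qed
  define v where "v y = indicator B' y *\<^sub>R u y" for y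
  have v [measurable]: "v \<in> borel_measurable (completion M)" unfolding v_def[abs_def] by (rule uB')
  have v_eq: "v y = u y" if "y \<in> B'" for y using that by (simp add: v_def)
  have emeasure_B: "emeasure (completion M) B = emeasure M B" by (simp add: B_def)
  define w where "w n y = max (- real n) (min (real n) (u y))" for n y
  have w_v: "w n y = max (- real n) (min (real n) (v y))" if "y \<in> B'" for n y using v_eq[OF that] by (simp add: w_def)
  have w_int: "set_integrable (completion M) B' (w n)" for n
  proof -
    have "integrable (completion M) (\<lambda>y. real n * indicator B' y :: real)"
      using B_fin by (intro integrable_mult_right integrable_real_indicator) (auto simp: B'_def)
    then have "integrable (completion M) (\<lambda>y. indicator B' y *\<^sub>R max (- real n) (min (real n) (v y)))"
    proof (rule Bochner_Integration.integrable_bound)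
      show "(\<lambda>y. indicator B' y *\<^sub>R max (- real n) (min (real n) (v y))) \<in> borel_measurable (completion M)"
        by (intro borel_measurable_scaleR borel_measurable_indicator borel_measurable_max borel_measurable_min
            borel_measurable_const v) simp
      have "norm (indicator B' y *\<^sub>R max (- real n) (min (real n) (v y))) \<le> norm (real n * indicator B' y :: real)" for y
        by (cases "y \<in> B'") auto
      then show "AE y in completion M. norm (indicator B' y *\<^sub>R max (- real n) (min (real n) (v y))) \<le> norm (real n * indicator B' y :: real)"
        by (rule AE_I2)
    qed
    moreover have "(\<lambda>y. indicator B' y *\<^sub>R max (- real n) (min (real n) (v y))) = (\<lambda>y. indicator B' y *\<^sub>R w n y)"
      using w_v by (intro ext) (simp add: indicator_def)
    ultimately show ?thesis by (simp add: set_integrable_def)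
  qed
  have w_ug: "weak_upper_gradient M p B' (w n) g" for n
  proof -
    have "weak_upper_gradient M p W u g" using g by (simp add: common_ug_def)
    then have "weak_upper_gradient M p B' u g"
      using W by (intro weak_upper_gradient_subset[of M p W u g B']) (auto simp: B'_def)
    then show ?thesis unfolding w_def[abs_def]
      by (rule weak_upper_gradient_contraction) (auto simp: max_def min_def)
  qed
  define R where "R = ennreal (Cp * diameter B) * enn_powr ((\<integral>\<^sup>+y\<in>B'. enn_powr (g y) p \<partial>completion M) / emeasure M B') (1 / p)"
  have R_fin: "R < \<infinity>"
  proof -
    have "(\<integral>\<^sup>+y\<in>B'. enn_powr (g y) p \<partial>completion M) = energy M p B' g" by (simp add: energy_def nn_integral_completion)
    also have "\<dots> \<le> energy M p W g" using p W by (intro energy_mono) (auto simp: B'_def)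
    also have "\<dots> < \<infinity>" using g by (simp add: common_ug_def)
    finally have "(\<integral>\<^sup>+y\<in>B'. enn_powr (g y) p \<partial>completion M) / emeasure M B' \<noteq> \<top>"
      using B_pos by (auto simp: ennreal_divide_eq_top_iff)
    then show ?thesis by (simp add: R_def ennreal_mult_eq_top_iff less_top[symmetric])
  qed
  define m where "m n = mean_value M B (w n)" for n
  define K where "K = R * emeasure M B"
  have K_fin: "K < \<infinity>" using R_fin B_fin by (simp add: K_def ennreal_mult_eq_top_iff less_top[symmetric])
  have osc: "(\<integral>\<^sup>+y\<in>B. ennreal \<bar>w n y - m n\<bar> \<partial>completion M) \<le> K" for n
  proof -
    let ?i = "\<integral>\<^sup>+y\<in>B. ennreal \<bar>w n y - m n\<bar> \<partial>completion M"
    have "?i / emeasure M B \<le> R"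
      unfolding B_def B'_def R_def m_def
      by (rule poincare[OF w_int[of n, unfolded B'_def] w_ug[of n, unfolded B'_def]])
    then have "?i / emeasure M B * emeasure M B \<le> K" unfolding K_def by (rule mult_right_mono) simp
    moreover have "?i / emeasure M B * emeasure M B = ?i"
    proof -
      have "?i / emeasure M B * emeasure M B = emeasure M B * (?i / emeasure M B)" by (rule mult.commute)
      also have "\<dots> = emeasure M B * ?i / emeasure M B" by (rule ennreal_times_divide)
      also have "\<dots> = ?i * emeasure M B / emeasure M B" by (simp only: mult.commute)
      also have "\<dots> = ?i" using B_pos B_fin by (intro ennreal_mult_divide_eq) auto
      finally show ?thesis .
    qed
    ultimately show ?thesis by simp
  qed
  define E where "E t = {y\<in>B. \<bar>v y\<bar> \<le> real t}" for t
  have E [measurable]: "E t \<in> sets (completion M)" for t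
  proof -
    have "E t = B \<inter> {y\<in>space (completion M). \<bar>v y\<bar> \<le> real t}" by (auto simp: E_def)
    moreover have "{y\<in>space (completion M). \<bar>v y\<bar> \<le> real t} \<in> sets (completion M)"
      by (intro borel_measurable_le borel_measurable_abs v borel_measurable_const)
    ultimately show ?thesis using \<open>B \<in> sets (completion M)\<close> by (simp only: sets.Int)
  qed
  have "\<exists>t. emeasure (completion M) (E t) \<noteq> 0"
  proof (rule ccontr)
    assume "\<not> (\<exists>t. emeasure (completion M) (E t) \<noteq> 0)"
    then have "(\<Union>t. E t) \<in> null_sets (completion M)" using E by (intro null_sets_UN) (auto simp: null_sets_def)
    moreover have "(\<Union>t. E t) = B"
    proof (intro equalityI subsetI)
      fix y assume "y \<in> B"
      moreover obtain t :: nat where "\<bar>v y\<bar> \<le> real t" using real_arch_simple by blast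
      ultimately have "y \<in> E t" by (simp add: E_def)
      then show "y \<in> (\<Union>t. E t)" by blast
    qed (auto simp: E_def)
    ultimately have "emeasure (completion M) B = 0" by (simp add: null_setsD1)
    then show False using B_pos by (simp add: B_def)
  qed
  then obtain t where t: "emeasure (completion M) (E t) \<noteq> 0" by blast
  have E_fin: "emeasure (completion M) (E t) < \<infinity>"
  proof -
    have "emeasure (completion M) (E t) \<le> emeasure (completion M) B" by (intro emeasure_mono) (auto simp: E_def)
    then show ?thesis using B_fin by (simp add: B_def)
  qed
  have wm [measurable]: "(\<lambda>y. ennreal \<bar>w n y - a\<bar> * indicator B y) \<in> borel_measurable (completion M)" for n a
  proof -
    have "(\<lambda>y. ennreal \<bar>w n y - a\<bar> * indicator B y) = (\<lambda>y. ennreal \<bar>max (- real n) (min (real n) (v y)) - a\<bar> * indicator B y)"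
    proof
      fix y
      show "ennreal \<bar>w n y - a\<bar> * indicator B y = ennreal \<bar>max (- real n) (min (real n) (v y)) - a\<bar> * indicator B y"
        using w_v[of y n] BB' by (cases "y \<in> B") auto
    qed
    moreover have "(\<lambda>y. ennreal \<bar>max (- real n) (min (real n) (v y)) - a\<bar> * indicator B y) \<in> borel_measurable (completion M)"
      by measurable
    ultimately show ?thesis by (simp only:)
  qed
  define L where "L = (ennreal (real t) * emeasure M B + K) / emeasure (completion M) (E t)"
  have L_fin: "L < \<infinity>"
  proof -
    have "ennreal (real t) * emeasure M B + K \<noteq> \<top>"
      using K_fin B_fin by (simp add: less_top[symmetric] ennreal_mult_eq_top_iff)
    then show ?thesis using t unfolding L_def by (simp add: ennreal_divide_eq_top_iff less_top[symmetric])
  qed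
  have m_le: "ennreal \<bar>m n\<bar> \<le> L" for n
  proof -
    have "ennreal \<bar>m n\<bar> * emeasure (completion M) (E t) = (\<integral>\<^sup>+y\<in>E t. ennreal \<bar>m n\<bar> \<partial>completion M)"
      by (rule nn_integral_cmult_indicator[OF E, symmetric])
    also have "\<dots> \<le> (\<integral>\<^sup>+y. ennreal (real t) * indicator B y + ennreal \<bar>w n y - m n\<bar> * indicator B y \<partial>completion M)"
    proof (rule nn_integral_mono)
      fix y
      show "ennreal \<bar>m n\<bar> * indicator (E t) y \<le> ennreal (real t) * indicator B y + ennreal \<bar>w n y - m n\<bar> * indicator B y"
      proof (cases "y \<in> E t")
        case True
        then have y: "y \<in> B" "\<bar>v y\<bar> \<le> real t" by (auto simp: E_def)
        then have "\<bar>w n y\<bar> \<le> real t" using w_v[of y n] BB' by auto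
        then have "\<bar>m n\<bar> \<le> real t + \<bar>w n y - m n\<bar>" by linarith
        then have "ennreal \<bar>m n\<bar> \<le> ennreal (real t + \<bar>w n y - m n\<bar>)" by (rule ennreal_leI)
        then show ?thesis using True y by (simp add: ennreal_plus)
      qed simp
    qed
    also have "\<dots> = ennreal (real t) * emeasure M B + (\<integral>\<^sup>+y\<in>B. ennreal \<bar>w n y - m n\<bar> \<partial>completion M)"
      using nn_integral_cmult_indicator[OF \<open>B \<in> sets (completion M)\<close>, of "ennreal (real t)"] emeasure_B
      by (subst nn_integral_add[OF _ wm]) simp_all
    also have "\<dots> \<le> ennreal (real t) * emeasure M B + K" by (intro add_left_mono osc)
    finally have le: "ennreal \<bar>m n\<bar> * emeasure (completion M) (E t) \<le> ennreal (real t) * emeasure M B + K" .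
    have "ennreal \<bar>m n\<bar> = ennreal \<bar>m n\<bar> * emeasure (completion M) (E t) / emeasure (completion M) (E t)"
      using t E_fin by (simp add: ennreal_mult_divide_eq)
    also have "\<dots> \<le> L" unfolding L_def by (rule divide_right_mono_ennreal[OF le])
    finally show ?thesis .
  qed
  have w_bound: "(\<integral>\<^sup>+y\<in>B. ennreal \<bar>w n y\<bar> \<partial>completion M) \<le> K + L * emeasure M B" for n
  proof -
    have "(\<integral>\<^sup>+y\<in>B. ennreal \<bar>w n y\<bar> \<partial>completion M)
        \<le> (\<integral>\<^sup>+y. ennreal \<bar>w n y - m n\<bar> * indicator B y + ennreal \<bar>m n\<bar> * indicator B y \<partial>completion M)"
    proof (rule nn_integral_mono)
      fix y
      have "ennreal \<bar>w n y\<bar> \<le> ennreal (\<bar>w n y - m n\<bar> + \<bar>m n\<bar>)" by (intro ennreal_leI) linarith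
      then show "ennreal \<bar>w n y\<bar> * indicator B y \<le> ennreal \<bar>w n y - m n\<bar> * indicator B y + ennreal \<bar>m n\<bar> * indicator B y"
        by (auto simp: indicator_def ennreal_plus)
    qed
    also have "\<dots> = (\<integral>\<^sup>+y\<in>B. ennreal \<bar>w n y - m n\<bar> \<partial>completion M) + ennreal \<bar>m n\<bar> * emeasure M B"
      using nn_integral_cmult_indicator[OF \<open>B \<in> sets (completion M)\<close>, of "ennreal \<bar>m n\<bar>"] emeasure_B
      by (subst nn_integral_add[OF wm]) simp_all
    also have "\<dots> \<le> K + L * emeasure M B" by (intro add_mono mult_right_mono osc m_le) simp
    finally show ?thesis .
  qed
  have "(\<integral>\<^sup>+y\<in>B. ennreal \<bar>u y\<bar> \<partial>completion M) = (\<integral>\<^sup>+y. (SUP n. ennreal \<bar>w n y - 0\<bar> * indicator B y) \<partial>completion M)"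
  proof (rule nn_integral_cong)
    fix y
    have "(SUP n. ennreal \<bar>w n y\<bar>) = ennreal \<bar>u y\<bar>"
    proof (rule antisym)
      show "(SUP n. ennreal \<bar>w n y\<bar>) \<le> ennreal \<bar>u y\<bar>" by (intro SUP_least ennreal_leI) (auto simp: w_def)
      obtain n :: nat where "\<bar>u y\<bar> \<le> real n" using real_arch_simple by blast
      then have "w n y = u y" by (auto simp: w_def)
      then show "ennreal \<bar>u y\<bar> \<le> (SUP n. ennreal \<bar>w n y\<bar>)" by (intro SUP_upper2[of n]) auto
    qed
    then show "ennreal \<bar>u y\<bar> * indicator B y = (SUP n. ennreal \<bar>w n y - 0\<bar> * indicator B y)"
      by (cases "y \<in> B") auto
  qed
  also have "\<dots> = (SUP n. \<integral>\<^sup>+y\<in>B. ennreal \<bar>w n y - 0\<bar> \<partial>completion M)"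
  proof (rule nn_integral_monotone_convergence_SUP)
    have "\<bar>w i y\<bar> \<le> \<bar>w j y\<bar>" if "i \<le> j" for i j y using that by (auto simp: w_def)
    then show "incseq (\<lambda>n y. ennreal \<bar>w n y - 0\<bar> * indicator B y)"
      by (intro incseq_SucI le_funI mult_right_mono ennreal_leI) auto
  qed measurable
  also have "\<dots> \<le> K + L * emeasure M B" by (intro SUP_least) (simp add: w_bound)
  also have "\<dots> < \<infinity>" using K_fin L_fin B_fin by (simp add: ennreal_mult_eq_top_iff less_top[symmetric])
  finally have fin: "(\<integral>\<^sup>+y\<in>B. ennreal \<bar>u y\<bar> \<partial>completion M) < \<infinity>" .
  have "integrable (completion M) (\<lambda>y. indicator B y *\<^sub>R u y)"
  proof (rule integrableI_bounded)
    have "(\<lambda>y. indicator B y *\<^sub>R u y) = (\<lambda>y. indicator B y *\<^sub>R v y)" 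
    proof
      fix y show "indicator B y *\<^sub>R u y = indicator B y *\<^sub>R v y"
        using v_eq[of y] BB' by (cases "y \<in> B") auto
    qed
    moreover have "(\<lambda>y. indicator B y *\<^sub>R v y) \<in> borel_measurable (completion M)"
      by (rule borel_measurable_scaleR[OF borel_measurable_indicator v]) simp
    ultimately show "(\<lambda>y. indicator B y *\<^sub>R u y) \<in> borel_measurable (completion M)" by (simp only:)
    have "(\<integral>\<^sup>+y. ennreal (norm (indicator B y *\<^sub>R u y)) \<partial>completion M) = (\<integral>\<^sup>+y\<in>B. ennreal \<bar>u y\<bar> \<partial>completion M)"
      by (intro nn_integral_cong) (auto simp: indicator_def)
    then show "(\<integral>\<^sup>+y. ennreal (norm (indicator B y *\<^sub>R u y)) \<partial>completion M) < \<infinity>" using fin by simp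
  qed
  then show ?thesis by (simp add: set_integrable_def B_def)
qed

lemma locally_L1_if_Poincare:
  assumes p: "0 < p" and P: "weak_Poincare M p" and W: "open W"
    and u: "u \<in> borel_measurable (restrict_space (completion M) W)" and g: "g \<in> common_ug M p W {u}"
  shows "locally_L1 M W u"
  unfolding locally_L1_def
proof (intro allI impI)
  fix K assume K: "compact K" "K \<subseteq> W"
  obtain \<sigma> Cp where P: "1 < \<sigma>" "0 < Cp" and poincare: "\<And>x r f g. 0 < r \<Longrightarrow> set_integrable (completion M) (ball x (\<sigma> * r)) f \<Longrightarrow>
        weak_upper_gradient M p (ball x (\<sigma> * r)) f g \<Longrightarrow>
        (\<integral>\<^sup>+y\<in>ball x r. ennreal \<bar>f y - mean_value M (ball x r) f\<bar> \<partial>completion M) / emeasure M (ball x r)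
          \<le> ennreal (Cp * diameter (ball x r)) *
             enn_powr ((\<integral>\<^sup>+y\<in>ball x (\<sigma> * r). enn_powr (g y) p \<partial>completion M) / emeasure M (ball x (\<sigma> * r))) (1 / p)"
    using P unfolding weak_Poincare_def by blast
  have "\<exists>r>0. ball x (\<sigma> * r) \<subseteq> W" if xK: "x \<in> K" for x
  proof -
    have "x \<in> W" using K(2) xK by blast
    then obtain d where d: "0 < d" "ball x d \<subseteq> W" using W open_contains_ball by blast
    then show ?thesis using P(1) by (intro exI[of _ "d / \<sigma>"]) auto
  qed
  then obtain r where r: "\<And>x. x \<in> K \<Longrightarrow> 0 < r x" "\<And>x. x \<in> K \<Longrightarrow> ball x (\<sigma> * r x) \<subseteq> W" by metis
  have "K \<subseteq> (\<Union>x\<in>K. ball x (r x))" using r(1) by force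
  then obtain T where T: "T \<subseteq> K" "finite T" "K \<subseteq> (\<Union>x\<in>T. ball x (r x))"
    using compactE_image[OF K(1), of K "\<lambda>x. ball x (r x)"] by auto
  have "set_integrable (completion M) (ball x (r x)) u" if "x \<in> T" for x
    using that T(1) r by (intro integrable_on_ball_if_Poincare[OF p P(1,2) _ poincare u g W]) auto
  then have "set_integrable (completion M) (\<Union>x\<in>T. ball x (r x)) u"
    using T(2) by (intro set_integrable_UN) (auto intro: sets_completion_Borel)
  then show "set_integrable (completion M) K u"
    by (rule set_integrable_subset) (use T(3) K(1) in \<open>auto intro: sets_completion_Borel borel_closed compact_imp_closed\<close>)
qed

end

section \<open>Sine and cosine as coordinates of small oscillation\<close>

lemma abs_sin_diff_le: "\<bar>sin x - sin y\<bar> \<le> \<bar>x - y :: real\<bar>"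
proof -
  have "\<bar>sin x - sin y\<bar> = 2 * (\<bar>sin ((x - y) / 2)\<bar> * \<bar>cos ((x + y) / 2)\<bar>)"
    unfolding sin_diff_sin by (simp add: abs_mult)
  also have "\<dots> \<le> 2 * (\<bar>(x - y) / 2\<bar> * 1)"
    by (intro mult_left_mono mult_mono abs_sin_x_le_abs_x) auto
  finally show ?thesis by simp
qed

lemma abs_cos_diff_le: "\<bar>cos x - cos y\<bar> \<le> \<bar>x - y :: real\<bar>"
proof -
  have "\<bar>cos x - cos y\<bar> = 2 * (\<bar>sin ((x + y) / 2)\<bar> * \<bar>sin ((y - x) / 2)\<bar>)"
    unfolding cos_diff_cos by (simp add: abs_mult)
  also have "\<dots> \<le> 2 * (1 * \<bar>(y - x) / 2\<bar>)"
    by (intro mult_left_mono mult_mono abs_sin_x_le_abs_x) auto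
  finally show ?thesis by simp
qed

lemma half_le_sin:
  assumes "0 \<le> x" "x \<le> 1/2" shows "x / 2 \<le> sin (x :: real)"
proof -
  have "sin 0 - 0 / 2 \<le> sin x - x / 2"
  proof (rule DERIV_nonneg_imp_nondecreasing[OF assms(1)])
    fix t :: real assume t: "0 \<le> t" "t \<le> x"
    have "cos (pi / 3) \<le> cos t"
      using t assms pi_ge_two by (intro cos_monotone_0_pi_le) auto
    then have "0 \<le> cos t - 1 / 2" by (simp add: cos_60)
    moreover have "((\<lambda>t. sin t - t / 2) has_real_derivative cos t - 1 / 2) (at t)"
      by (auto intro!: derivative_eq_intros)
    ultimately show "\<exists>y. ((\<lambda>t. sin t - t / 2) has_real_derivative y) (at t) \<and> 0 \<le> y" by blast
  qed
  then show ?thesis by simp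
qed

text \<open>The chord between two points of the unit circle has length \<open>2 sin (t / 2)\<close>, where \<open>t\<close> is the length
  of the arc, and this is at least half of \<open>t\<close> if \<open>t \<le> 1\<close>.\<close>

lemma abs_le_sin_cos_diff:
  assumes "\<bar>x - y\<bar> \<le> (1::real)"
  shows "\<bar>x - y\<bar> \<le> 2 * (\<bar>sin x - sin y\<bar> + \<bar>cos x - cos y\<bar>)"
proof -
  define w where "w = \<bar>x - y\<bar> / 2"
  have w: "0 \<le> w" "w \<le> 1/2" using assms by (auto simp: w_def)
  have "(sin x - sin y)\<^sup>2 + (cos x - cos y)\<^sup>2 = 2 - 2 * cos (x - y)"
    by (simp add: cos_diff power2_diff sin_squared_eq algebra_simps)
  also have "cos (x - y) = cos (2 * w)" using cos_abs_real[of "x - y"] by (simp add: w_def)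
  also have "2 - 2 * cos (2 * w) = (2 * sin w)\<^sup>2" by (simp add: cos_double_sin power_mult_distrib)
  finally have eq: "(2 * sin w)\<^sup>2 = (sin x - sin y)\<^sup>2 + (cos x - cos y)\<^sup>2" ..
  have "(2 * sin w)\<^sup>2 \<le> (\<bar>sin x - sin y\<bar> + \<bar>cos x - cos y\<bar>)\<^sup>2"
    unfolding eq by (simp add: power2_sum)
  then have "2 * sin w \<le> \<bar>sin x - sin y\<bar> + \<bar>cos x - cos y\<bar>" by (rule power2_le_imp_le) simp
  then show ?thesis using half_le_sin[OF w] by (simp add: w_def)
qed

section \<open>Test functions\<close>

context bimeasurable_homeomorphism
begin

text \<open>The constant 1 is an upper gradient of a 1-Lipschitz function, and 0 is one where the function
  vanishes; gluing gives the indicator of the support.\<close>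

lemma Lipschitz_test_function:
  assumes lip: "\<And>x y. \<bar>u x - u y\<bar> \<le> dist x y" and A: "closed A" and zero: "\<And>x. x \<notin> A \<Longrightarrow> u x = 0"
  shows "u \<in> Sobolev_S M p \<Omega>'"
    and "energy M p \<Omega>' (grad_min M p \<Omega>' u) \<le> emeasure M (A \<inter> \<Omega>')"
proof -
  have cont: "continuous_on UNIV u"
    by (rule continuous_on_iff[THEN iffD2]) (use lip in \<open>auto simp: dist_real_def intro: le_less_trans\<close>)
  then have u [measurable]: "u \<in> borel_measurable borel" by (rule borel_measurable_continuous_onI)
  have A' [measurable]: "A \<in> sets borel" using A by simp
  have one: "(\<lambda>_. 1) \<in> common_ug M p \<Omega>' {u}"
    unfolding common_ug_def
  proof (intro CollectI conjI ballI)
    fix f assume "f \<in> {u}"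
    have meas: "zero_off \<Omega>' (\<lambda>_. 1) \<in> borel_measurable borel" unfolding zero_off_def[abs_def] by measurable
    have "weak_upper_gradient M p \<Omega>' u (\<lambda>_. 1)"
    proof (rule weak_upper_gradientI[OF sets_M p_pos \<Omega>'(1) meas])
      have "ae_curve M p \<Omega>' (\<lambda>\<gamma>. curve_integral \<gamma> (\<lambda>_. 0) < \<infinity>)"
        by (rule ae_curve_finite_integral) auto
      then show "ae_curve M p \<Omega>' (\<lambda>\<gamma>. ennreal \<bar>u (\<gamma> 0) - u (\<gamma> 1)\<bar> \<le> curve_integral \<gamma> (zero_off \<Omega>' (\<lambda>_. 1)))"
      proof (rule ae_curve_mono)
        fix \<gamma> assume \<gamma>: "rectifiable_curve \<Omega>' \<gamma>"
        then have rect: "rectifiable \<gamma>" by (simp add: rectifiable_curve_iff)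
        have "\<bar>u (\<gamma> 0) - u (\<gamma> 1)\<bar> \<le> arc_length \<gamma> 1"
          using lip[of "\<gamma> 0" "\<gamma> 1"] dist_le_arc_length[OF rect, of 0 1] arc_length_nonneg[OF rect, of 0] by simp
        then have "ennreal \<bar>u (\<gamma> 0) - u (\<gamma> 1)\<bar> \<le> emeasure (curve_measure \<gamma>) UNIV"
          by (simp add: emeasure_curve_measure_UNIV[OF rect] ennreal_leI)
        also have "\<dots> = curve_integral \<gamma> (\<lambda>_. 1)" by (simp add: curve_integral_eq[OF rect])
        also have "\<dots> = curve_integral \<gamma> (zero_off \<Omega>' (\<lambda>_. 1))" by (rule curve_integral_zero_off[OF \<gamma>, symmetric])
        finally show "ennreal \<bar>u (\<gamma> 0) - u (\<gamma> 1)\<bar> \<le> curve_integral \<gamma> (zero_off \<Omega>' (\<lambda>_. 1))" .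
      qed simp
    qed
    with \<open>f \<in> {u}\<close> show "weak_upper_gradient M p \<Omega>' f (\<lambda>_. 1)" by simp
  next
    show "energy M p \<Omega>' (\<lambda>_. 1) < \<infinity>" using emeasure_\<Omega>_finite by (simp add: energy_def)
  qed
  define V where "V = \<Omega>' - A"
  have V: "open V" "V \<subseteq> \<Omega>'" using \<Omega>'(1) A by (auto simp: V_def)
  have "(\<lambda>_. 0) \<in> common_ug M p V {u}"
  proof -
    have "upper_gradient V u (\<lambda>_. 0)"
      unfolding upper_gradient_def
    proof (intro conjI allI impI)
      fix \<gamma> assume "rectifiable_curve V \<gamma>"
      then have "pathstart \<gamma> \<in> V" "pathfinish \<gamma> \<in> V" unfolding rectifiable_curve_def by auto
      then show "upper_gradient_ineq u (\<lambda>_. 0) \<gamma>" using zero by (simp add: upper_gradient_ineq_def V_def)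
    qed simp
    then show ?thesis using upper_gradient_imp_weak by (auto simp: common_ug_def energy_def)
  qed
  from common_ug_glue[OF sets_M p_pos \<Omega>'(1) _ one this V]
  have glued: "(\<lambda>x. if x \<in> V then min 1 0 else 1) \<in> common_ug M p \<Omega>' {u}" by simp
  have "locally_L1 M \<Omega>' u"
    unfolding locally_L1_def
  proof (intro allI impI)
    fix K assume K: "compact K" "K \<subseteq> \<Omega>'"
    have "compact (u ` K)" using K(1) cont by (intro compact_continuous_image) (auto intro: continuous_on_subset)
    then obtain b where b: "\<And>x. x \<in> K \<Longrightarrow> \<bar>u x\<bar> \<le> b"
      using compact_imp_bounded[of "u ` K"] unfolding bounded_iff by auto
    have KB: "K \<in> sets borel" using K(1) by (intro borel_closed compact_imp_closed)
    have "emeasure M K < \<infinity>" using K(1) by (intro emeasure_bounded_finite compact_imp_bounded)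
    then have "integrable M (\<lambda>x. b * indicator K x :: real)"
      using KB by (intro integrable_mult_right integrable_real_indicator) auto
    then have "integrable M (\<lambda>x. indicator K x *\<^sub>R u x)"
    proof (rule Bochner_Integration.integrable_bound)
      show "(\<lambda>x. indicator K x *\<^sub>R u x) \<in> borel_measurable M" using KB by measurable
      have "norm (indicator K x *\<^sub>R u x) \<le> norm (b * indicator K x :: real)" for x
        using b[of x] by (cases "x \<in> K") auto
      then show "AE x in M. norm (indicator K x *\<^sub>R u x) \<le> norm (b * indicator K x :: real)" by (rule AE_I2)
    qed
    then show "set_integrable (completion M) K u"
      unfolding set_integrable_def by (subst integrable_completion) (auto dest: borel_measurable_integrable)
  qed
  moreover have "u \<in> borel_measurable (restrict_space (completion M) \<Omega>')"
  proof (rule measurable_restrict_space1, rule measurable_completion)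
    show "u \<in> borel_measurable M" by measurable
  qed
  moreover have "\<exists>g. Lp_weak_upper_gradient M p \<Omega>' u g" using one unfolding Lp_weak_upper_gradient_iff by blast
  ultimately show "u \<in> Sobolev_S M p \<Omega>'" by (simp add: Sobolev_S_def)
  have "least_ug M p \<Omega>' {u} (grad_min M p \<Omega>' u)"
    using one by (intro grad_min_least[OF sets_M p_pos \<Omega>'(1)]) (simp add: Lp_weak_upper_gradient_iff)
  then have "energy M p \<Omega>' (grad_min M p \<Omega>' u) \<le> energy M p \<Omega>' (\<lambda>x. if x \<in> V then min 1 0 else 1)"
    by (intro energy_le_if_least_ug[OF sets_M p_pos \<Omega>'(1) _ _ glued]) simp
  also have "\<dots> = (\<integral>\<^sup>+x. indicator (A \<inter> \<Omega>') x \<partial>M)"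
    unfolding energy_def by (intro nn_integral_cong) (auto simp: V_def indicator_def)
  also have "\<dots> = emeasure M (A \<inter> \<Omega>')" by simp
  finally show "energy M p \<Omega>' (grad_min M p \<Omega>' u) \<le> emeasure M (A \<inter> \<Omega>')" .
qed

lemma energy_comp_le:
  assumes f: "f \<in> Sobolev_S M p \<Omega>'" and comp: "f \<circ> \<phi> \<in> Sobolev_S M p \<Omega>" and C0: "0 \<le> C0"
    and norm: "S_norm M p \<Omega> (f \<circ> \<phi>) \<le> ennreal C0 * S_norm M p \<Omega>' f"
  shows "energy M p \<Omega> (grad_min M p \<Omega> (f \<circ> \<phi>)) \<le> ennreal (C0 powr p) * energy M p \<Omega>' (grad_min M p \<Omega>' f)"
proof -
  have "enn_powr (S_norm M p \<Omega> (f \<circ> \<phi>)) p \<le> enn_powr (ennreal C0 * S_norm M p \<Omega>' f) p"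
    using norm p by (intro enn_powr_mono) auto
  then show ?thesis
    using C0 p by (simp add: S_norm_def Lp_norm_eq enn_powr_mult enn_powr_inverse' enn_powr_ennreal)
qed

lemma grad_min_common:
  assumes "f \<in> Sobolev_S M p \<Omega>"
  shows "least_ug M p \<Omega> {f} (grad_min M p \<Omega> f)"
proof -
  obtain g where "Lp_weak_upper_gradient M p \<Omega> f g" using assms by (auto simp: Sobolev_S_def)
  then show ?thesis by (rule grad_min_least[OF sets_M p_pos \<Omega>(1)])
qed

text \<open>Where two functions \<open>w1\<close>, \<open>w2\<close> separate the values of a continuous function \<open>v\<close> at small scales, their
  upper gradients bound the increments of \<open>v\<close> on short, hence on all parameter intervals.\<close>

lemma weak_upper_gradient_if_locally_dominated:
  assumes Q: "open Q" and v: "continuous_on Q v" and e: "0 < e"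
    and g1: "g1 \<in> common_ug M p Q {w1}" and g2: "g2 \<in> common_ug M p Q {w2}"
    and sep: "\<And>x y. x \<in> Q \<Longrightarrow> y \<in> Q \<Longrightarrow> \<bar>v x - v y\<bar> \<le> e \<Longrightarrow> \<bar>v x - v y\<bar> \<le> 2 * (\<bar>w1 x - w1 y\<bar> + \<bar>w2 x - w2 y\<bar>)"
  shows "(\<lambda>x. 4 * max (g1 x) (g2 x)) \<in> common_ug M p Q {v}"
    and "energy M p Q (\<lambda>x. 4 * max (g1 x) (g2 x)) \<le> ennreal (4 powr p) * (energy M p Q g1 + energy M p Q g2)"
proof -
  have m1 [measurable]: "zero_off Q g1 \<in> borel_measurable borel"
    by (rule common_ug_measurable[OF sets_M p_pos Q _ g1]) simp
  have m2 [measurable]: "zero_off Q g2 \<in> borel_measurable borel"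
    by (rule common_ug_measurable[OF sets_M p_pos Q _ g2]) simp
  define h where "h x = 4 * max (zero_off Q g1 x) (zero_off Q g2 x)" for x
  have zo: "zero_off Q (\<lambda>x. 4 * max (g1 x) (g2 x)) = h"
    by (auto simp: h_def zero_off_def indicator_def fun_eq_iff)
  have h [measurable]: "h \<in> borel_measurable borel" unfolding h_def[abs_def] by measurable
  have fin: "energy M p Q g1 < \<infinity>" "energy M p Q g2 < \<infinity>" using g1 g2 by (auto simp: common_ug_def)
  have "energy M p Q (\<lambda>x. 4 * max (g1 x) (g2 x)) = (\<integral>\<^sup>+x. enn_powr (h x) p \<partial>M)"
    unfolding energy_zero_off[symmetric] zo ..
  also have "\<dots> \<le> (\<integral>\<^sup>+x. ennreal (4 powr p) * (enn_powr (zero_off Q g1 x) p + enn_powr (zero_off Q g2 x) p) \<partial>M)"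
  proof (rule nn_integral_mono)
    fix x
    have "enn_powr 4 p = ennreal (4 powr p)" using enn_powr_ennreal[of 4 p] by simp
    then have "enn_powr (h x) p = ennreal (4 powr p) * max (enn_powr (zero_off Q g1 x) p) (enn_powr (zero_off Q g2 x) p)"
      by (simp add: h_def enn_powr_mult enn_powr_max[OF p_pos])
    also have "\<dots> \<le> ennreal (4 powr p) * (enn_powr (zero_off Q g1 x) p + enn_powr (zero_off Q g2 x) p)"
      by (intro mult_left_mono) (auto simp: max_def add_increasing add_increasing2)
    finally show "enn_powr (h x) p \<le> ennreal (4 powr p) * (enn_powr (zero_off Q g1 x) p + enn_powr (zero_off Q g2 x) p)" .
  qed
  also have "\<dots> = ennreal (4 powr p) * (energy M p Q g1 + energy M p Q g2)"
    by (simp add: nn_integral_cmult nn_integral_add energy_zero_off)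
  finally show en: "energy M p Q (\<lambda>x. 4 * max (g1 x) (g2 x)) \<le> ennreal (4 powr p) * (energy M p Q g1 + energy M p Q g2)" .
  have "weak_upper_gradient M p Q w1 g1" "weak_upper_gradient M p Q w2 g2"
    using g1 g2 by (auto simp: common_ug_def)
  from ae_curve_conj[OF sets_M p_pos ae_curve_controlled[OF sets_M p_pos Q this(1) fin(1)] ae_curve_controlled[OF sets_M p_pos Q this(2) fin(2)]]
  have "ae_curve M p Q (\<lambda>\<gamma>. ennreal \<bar>v (\<gamma> 0) - v (\<gamma> 1)\<bar> \<le> curve_integral \<gamma> h)"
  proof (rule ae_curve_mono)
    fix \<gamma> assume \<gamma>: "rectifiable_curve Q \<gamma>"
      and ctl: "controlled \<gamma> w1 (zero_off Q g1) \<and> controlled \<gamma> w2 (zero_off Q g2)"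
    then have rect: "rectifiable \<gamma>" by (simp add: rectifiable_curve_iff)
    note [measurable] = measurable_curve_clamp[OF rect]
    have in_Q: "\<gamma> (unit_clamp t) \<in> Q" for t using \<gamma> by (auto simp: rectifiable_curve_def path_image_def)
    let ?m = "weighted_measure \<gamma> h"
    let ?i = "\<lambda>a b. {unit_clamp a<..unit_clamp b}"
    define P where "P a b \<longleftrightarrow> ennreal \<bar>v (\<gamma> (unit_clamp a)) - v (\<gamma> (unit_clamp b))\<bar> \<le> emeasure ?m (?i a b)" for a b
    have "(0::real) \<le> 1" by simp
    then have "P 0 1"
    proof (induction rule: Bolzano)
      case (trans a b c)
      have "\<bar>v (\<gamma> (unit_clamp a)) - v (\<gamma> (unit_clamp c))\<bar>
         \<le> \<bar>v (\<gamma> (unit_clamp a)) - v (\<gamma> (unit_clamp b))\<bar> + \<bar>v (\<gamma> (unit_clamp b)) - v (\<gamma> (unit_clamp c))\<bar>" by linarith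
      then have "ennreal \<bar>v (\<gamma> (unit_clamp a)) - v (\<gamma> (unit_clamp c))\<bar>
         \<le> ennreal \<bar>v (\<gamma> (unit_clamp a)) - v (\<gamma> (unit_clamp b))\<bar> + ennreal \<bar>v (\<gamma> (unit_clamp b)) - v (\<gamma> (unit_clamp c))\<bar>"
        by (simp flip: ennreal_plus)
      also have "\<dots> \<le> emeasure ?m (?i a b) + emeasure ?m (?i b c)"
        using trans by (intro add_mono) (auto simp: P_def)
      also have "\<dots> = emeasure ?m (?i a b \<union> ?i b c)"
        by (intro plus_emeasure) (auto simp: sets_weighted_measure[OF rect h])
      also have "?i a b \<union> ?i b c = ?i a c"
        using unit_clamp_mono[OF trans(3)] unit_clamp_mono[OF trans(4)] by auto
      finally show ?case by (simp add: P_def)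
    next
      case (local x)
      have "continuous_on UNIV (\<lambda>t. v (\<gamma> (unit_clamp t)))"
        using rect in_Q by (intro continuous_on_compose2[OF v] continuous_on_unit_clamp) (auto simp: rectifiable_def)
      then obtain d where d: "0 < d" "\<And>t. dist t x < d \<Longrightarrow> dist (v (\<gamma> (unit_clamp t))) (v (\<gamma> (unit_clamp x))) < e / 2"
        using e unfolding continuous_on_iff by (metis UNIV_I half_gt_zero)
      have "P a b" if ab: "a \<le> x" "x \<le> b" "b - a < d" for a b
      proof -
        have "dist (v (\<gamma> (unit_clamp a))) (v (\<gamma> (unit_clamp x))) < e / 2" "dist (v (\<gamma> (unit_clamp b))) (v (\<gamma> (unit_clamp x))) < e / 2"
          by (rule d(2), use ab in \<open>simp add: dist_real_def\<close>)+
        then have "\<bar>v (\<gamma> (unit_clamp a)) - v (\<gamma> (unit_clamp b))\<bar> \<le> e"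
          unfolding dist_real_def by arith
        then have *: "\<bar>v (\<gamma> (unit_clamp a)) - v (\<gamma> (unit_clamp b))\<bar>
           \<le> 2 * (\<bar>w1 (\<gamma> (unit_clamp a)) - w1 (\<gamma> (unit_clamp b))\<bar> + \<bar>w2 (\<gamma> (unit_clamp a)) - w2 (\<gamma> (unit_clamp b))\<bar>)"
          by (rule sep[OF in_Q in_Q])
        have abc: "0 \<le> unit_clamp a" "unit_clamp a \<le> unit_clamp b" "unit_clamp b \<le> 1"
          using ab unit_clamp_mono[of a b] by auto
        define I where "I g = (\<integral>\<^sup>+t\<in>?i a b. g (\<gamma> (unit_clamp t)) \<partial>curve_measure \<gamma>)" for g :: "'a \<Rightarrow> ennreal"
        have c1: "ennreal \<bar>w1 (\<gamma> (unit_clamp a)) - w1 (\<gamma> (unit_clamp b))\<bar> \<le> I (zero_off Q g1)"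
          using controlledD[OF conjunct1[OF ctl] abc] by (simp add: dist_real_def I_def)
        have c2: "ennreal \<bar>w2 (\<gamma> (unit_clamp a)) - w2 (\<gamma> (unit_clamp b))\<bar> \<le> I (zero_off Q g2)"
          using controlledD[OF conjunct2[OF ctl] abc] by (simp add: dist_real_def I_def)
        have "ennreal \<bar>v (\<gamma> (unit_clamp a)) - v (\<gamma> (unit_clamp b))\<bar>
          \<le> ennreal (2 * (\<bar>w1 (\<gamma> (unit_clamp a)) - w1 (\<gamma> (unit_clamp b))\<bar> + \<bar>w2 (\<gamma> (unit_clamp a)) - w2 (\<gamma> (unit_clamp b))\<bar>))"
          by (rule ennreal_leI[OF *])
        also have "\<dots> = 2 * (ennreal \<bar>w1 (\<gamma> (unit_clamp a)) - w1 (\<gamma> (unit_clamp b))\<bar> + ennreal \<bar>w2 (\<gamma> (unit_clamp a)) - w2 (\<gamma> (unit_clamp b))\<bar>)"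
          by (simp add: ennreal_mult ennreal_plus)
        also have "\<dots> \<le> 2 * (I (zero_off Q g1) + I (zero_off Q g2))"
          by (intro mult_left_mono add_mono c1 c2) simp
        also have "\<dots> = (\<integral>\<^sup>+t. 2 * (zero_off Q g1 (\<gamma> (unit_clamp t)) * indicator (?i a b) t + zero_off Q g2 (\<gamma> (unit_clamp t)) * indicator (?i a b) t) \<partial>curve_measure \<gamma>)"
          unfolding I_def by (subst nn_integral_cmult) (auto simp: nn_integral_add)
        also have "\<dots> \<le> (\<integral>\<^sup>+t\<in>?i a b. h (\<gamma> (unit_clamp t)) \<partial>curve_measure \<gamma>)"
        proof (rule nn_integral_mono)
          fix t
          let ?A = "zero_off Q g1 (\<gamma> (unit_clamp t))" and ?B = "zero_off Q g2 (\<gamma> (unit_clamp t))"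
          have "2 * (?A + ?B) \<le> 2 * (max ?A ?B + max ?A ?B)" by (intro mult_left_mono add_mono) auto
          also have "\<dots> = h (\<gamma> (unit_clamp t))" by (simp add: h_def mult_2[symmetric] mult.assoc[symmetric])
          finally show "2 * (?A * indicator (?i a b) t + ?B * indicator (?i a b) t) \<le> h (\<gamma> (unit_clamp t)) * indicator (?i a b) t"
            by (cases "t \<in> ?i a b") auto
        qed
        also have "\<dots> = emeasure ?m (?i a b)" by (rule emeasure_weighted_measure[OF rect h, symmetric]) simp
        finally show ?thesis by (simp add: P_def)
      qed
      then show ?case using d(1) by blast
    qed
    then have "ennreal \<bar>v (\<gamma> 0) - v (\<gamma> 1)\<bar> \<le> emeasure ?m {0<..1}" by (simp add: P_def)
    also have "\<dots> = (\<integral>\<^sup>+t\<in>{0<..1}. h (\<gamma> (unit_clamp t)) \<partial>curve_measure \<gamma>)"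
      by (rule emeasure_weighted_measure[OF rect h]) simp
    also have "\<dots> \<le> curve_integral \<gamma> h"
      unfolding curve_integral_eq[OF rect h] by (intro nn_integral_mono) (auto simp: indicator_def)
    finally show "ennreal \<bar>v (\<gamma> 0) - v (\<gamma> 1)\<bar> \<le> curve_integral \<gamma> h" .
  qed simp
  then have "weak_upper_gradient M p Q v (\<lambda>x. 4 * max (g1 x) (g2 x))"
    by (intro weak_upper_gradientI[OF sets_M p_pos Q]) (simp_all only: zo h)
  moreover have "ennreal (4 powr p) * (energy M p Q g1 + energy M p Q g2) < \<infinity>"
    using fin by (simp add: ennreal_mult_less_top)
  ultimately show "(\<lambda>x. 4 * max (g1 x) (g2 x)) \<in> common_ug M p Q {v}"
    using le_less_trans[OF en] by (simp add: common_ug_def)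
qed

end

section \<open>From the composition operator to the map\<close>

context bimeasurable_homeomorphism
begin

lemma dist_map_bounded: "\<exists>b. \<forall>x\<in>\<Omega>. \<forall>z\<in>\<Omega>'. dist (\<phi> x) z \<le> b"
proof -
  obtain b where "\<forall>x\<in>\<Omega>'. \<forall>y\<in>\<Omega>'. dist x y \<le> b" using \<Omega>'(3) unfolding bounded_two_points by blast
  then show ?thesis using \<phi>_in by blast
qed

text \<open>Near the preimage of a closed set \<open>F\<close> the distance function is locally determined by the compositions
  of two test functions of small size that are supported near \<open>F\<close>: the sine and cosine of the
  rescaled distance, cut off away from \<open>F\<close>. The operator bounds the energies of their
  compositions by the volume of a neighbourhood of \<open>F\<close>.\<close>

lemma energy_distance_near_closed_le:
  assumes C0: "0 \<le> C0"
    and comp: "\<And>f. f \<in> Sobolev_S M p \<Omega>' \<Longrightarrow> f \<circ> \<phi> \<in> Sobolev_S M p \<Omega>"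
    and norm: "\<And>f. f \<in> Sobolev_S M p \<Omega>' \<Longrightarrow> S_norm M p \<Omega> (f \<circ> \<phi>) \<le> ennreal C0 * S_norm M p \<Omega>' f"
    and G: "least_ug M p \<Omega> {\<lambda>x. dist (\<phi> x) z} G"
    and F: "closed F" "F \<noteq> {}" and e: "0 < e"
  shows "(\<integral>\<^sup>+x\<in>\<Omega>. enn_powr (G x) p * indicator F (\<phi> x) \<partial>M)
    \<le> ennreal (2 * 4 powr p * C0 powr p) * emeasure M ({y. infdist y F \<le> 4 * e} \<inter> \<Omega>')"
proof -
  define A where "A = {y. infdist y F \<le> 4 * e}"
  have A: "closed A" unfolding A_def by (intro closed_Collect_le continuous_intros)
  \<comment> \<open>the cut-off is at least \<open>3 e\<close> on the \<open>e\<close>-neighbourhood of \<open>F\<close>, where it exceeds \<open>s \<le> 2 e\<close>\<close>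
  define cut where "cut y = max 0 (4 * e - infdist y F)" for y
  define s where "s i y = e * (1 + (if i then sin (dist y z / e) else cos (dist y z / e)))" for i y
  define u where "u i y = min (s i y) (cut y)" for i y
  have s_lip: "\<bar>s i x - s i y\<bar> \<le> dist x y" for i x y
  proof -
    have "\<bar>s i x - s i y\<bar> = e * \<bar>if i then sin (dist x z / e) - sin (dist y z / e) else cos (dist x z / e) - cos (dist y z / e)\<bar>"
      using e by (simp add: s_def abs_mult flip: right_diff_distrib)
    also have "\<dots> \<le> e * \<bar>dist x z / e - dist y z / e\<bar>"
      using e abs_sin_diff_le[of "dist x z / e" "dist y z / e"] abs_cos_diff_le[of "dist x z / e" "dist y z / e"]
      by (intro mult_left_mono) auto
    also have "\<dots> = \<bar>dist x z - dist y z\<bar>" using e by (simp add: diff_divide_distrib[symmetric])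
    also have "\<dots> \<le> dist x y" using abs_dist_diff_le[of x z y] by (simp add: dist_commute)
    finally show ?thesis .
  qed
  have s_bounds: "0 \<le> s i y" "s i y \<le> 2 * e" for i y
  proof -
    have "-1 \<le> (if i then sin (dist y z / e) else cos (dist y z / e))" "(if i then sin (dist y z / e) else cos (dist y z / e)) \<le> 1"
      by auto
    then have "0 \<le> 1 + (if i then sin (dist y z / e) else cos (dist y z / e))" "1 + (if i then sin (dist y z / e) else cos (dist y z / e)) \<le> 2"
      by linarith+
    then show "0 \<le> s i y" "s i y \<le> 2 * e"
      using e mult_left_mono[of "1 + (if i then sin (dist y z / e) else cos (dist y z / e))" 2 e] by (auto simp: s_def)
  qed
  have cut_lip: "\<bar>cut x - cut y\<bar> \<le> dist x y" for x y
    using infdist_triangle_abs[of x F y] unfolding cut_def by linarith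
  have u_lip: "\<bar>u i x - u i y\<bar> \<le> dist x y" for i x y
    using s_lip[of i x y] cut_lip[of x y] unfolding u_def by linarith
  have u_zero: "u i y = 0" if "y \<notin> A" for i y
    using that s_bounds(1)[of i y] by (simp add: u_def cut_def A_def)
  have u_S: "u i \<in> Sobolev_S M p \<Omega>'" "energy M p \<Omega>' (grad_min M p \<Omega>' (u i)) \<le> emeasure M (A \<inter> \<Omega>')" for i
    using Lipschitz_test_function[OF u_lip A u_zero, of i] by auto
  define g where "g i = grad_min M p \<Omega> (u i \<circ> \<phi>)" for i
  have g: "g i \<in> common_ug M p \<Omega> {u i \<circ> \<phi>}" for i
    using grad_min_common[OF comp[OF u_S(1)]] by (simp add: g_def least_ug_def)
  have g_energy: "energy M p \<Omega> (g i) \<le> ennreal (C0 powr p) * emeasure M (A \<inter> \<Omega>')" for i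
  proof -
    have "energy M p \<Omega> (g i) \<le> ennreal (C0 powr p) * energy M p \<Omega>' (grad_min M p \<Omega>' (u i))"
      unfolding g_def by (rule energy_comp_le[OF u_S(1) comp[OF u_S(1)] C0 norm[OF u_S(1)]])
    also have "\<dots> \<le> ennreal (C0 powr p) * emeasure M (A \<inter> \<Omega>')"
      by (rule mult_left_mono[OF u_S(2)[of i]]) (rule zero_le)
    finally show ?thesis .
  qed
  define Q where "Q = {x\<in>\<Omega>. infdist (\<phi> x) F < e}"
  have Q: "open Q" "Q \<subseteq> \<Omega>"
  proof -
    have "open (\<Omega> \<inter> (\<lambda>x. infdist (\<phi> x) F) -` {..<e})"
      by (intro continuous_open_preimage \<Omega>(1) continuous_intros \<phi>_cont)
    moreover have "\<Omega> \<inter> (\<lambda>x. infdist (\<phi> x) F) -` {..<e} = Q" by (auto simp: Q_def)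
    ultimately show "open Q" by simp
  qed (auto simp: Q_def)
  have u_eq: "(u i \<circ> \<phi>) x = s i (\<phi> x)" if "x \<in> Q" for i x
    using that s_bounds(2)[of i "\<phi> x"] e by (simp add: u_def cut_def Q_def)
  have gQ: "g i \<in> common_ug M p Q {u i \<circ> \<phi>}" for i
    by (rule common_ug_subset[OF sets_M p_pos \<Omega>(1) _ g Q]) simp
  have v_cont: "continuous_on Q (\<lambda>x. dist (\<phi> x) z)"
    by (intro continuous_intros continuous_on_subset[OF \<phi>_cont Q(2)])
  have sep: "\<bar>dist (\<phi> x) z - dist (\<phi> y) z\<bar> \<le> 2 * (\<bar>(u True \<circ> \<phi>) x - (u True \<circ> \<phi>) y\<bar> + \<bar>(u False \<circ> \<phi>) x - (u False \<circ> \<phi>) y\<bar>)"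
    if xy: "x \<in> Q" "y \<in> Q" and le: "\<bar>dist (\<phi> x) z - dist (\<phi> y) z\<bar> \<le> e" for x y
  proof -
    define a b where "a = dist (\<phi> x) z / e" and "b = dist (\<phi> y) z / e"
    have ab: "\<bar>dist (\<phi> x) z - dist (\<phi> y) z\<bar> = e * \<bar>a - b\<bar>" using e by (simp add: a_def b_def diff_divide_distrib[symmetric])
    then have "\<bar>a - b\<bar> \<le> 1" using le e by simp
    then have "e * \<bar>a - b\<bar> \<le> e * (2 * (\<bar>sin a - sin b\<bar> + \<bar>cos a - cos b\<bar>))"
      using e by (intro mult_left_mono abs_le_sin_cos_diff) auto
    also have "\<dots> = 2 * (\<bar>e * (sin a - sin b)\<bar> + \<bar>e * (cos a - cos b)\<bar>)" using e by (simp add: abs_mult distrib_left)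
    also have "e * (sin a - sin b) = (u True \<circ> \<phi>) x - (u True \<circ> \<phi>) y"
      unfolding u_eq[OF xy(1)] u_eq[OF xy(2)] by (simp add: s_def a_def b_def algebra_simps)
    also have "e * (cos a - cos b) = (u False \<circ> \<phi>) x - (u False \<circ> \<phi>) y"
      unfolding u_eq[OF xy(1)] u_eq[OF xy(2)] by (simp add: s_def a_def b_def algebra_simps)
    finally show ?thesis unfolding ab .
  qed
  define h where "h x = 4 * max (g True x) (g False x)" for x
  note dom = weak_upper_gradient_if_locally_dominated[OF Q(1) v_cont e gQ[of True] gQ[of False] sep, folded h_def]
  have GO: "G \<in> common_ug M p \<Omega> {\<lambda>x. dist (\<phi> x) z}" using G by (simp add: least_ug_def)
  have glued: "(\<lambda>x. if x \<in> Q then min (G x) (h x) else G x) \<in> common_ug M p \<Omega> {\<lambda>x. dist (\<phi> x) z}"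
    by (rule common_ug_glue[OF sets_M p_pos \<Omega>(1) _ GO dom(1) Q]) simp
  have "AE x in M. x \<in> \<Omega> \<longrightarrow> G x \<le> (if x \<in> Q then min (G x) (h x) else G x)"
    using G glued unfolding least_ug_def by (elim conjE bspec)
  then have "AE x in M. enn_powr (G x) p * indicator F (\<phi> x) * indicator \<Omega> x \<le> enn_powr (h x) p * indicator Q x"
  proof eventually_elim
    case (elim x)
    show ?case
    proof (cases "x \<in> \<Omega> \<and> \<phi> x \<in> F")
      case True
      then have "x \<in> Q" using e by (simp add: Q_def infdist_zero)
      moreover from this have "G x \<le> h x" using elim True by simp
      ultimately show ?thesis using True p by (simp add: enn_powr_mono)
    qed auto
  qed
  then have "(\<integral>\<^sup>+x\<in>\<Omega>. enn_powr (G x) p * indicator F (\<phi> x) \<partial>M) \<le> energy M p Q h"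
    unfolding energy_def by (rule nn_integral_mono_AE)
  also have "\<dots> \<le> ennreal (4 powr p) * (energy M p Q (g True) + energy M p Q (g False))" by (rule dom(2))
  also have "\<dots> \<le> ennreal (4 powr p) * (energy M p \<Omega> (g True) + energy M p \<Omega> (g False))"
    using p Q(2) by (intro mult_left_mono add_mono energy_mono) auto
  also have "\<dots> \<le> ennreal (4 powr p) * (ennreal (C0 powr p) * emeasure M (A \<inter> \<Omega>') + ennreal (C0 powr p) * emeasure M (A \<inter> \<Omega>'))"
    by (intro mult_left_mono add_mono g_energy) simp
  also have "\<dots> = ennreal (2 * 4 powr p * C0 powr p) * emeasure M (A \<inter> \<Omega>')"
  proof -
    have "ennreal (2 * 4 powr p * C0 powr p) = 2 * (ennreal (4 powr p) * ennreal (C0 powr p))"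
      by (simp add: ennreal_mult mult.assoc)
    then show ?thesis by (simp only: mult_2[symmetric] mult_ac)
  qed
  finally show ?thesis by (simp add: A_def)
qed

text \<open>As \<open>e\<close> tends to 0 the neighbourhoods of \<open>F\<close> shrink to \<open>F\<close> itself.\<close>

lemma grad_distance_le_Jacobian:
  assumes C0: "0 \<le> C0"
    and comp: "\<And>f. f \<in> Sobolev_S M p \<Omega>' \<Longrightarrow> f \<circ> \<phi> \<in> Sobolev_S M p \<Omega>"
    and norm: "\<And>f. f \<in> Sobolev_S M p \<Omega>' \<Longrightarrow> S_norm M p \<Omega> (f \<circ> \<phi>) \<le> ennreal C0 * S_norm M p \<Omega>' f"
    and G: "least_ug M p \<Omega> {\<lambda>x. dist (\<phi> x) z} G"
  shows "AE x in M. x \<in> \<Omega> \<longrightarrow> enn_powr (G x) p \<le> ennreal (2 * 4 powr p * C0 powr p) * J0 x"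
proof (rule le_Jacobian_if_le_on_closed)
  have GO: "G \<in> common_ug M p \<Omega> {\<lambda>x. dist (\<phi> x) z}" using G by (simp add: least_ug_def)
  have [measurable]: "zero_off \<Omega> G \<in> borel_measurable borel"
    by (rule common_ug_measurable[OF sets_M p_pos \<Omega>(1) _ GO]) simp
  have "zero_off \<Omega> (\<lambda>x. enn_powr (G x) p) = (\<lambda>x. enn_powr (zero_off \<Omega> G x) p)"
    by (auto simp: zero_off_def enn_powr_mult)
  then show "zero_off \<Omega> (\<lambda>x. enn_powr (G x) p) \<in> borel_measurable borel" by simp
  show "(\<integral>\<^sup>+x\<in>\<Omega>. enn_powr (G x) p \<partial>M) < \<infinity>" using GO by (simp add: common_ug_def energy_def)
  show "0 \<le> 2 * 4 powr p * C0 powr p" by simp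
  fix F :: "'a set" assume F: "closed F"
  show "(\<integral>\<^sup>+x\<in>\<Omega>. enn_powr (G x) p * indicator F (\<phi> x) \<partial>M) \<le> ennreal (2 * 4 powr p * C0 powr p) * emeasure M (F \<inter> \<Omega>')"
  proof (cases "F = {}")
    case False
    define A where "A n = {y. infdist y F \<le> 4 * (1 / real (Suc n))} \<inter> \<Omega>'" for n
    have A_sets: "A n \<in> sets borel" for n
    proof -
      have "closed {y. infdist y F \<le> 4 * (1 / real (Suc n))}" by (intro closed_Collect_le continuous_intros)
      then show ?thesis unfolding A_def by (intro sets.Int) (auto intro: borel_closed)
    qed
    have "(\<lambda>n. emeasure M (A n)) \<longlonglongrightarrow> emeasure M (\<Inter>n. A n)"
    proof (rule Lim_emeasure_decseq)
      show "range A \<subseteq> sets M" using A_sets by auto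
      show "decseq A"
      proof (rule decseq_SucI)
        fix n
        have "4 * (1 / real (Suc (Suc n))) \<le> 4 * (1 / real (Suc n))" by (intro mult_left_mono frac_le) auto
        then show "A (Suc n) \<subseteq> A n" unfolding A_def by (auto intro: order_trans)
      qed
      show "emeasure M (A n) \<noteq> \<infinity>" for n
      proof -
        have "emeasure M (A n) \<le> emeasure M \<Omega>'" by (intro emeasure_mono) (auto simp: A_def)
        then show ?thesis using emeasure_\<Omega>_finite(2) by (auto simp: top_unique)
      qed
    qed
    moreover have "(\<Inter>n. A n) = F \<inter> \<Omega>'"
    proof (intro equalityI subsetI)
      fix y assume y: "y \<in> (\<Inter>n. A n)"
      have "infdist y F \<le> 0"
      proof (rule field_le_epsilon)
        fix e :: real assume "0 < e"
        then obtain n where "1 / real (Suc n) < e / 4" using nat_approx_posE[of "e / 4"] by auto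
        moreover have "infdist y F \<le> 4 * (1 / real (Suc n))" using y by (simp add: A_def)
        ultimately show "infdist y F \<le> 0 + e" by linarith
      qed
      then have "infdist y F = 0" using infdist_nonneg[of y F] by linarith
      then show "y \<in> F \<inter> \<Omega>'" using y in_closed_iff_infdist_zero[OF F False] by (simp add: A_def)
    qed (auto simp: A_def)
    ultimately have "(\<lambda>n. emeasure M (A n)) \<longlonglongrightarrow> emeasure M (F \<inter> \<Omega>')" by simp
    then have "(\<lambda>n. ennreal (2 * 4 powr p * C0 powr p) * emeasure M (A n)) \<longlonglongrightarrow> ennreal (2 * 4 powr p * C0 powr p) * emeasure M (F \<inter> \<Omega>')"
      by (rule ennreal_tendsto_cmult[rotated]) simp
    then show ?thesis
    proof (rule LIMSEQ_le_const)
      have "(\<integral>\<^sup>+x\<in>\<Omega>. enn_powr (G x) p * indicator F (\<phi> x) \<partial>M) \<le> ennreal (2 * 4 powr p * C0 powr p) * emeasure M (A n)" for n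
        unfolding A_def by (rule energy_distance_near_closed_le[OF C0 comp norm G F False]) auto
      then show "\<exists>N. \<forall>n\<ge>N. (\<integral>\<^sup>+x\<in>\<Omega>. enn_powr (G x) p * indicator F (\<phi> x) \<partial>M) \<le> ennreal (2 * 4 powr p * C0 powr p) * emeasure M (A n)"
        by blast
    qed
  qed simp
qed

text \<open>The bound for the minimal upper gradients does not depend on the point \<open>z\<close>, and upper gradients may
  be increased almost everywhere. The Jacobian has the finite integral \<open>\<mu>(\<Omega>')\<close>.\<close>

lemma Jacobian_common_ug:
  assumes C0: "0 \<le> C0"
    and comp: "\<And>f. f \<in> Sobolev_S M p \<Omega>' \<Longrightarrow> f \<circ> \<phi> \<in> Sobolev_S M p \<Omega>"
    and norm: "\<And>f. f \<in> Sobolev_S M p \<Omega>' \<Longrightarrow> S_norm M p \<Omega> (f \<circ> \<phi>) \<le> ennreal C0 * S_norm M p \<Omega>' f"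
  shows "(\<lambda>x. enn_powr (ennreal (2 * 4 powr p * C0 powr p) * J0 x) (1 / p)) \<in> common_ug M p \<Omega> dist_fns"
proof -
  let ?K = "ennreal (2 * 4 powr p * C0 powr p)"
  define g0 where "g0 x = enn_powr (?K * J0 x) (1 / p)" for x
  have g0 [measurable]: "g0 \<in> borel_measurable borel" unfolding g0_def[abs_def] by measurable
  have g0p: "enn_powr (g0 x) p = ?K * J0 x" for x unfolding g0_def by (rule enn_powr_inverse'[OF p_pos])
  have meas: "zero_off \<Omega> g0 \<in> borel_measurable borel" unfolding zero_off_def[abs_def] by measurable
  have "weak_upper_gradient M p \<Omega> f g0" if f: "f \<in> dist_fns" for f
  proof -
    obtain z where z: "z \<in> \<Omega>'" "f = (\<lambda>x. dist (\<phi> x) z)" using f by (auto simp: distance_functions_def)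
    have "(\<lambda>y. dist y z) \<in> Sobolev_S M p \<Omega>'"
    proof (rule Lipschitz_test_function(1)[of _ UNIV])
      show "\<bar>dist x z - dist y z\<bar> \<le> dist x y" for x y
        using abs_dist_diff_le[of x z y] by (simp add: dist_commute)
    qed auto
    from comp[OF this] have "(\<lambda>x. dist (\<phi> x) z) \<in> Sobolev_S M p \<Omega>" by (simp add: comp_def)
    from grad_min_common[OF this] have least: "least_ug M p \<Omega> {f} (grad_min M p \<Omega> f)" unfolding z(2) .
    have "AE x in M. x \<in> \<Omega> \<longrightarrow> enn_powr (grad_min M p \<Omega> f x) p \<le> ?K * J0 x"
      unfolding z(2) by (rule grad_distance_le_Jacobian[OF C0 comp norm least[unfolded z(2)]])
    then have "AE x in M. x \<in> \<Omega> \<longrightarrow> grad_min M p \<Omega> f x \<le> g0 x"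
      by eventually_elim (simp only: g0p[symmetric] enn_powr_le_iff[OF p_pos])
    moreover have "weak_upper_gradient M p \<Omega> f (grad_min M p \<Omega> f)" "energy M p \<Omega> (grad_min M p \<Omega> f) < \<infinity>"
      using least by (auto simp: least_ug_def common_ug_def)
    ultimately show ?thesis using weak_upper_gradient_AE_mono[OF sets_M p_pos \<Omega>(1) _ _ meas] by blast
  qed
  moreover have "energy M p \<Omega> g0 < \<infinity>"
  proof -
    have "energy M p \<Omega> g0 = (\<integral>\<^sup>+x. ?K * (1 * J0 x * indicator \<Omega> x) \<partial>M)" unfolding energy_def g0p by (simp add: mult.assoc)
    also have "\<dots> = ?K * (\<integral>\<^sup>+x\<in>\<Omega>. 1 * J0 x \<partial>M)" by (rule nn_integral_cmult) measurable
    also have "(\<integral>\<^sup>+x\<in>\<Omega>. 1 * J0 x \<partial>M) = (\<integral>\<^sup>+y\<in>\<Omega>'. 1 \<partial>M)"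
      using change_of_variables[of "\<lambda>_. 1"] by simp
    also have "?K * \<dots> < \<infinity>" using emeasure_\<Omega>_finite(2) by (simp add: ennreal_mult_less_top)
    finally show ?thesis .
  qed
  ultimately show ?thesis unfolding g0_def[symmetric] common_ug_def by blast
qed

text \<open>The maximum with a function that is not integrable along the exceptional curves turns a weak upper
  gradient of countably many distance functions into an upper gradient. The inequality passes from
  a dense set of points \<open>z\<close> to all of them by continuity.\<close>

lemma ex_upper_gradient:
  assumes g: "g \<in> common_ug M p \<Omega> dist_fns" and g_meas [measurable]: "g \<in> borel_measurable borel"
  shows "\<exists>h. energy M p \<Omega> h < \<infinity> \<and> h \<in> borel_measurable borel \<and> (\<forall>z\<in>\<Omega>'. \<forall>\<gamma>. rectifiable_curve \<Omega> \<gamma> \<longrightarrow> upper_gradient_ineq (\<lambda>x. dist (\<phi> x) z) h \<gamma>)"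
proof -
  obtain D :: "'a set" where D: "countable D" "\<And>x e. 0 < e \<Longrightarrow> \<exists>d\<in>D. dist x d < e" using separable by blast
  define Z where "Z = D \<inter> \<Omega>'"
  have dense: "\<exists>w\<in>Z. dist z w < e" if z: "z \<in> \<Omega>'" and e: "0 < e" for z e
  proof -
    obtain d where d: "0 < d" "ball z d \<subseteq> \<Omega>'" using z \<Omega>'(1) open_contains_ball by blast
    have "0 < min d e" using d(1) e by simp
    then obtain w where w: "w \<in> D" "dist z w < min d e" using D(2) by blast
    then have "w \<in> ball z d" by simp
    then show ?thesis using w d(2) by (intro bexI[of _ w]) (auto simp: Z_def)
  qed
  have Z: "countable Z" "Z \<noteq> {}" using D(1) dense[of _ 1] \<Omega>'(2) by (auto simp: Z_def)
  have z_range: "range (from_nat_into Z) = Z" by (rule range_from_nat_into[OF Z(2,1)])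
  have "ae_curve M p \<Omega> (\<lambda>\<gamma>. \<forall>n. upper_gradient_ineq (\<lambda>x. dist (\<phi> x) (from_nat_into Z n)) g \<gamma>)"
  proof (rule ae_curve_all[OF sets_M p_pos])
    fix n
    have "from_nat_into Z n \<in> \<Omega>'" using z_range by (auto simp: Z_def)
    then have "weak_upper_gradient M p \<Omega> (\<lambda>x. dist (\<phi> x) (from_nat_into Z n)) g"
      using g by (auto simp: common_ug_def distance_functions_def)
    then show "ae_curve M p \<Omega> (upper_gradient_ineq (\<lambda>x. dist (\<phi> x) (from_nat_into Z n)) g)"
      unfolding weak_upper_gradient_def ae_curve_iff_modulus[OF sets_M p_pos] by blast
  qed
  then obtain \<eta> where \<eta> [measurable]: "\<eta> \<in> borel_measurable borel" and \<eta>_fin: "(\<integral>\<^sup>+x. enn_powr (\<eta> x) p \<partial>M) < \<infinity>"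
     and \<eta>_all: "\<And>\<gamma> n. rectifiable_curve \<Omega> \<gamma> \<Longrightarrow> curve_integral \<gamma> \<eta> < \<infinity> \<Longrightarrow> upper_gradient_ineq (\<lambda>x. dist (\<phi> x) (from_nat_into Z n)) g \<gamma>"
    unfolding ae_curve_def by blast
  define h where "h x = max (g x) (\<eta> x)" for x
  have h: "h \<in> borel_measurable borel" unfolding h_def[abs_def] by measurable
  have "energy M p \<Omega> h \<le> energy M p \<Omega> g + (\<integral>\<^sup>+x. enn_powr (\<eta> x) p \<partial>M)"
  proof -
    have "energy M p \<Omega> h \<le> (\<integral>\<^sup>+x. enn_powr (g x) p * indicator \<Omega> x + enn_powr (\<eta> x) p \<partial>M)"
      unfolding energy_def by (intro nn_integral_mono)
        (auto simp: h_def enn_powr_max[OF p_pos] max_def indicator_def add_increasing add_increasing2)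
    also have "\<dots> = energy M p \<Omega> g + (\<integral>\<^sup>+x. enn_powr (\<eta> x) p \<partial>M)"
      unfolding energy_def by (rule nn_integral_add) measurable
    finally show ?thesis .
  qed
  also have "\<dots> < \<infinity>" using g \<eta>_fin by (simp add: common_ug_def)
  finally have fin: "energy M p \<Omega> h < \<infinity>" .
  have "upper_gradient_ineq (\<lambda>x. dist (\<phi> x) z) h \<gamma>" if z: "z \<in> \<Omega>'" and \<gamma>: "rectifiable_curve \<Omega> \<gamma>" for z \<gamma>
  proof (cases "curve_integral \<gamma> \<eta> < \<infinity>")
    case True
    let ?I = "curve_integral \<gamma> h"
    have "ennreal \<bar>dist (\<phi> (pathstart \<gamma>)) z - dist (\<phi> (pathfinish \<gamma>)) z\<bar> \<le> ?I"
    proof (rule ennreal_le_epsilon)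
      fix e :: real assume e: "0 < e"
      have "0 < e / 2" using e by simp
      then obtain w where w: "w \<in> Z" "dist z w < e / 2" using dense[OF z] by blast
      then obtain n where n: "w = from_nat_into Z n" using z_range by blast
      have "\<bar>dist (\<phi> (pathstart \<gamma>)) z - dist (\<phi> (pathfinish \<gamma>)) z\<bar>
         \<le> \<bar>dist (\<phi> (pathstart \<gamma>)) w - dist (\<phi> (pathfinish \<gamma>)) w\<bar> + e"
        using dist_triangle2[of "\<phi> (pathstart \<gamma>)" z w] dist_triangle2[of "\<phi> (pathstart \<gamma>)" w z]
          dist_triangle2[of "\<phi> (pathfinish \<gamma>)" z w] dist_triangle2[of "\<phi> (pathfinish \<gamma>)" w z] w(2) dist_commute[of z w]
        by linarith
      then have "ennreal \<bar>dist (\<phi> (pathstart \<gamma>)) z - dist (\<phi> (pathfinish \<gamma>)) z\<bar>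
         \<le> ennreal \<bar>dist (\<phi> (pathstart \<gamma>)) w - dist (\<phi> (pathfinish \<gamma>)) w\<bar> + ennreal e"
        using e by (simp flip: ennreal_plus)
      also have "\<dots> \<le> curve_integral \<gamma> g + ennreal e"
        using \<eta>_all[OF \<gamma> True, of n] unfolding n upper_gradient_ineq_def by (rule add_right_mono)
      also have "\<dots> \<le> ?I + ennreal e" by (intro add_right_mono curve_integral_mono) (simp add: h_def)
      finally show "ennreal \<bar>dist (\<phi> (pathstart \<gamma>)) z - dist (\<phi> (pathfinish \<gamma>)) z\<bar> \<le> ?I + ennreal e" .
    qed
    then show ?thesis by (simp add: upper_gradient_ineq_def)
  next
    case False
    have "curve_integral \<gamma> \<eta> \<le> curve_integral \<gamma> h" by (rule curve_integral_mono) (simp add: h_def)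
    then have "curve_integral \<gamma> h = \<top>" using False by (simp add: less_top[symmetric] top_unique)
    then show ?thesis by (simp add: upper_gradient_ineq_def)
  qed
  with fin h show ?thesis by blast
qed

lemma RS_class_loc_if_common_ug:
  assumes g: "g \<in> common_ug M p \<Omega> dist_fns" and g_meas: "g \<in> borel_measurable borel"
  shows "\<phi> \<in> RS_class_loc M p \<Omega> \<Omega>'"
  unfolding RS_class_loc_def
proof (intro CollectI allI impI)
  fix U assume "compactly_inside U \<Omega>"
  then have U: "open U" "U \<subseteq> \<Omega>" using closure_subset by (auto simp: compactly_inside_def)
  show "\<phi> \<in> RS_class M p U \<Omega>'"
    unfolding RS_class_def
  proof (intro CollectI conjI ballI)
    show "\<phi> ` U \<subseteq> \<Omega>'" using U \<phi>_in by blast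
    show "bi_measurable M U \<Omega>' \<phi>"
      unfolding bi_measurable_def
    proof (intro conjI allI impI)
      fix E assume E: "E \<subseteq> U" "E \<in> null_sets (completion M)"
      then have "E \<subseteq> \<Omega>" using U by blast
      then show "\<phi> ` E \<in> null_sets (completion M)" using bimeas E(2) unfolding bi_measurable_def by (elim conjE) simp
    next
      fix E assume E: "E \<subseteq> \<Omega>'" "E \<in> null_sets (completion M)"
      then have "\<phi> -` E \<inter> \<Omega> \<in> null_sets (completion M)" using bimeas unfolding bi_measurable_def by (elim conjE) simp
      moreover have "\<phi> -` E \<inter> U \<subseteq> \<phi> -` E \<inter> \<Omega>" using U by blast
      ultimately show "\<phi> -` E \<inter> U \<in> null_sets (completion M)" by (metis null_sets_completion_subset)
    qed
    show "(\<lambda>x. dist (\<phi> x) z) \<in> Sobolev_N M p U" if z: "z \<in> \<Omega>'" for z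
      unfolding Sobolev_N_def
    proof (intro CollectI conjI)
      have "(\<lambda>y. dist y z) \<in> borel_measurable M"
        by (rule borel_measurable_continuous_onI[THEN measurable_cong_sets[OF sets_M refl, THEN equalityD2, THEN subsetD]]) (intro continuous_intros)
      then have "(\<lambda>y. dist y z) \<in> borel_measurable (restrict_space (completion M) \<Omega>')"
        by (intro measurable_restrict_space1 measurable_completion)
      from measurable_comp[OF this] have "(\<lambda>x. dist (\<phi> x) z) \<in> borel_measurable (restrict_space (completion M) \<Omega>)"
        by (simp add: comp_def)
      then show "(\<lambda>x. dist (\<phi> x) z) \<in> borel_measurable (restrict_space (completion M) U)"
        by (rule measurable_restrict_mono) (rule U(2))
      obtain b where b: "\<And>x. x \<in> \<Omega> \<Longrightarrow> dist (\<phi> x) z \<le> b" using dist_map_bounded z by blast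
      have "energy M p U (\<lambda>x. ennreal \<bar>dist (\<phi> x) z\<bar>) \<le> (\<integral>\<^sup>+x. enn_powr (ennreal b) p * indicator \<Omega> x \<partial>M)"
        unfolding energy_def
      proof (rule nn_integral_mono)
        fix x
        show "enn_powr (ennreal \<bar>dist (\<phi> x) z\<bar>) p * indicator U x \<le> enn_powr (ennreal b) p * indicator \<Omega> x"
        proof (cases "x \<in> U")
          case True
          then have "x \<in> \<Omega>" using U(2) by blast
          then show ?thesis using True b[of x] p by (simp add: enn_powr_mono ennreal_leI)
        qed simp
      qed
      also have "\<dots> = enn_powr (ennreal b) p * emeasure M \<Omega>" by (subst nn_integral_cmult_indicator) auto
      also have "\<dots> < \<infinity>" using emeasure_\<Omega>_finite(1) by (simp add: ennreal_mult_less_top)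
      finally show "Lp_norm M p U (\<lambda>x. ennreal \<bar>dist (\<phi> x) z\<bar>) < \<infinity>" by (simp add: Lp_norm_eq)
      have "g \<in> common_ug M p \<Omega> {\<lambda>x. dist (\<phi> x) z}" using g z by (auto simp: common_ug_def distance_functions_def)
      from common_ug_subset[OF sets_M p_pos \<Omega>(1) _ this U]
      have "g \<in> common_ug M p U {\<lambda>x. dist (\<phi> x) z}" by simp
      then show "\<exists>g. Lp_weak_upper_gradient M p U (\<lambda>x. dist (\<phi> x) z) g" unfolding Lp_weak_upper_gradient_iff by blast
    qed
    obtain h where h: "energy M p \<Omega> h < \<infinity>" "h \<in> borel_measurable borel"
        "\<And>z \<gamma>. z \<in> \<Omega>' \<Longrightarrow> rectifiable_curve \<Omega> \<gamma> \<Longrightarrow> upper_gradient_ineq (\<lambda>x. dist (\<phi> x) z) h \<gamma>"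
      using ex_upper_gradient[OF g g_meas] by blast
    show "\<exists>h. Lp_norm M p U h < \<infinity> \<and> (\<forall>z\<in>\<Omega>'. upper_gradient U (\<lambda>x. dist (\<phi> x) z) h)"
    proof (intro exI[of _ h] conjI ballI)
      have "energy M p U h \<le> energy M p \<Omega> h" using p U by (intro energy_mono) auto
      then have "energy M p U h < \<infinity>" using h(1) by (rule le_less_trans)
      then show "Lp_norm M p U h < \<infinity>" by (simp add: Lp_norm_eq)
      fix z assume z: "z \<in> \<Omega>'"
      have "rectifiable_curve \<Omega> \<gamma>" if "rectifiable_curve U \<gamma>" for \<gamma>
        using that U(2) unfolding rectifiable_curve_def by blast
      then show "upper_gradient U (\<lambda>x. dist (\<phi> x) z) h"
        unfolding upper_gradient_def using h(3)[OF z] measurable_restrict_space1[OF h(2)] by blast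
    qed
  qed
qed

lemma borel_measurable_completion_AE_eq:
  fixes f g :: "'a \<Rightarrow> ennreal"
  assumes g: "g \<in> borel_measurable borel" and eq: "AE x in M. f x = g x"
  shows "f \<in> borel_measurable (completion M)"
proof (rule measurableI)
  fix S :: "ennreal set" assume S: "S \<in> sets borel"
  have n: "{x. P x \<in> S \<and> f x \<noteq> g x} \<in> sets (completion M)" for P :: "'a \<Rightarrow> ennreal"
  proof -
    have "AE x in M. \<not> (P x \<in> S \<and> f x \<noteq> g x)" using eq by eventually_elim simp
    then have "Measurable.pred (completion M) (\<lambda>x. P x \<in> S \<and> f x \<noteq> g x)" by (rule sets_completion_AE)
    then show ?thesis unfolding pred_def by simp
  qed
  have "g -` S \<in> sets (completion M)" using measurable_sets[OF g S] by (intro sets_completion_Borel) simp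
  moreover have "f -` S \<inter> space (completion M) = (g -` S - {x. g x \<in> S \<and> f x \<noteq> g x}) \<union> {x. f x \<in> S \<and> f x \<noteq> g x}"
    by auto
  ultimately show "f -` S \<inter> space (completion M) \<in> sets (completion M)" using n by (simp only: sets.Un sets.Diff)
qed simp

text \<open>The quotient \<open>|D_min \<phi>|\<^sup>p / J\<close> is measurable with respect to the completion, as the metric Jacobian
  agrees with the Borel function \<open>J0\<close> almost everywhere. Where \<open>J = 0\<close> also \<open>|D_min \<phi>| = 0\<close>, and \<open>0 / 0 = 0\<close>.\<close>

lemma K_global_finite_if_le_Jacobian:
  assumes D: "\<And>k. D_min M p \<Omega> \<Omega>' \<phi> \<in> common_ug M p (inner_part \<Omega> k) dist_fns"
    and DJ: "AE x in M. x \<in> \<Omega> \<longrightarrow> enn_powr (D_min M p \<Omega> \<Omega>' \<phi> x) p \<le> ennreal k * J0 x"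
  shows "K_global M p \<Omega> \<Omega>' \<phi> < \<infinity>"
proof -
  let ?D = "D_min M p \<Omega> \<Omega>' \<phi>"
  define Kf where "Kf x = enn_powr (enn_powr (zero_off \<Omega> ?D x) p / J0 x) (1 / p)" for x
  have [measurable]: "zero_off \<Omega> ?D \<in> borel_measurable borel" using D by (rule locally_common_ug_measurable)
  have Kf: "Kf \<in> borel_measurable borel" unfolding Kf_def[abs_def] by measurable
  have eq: "AE x in M. zero_off \<Omega> (K_dilatation M p \<Omega> \<Omega>' \<phi>) x = Kf x"
    using J0_eq_metric_Jacobian
    by eventually_elim (auto simp: zero_off_def Kf_def K_dilatation_def indicator_def)
  have "zero_off \<Omega> (K_dilatation M p \<Omega> \<Omega>' \<phi>) \<in> borel_measurable (completion M)"
    by (rule borel_measurable_completion_AE_eq[OF Kf eq])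
  then have meas: "K_dilatation M p \<Omega> \<Omega>' \<phi> \<in> borel_measurable (restrict_space (completion M) \<Omega>)"
    unfolding zero_off_def[abs_def] by (subst borel_measurable_restrict_space_iff_ennreal) auto
  have "AE x in M. x \<in> \<Omega> \<longrightarrow> K_dilatation M p \<Omega> \<Omega>' \<phi> x \<le> enn_powr (ennreal k) (1 / p)"
    using DJ J0_eq_metric_Jacobian J0_finite
  proof eventually_elim
    case (elim x)
    show ?case
    proof
      assume x: "x \<in> \<Omega>"
      have "enn_powr (?D x) p / J0 x \<le> ennreal k"
      proof (cases "J0 x = 0")
        case True then show ?thesis using elim(1) x by simp
      next
        case False
        have "enn_powr (?D x) p / J0 x \<le> ennreal k * J0 x / J0 x" using elim(1) x by (intro divide_right_mono_ennreal) simp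
        also have "\<dots> = ennreal k" using False elim(3) by (intro ennreal_mult_divide_eq) auto
        finally show ?thesis .
      qed
      then show "K_dilatation M p \<Omega> \<Omega>' \<phi> x \<le> enn_powr (ennreal k) (1 / p)"
        using elim(2) x p by (simp add: K_dilatation_def enn_powr_mono)
    qed
  qed
  then have "AE x in restrict_space (completion M) \<Omega>. K_dilatation M p \<Omega> \<Omega>' \<phi> x \<le> enn_powr (ennreal k) (1 / p)"
    by (subst AE_restrict_space_iff) (auto simp: AE_completion_iff)
  then have "K_global M p \<Omega> \<Omega>' \<phi> \<le> enn_powr (ennreal k) (1 / p)"
    unfolding K_global_def by (rule esssup_I[OF meas])
  also have "\<dots> < \<infinity>" by simp
  finally show ?thesis .
qed

lemma map_regular_if_bounded_composition:
  assumes "bounded_composition_operator M p \<Omega> \<Omega>' \<phi>"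
  shows "\<phi> \<in> RS_class_loc M p \<Omega> \<Omega>'" and "K_global M p \<Omega> \<Omega>' \<phi> < \<infinity>"
proof -
  obtain C0 where C0: "0 \<le> C0" and norm: "\<And>f. f \<in> Sobolev_S M p \<Omega>' \<Longrightarrow> S_norm M p \<Omega> (f \<circ> \<phi>) \<le> ennreal C0 * S_norm M p \<Omega>' f"
    and comp: "\<And>f. f \<in> Sobolev_S M p \<Omega>' \<Longrightarrow> f \<circ> \<phi> \<in> Sobolev_S M p \<Omega>"
    using assms unfolding bounded_composition_operator_def by auto
  define k where "k = 2 * 4 powr p * C0 powr p"
  define g0 where "g0 x = enn_powr (ennreal k * J0 x) (1 / p)" for x
  have g0: "g0 \<in> common_ug M p \<Omega> dist_fns"
    unfolding g0_def k_def by (rule Jacobian_common_ug[OF C0 comp norm])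
  have g0_meas: "g0 \<in> borel_measurable borel" unfolding g0_def[abs_def] by measurable
  show "\<phi> \<in> RS_class_loc M p \<Omega> \<Omega>'" by (rule RS_class_loc_if_common_ug[OF g0 g0_meas])
  have sub: "g0 \<in> common_ug M p U dist_fns" if "compactly_inside U \<Omega>" for U
    by (rule common_ug_subset[OF sets_M p_pos \<Omega>(1) dist_fns_ne g0])
       (use that closure_subset in \<open>auto simp: compactly_inside_def\<close>)
  let ?D = "D_min M p \<Omega> \<Omega>' \<phi>"
  have least: "least_ug M p (inner_part \<Omega> j) dist_fns ?D" for j
    using sub compactly_inside_inner_part[OF \<Omega>(3), of j] by (intro D_min_least) blast+
  then have D: "?D \<in> common_ug M p (inner_part \<Omega> j) dist_fns" for j by (simp add: least_ug_def)
  have "AE x in M. x \<in> inner_part \<Omega> j \<longrightarrow> ?D x \<le> g0 x" for j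
    using least[of j] sub[OF compactly_inside_inner_part[OF \<Omega>(3), of j]] unfolding least_ug_def by (elim conjE bspec)
  then have "AE x in M. \<forall>j. x \<in> inner_part \<Omega> j \<longrightarrow> ?D x \<le> g0 x" unfolding AE_all_countable by blast
  then have "AE x in M. x \<in> \<Omega> \<longrightarrow> enn_powr (?D x) p \<le> ennreal k * J0 x"
  proof eventually_elim
    case (elim x)
    show ?case
    proof
      assume "x \<in> \<Omega>"
      then have "?D x \<le> g0 x" using elim UN_inner_part[OF \<Omega>(1)] by blast
      then have "enn_powr (?D x) p \<le> enn_powr (g0 x) p" using p by (intro enn_powr_mono) auto
      also have "\<dots> = ennreal k * J0 x" unfolding g0_def by (rule enn_powr_inverse'[OF p_pos])
      finally show "enn_powr (?D x) p \<le> ennreal k * J0 x" .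
    qed
  qed
  then show "K_global M p \<Omega> \<Omega>' \<phi> < \<infinity>" by (rule K_global_finite_if_le_Jacobian[OF D])
qed

section \<open>From the map to the composition operator\<close>

text \<open>A finite quotient \<open>|D_min \<phi>|\<^sup>p / J\<close> forces \<open>|D_min \<phi>| = 0\<close> where \<open>J = 0\<close>, so that the bound for the
  quotient is equivalent to \<open>|D_min \<phi>|\<^sup>p \<le> k J\<close>.\<close>

lemma bounded_composition_if_map_regular:
  assumes RS: "\<phi> \<in> RS_class_loc M p \<Omega> \<Omega>'" and K: "K_global M p \<Omega> \<Omega>' \<phi> < \<infinity>"
    and P: "weak_Poincare M p"
  shows "bounded_composition_operator M p \<Omega> \<Omega>' \<phi>"
proof -
  let ?D = "D_min M p \<Omega> \<Omega>' \<phi>"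
  have ne: "common_ug M p U dist_fns \<noteq> {}" if U: "compactly_inside U \<Omega>" for U
  proof -
    have "\<phi> \<in> RS_class M p U \<Omega>'" using RS U by (simp add: RS_class_loc_def)
    then obtain g where "Lp_norm M p U g < \<infinity>" "\<forall>z\<in>\<Omega>'. upper_gradient U (\<lambda>x. dist (\<phi> x) z) g"
      unfolding RS_class_def by blast
    then have "g \<in> common_ug M p U dist_fns"
      by (auto simp: common_ug_def distance_functions_def Lp_norm_eq intro: upper_gradient_imp_weak)
    then show ?thesis by blast
  qed
  have D: "?D \<in> common_ug M p (inner_part \<Omega> j) dist_fns" for j
    using D_min_least[OF ne compactly_inside_inner_part[OF \<Omega>(3), of j]] by (simp add: least_ug_def)
  obtain K' where K': "K_global M p \<Omega> \<Omega>' \<phi> = ennreal K'" "0 \<le> K'" using K by (cases "K_global M p \<Omega> \<Omega>' \<phi>") auto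
  define k where "k = K' powr p"
  have k: "0 \<le> k" by (simp add: k_def)
  have "AE x in restrict_space (completion M) \<Omega>. K_dilatation M p \<Omega> \<Omega>' \<phi> x \<le> ennreal K'"
    unfolding K'(1)[symmetric] K_global_def by (rule esssup_AE)
  then have "AE x in M. x \<in> \<Omega> \<longrightarrow> K_dilatation M p \<Omega> \<Omega>' \<phi> x \<le> ennreal K'"
    by (subst (asm) AE_restrict_space_iff) (auto simp: AE_completion_iff)
  then have DJ: "AE x in M. x \<in> \<Omega> \<longrightarrow> enn_powr (?D x) p \<le> ennreal k * J0 x"
    using J0_eq_metric_Jacobian J0_finite
  proof eventually_elim
    case (elim x)
    show ?case
    proof
      assume x: "x \<in> \<Omega>"
      have "enn_powr (enn_powr (?D x) p / J0 x) (1 / p) \<le> ennreal K'" using elim(1,2) x by (simp add: K_dilatation_def)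
      then have "enn_powr (enn_powr (enn_powr (?D x) p / J0 x) (1 / p)) p \<le> enn_powr (ennreal K') p"
        using p by (intro enn_powr_mono) auto
      then have le: "enn_powr (?D x) p / J0 x \<le> ennreal k"
        using K'(2) by (simp add: enn_powr_inverse'[OF p_pos] enn_powr_ennreal k_def)
      show "enn_powr (?D x) p \<le> ennreal k * J0 x"
      proof (cases "J0 x = 0")
        case True
        then have "enn_powr (?D x) p = 0" using le by (cases "enn_powr (?D x) p = 0") (auto simp: ennreal_divide_zero top_unique)
        then show ?thesis by simp
      next
        case False
        have "enn_powr (?D x) p = enn_powr (?D x) p * J0 x / J0 x" using False elim(3) by (simp add: ennreal_mult_divide_eq)
        also have "\<dots> = J0 x * (enn_powr (?D x) p / J0 x)" by (simp add: ennreal_times_divide mult.commute)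
        also have "\<dots> \<le> J0 x * ennreal k" using le by (intro mult_left_mono) auto
        finally show ?thesis by (simp add: mult.commute)
      qed
    qed
  qed
  have main: "f \<circ> \<phi> \<in> Sobolev_S M p \<Omega>" "S_norm M p \<Omega> (f \<circ> \<phi>) \<le> ennreal (k powr (1 / p)) * S_norm M p \<Omega>' f"
    if f: "f \<in> Sobolev_S M p \<Omega>'" for f
  proof -
    obtain g where "Lp_weak_upper_gradient M p \<Omega>' f g" using f by (auto simp: Sobolev_S_def)
    then have "least_ug M p \<Omega>' {f} (grad_min M p \<Omega>' f)" by (rule grad_min_least[OF sets_M p_pos \<Omega>'(1)])
    then have "grad_min M p \<Omega>' f \<in> common_ug M p \<Omega>' {f}" by (simp add: least_ug_def)
    note G = weak_upper_gradient_comp[OF D k DJ this]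
    have meas: "f \<circ> \<phi> \<in> borel_measurable (restrict_space (completion M) \<Omega>)"
      using f by (intro measurable_comp) (simp add: Sobolev_S_def)
    have "locally_L1 M \<Omega> (f \<circ> \<phi>)" by (rule locally_L1_if_Poincare[OF p_pos P \<Omega>(1) meas G(1)])
    then show S: "f \<circ> \<phi> \<in> Sobolev_S M p \<Omega>"
      using meas G(1) unfolding Sobolev_S_def Lp_weak_upper_gradient_iff by blast
    have "energy M p \<Omega> (grad_min M p \<Omega> (f \<circ> \<phi>)) \<le> energy M p \<Omega> (\<lambda>x. grad_min M p \<Omega>' f (\<phi> x) * ?D x)"
      by (rule energy_le_if_least_ug[OF sets_M p_pos \<Omega>(1) _ grad_min_common[OF S] G(1)]) simp
    also note G(2)
    finally have "enn_powr (energy M p \<Omega> (grad_min M p \<Omega> (f \<circ> \<phi>))) (1 / p)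
        \<le> enn_powr (ennreal k * energy M p \<Omega>' (grad_min M p \<Omega>' f)) (1 / p)"
      using p by (intro enn_powr_mono) auto
    then show "S_norm M p \<Omega> (f \<circ> \<phi>) \<le> ennreal (k powr (1 / p)) * S_norm M p \<Omega>' f"
      using k by (simp add: S_norm_def Lp_norm_eq enn_powr_mult enn_powr_ennreal)
  qed
  show ?thesis
    unfolding bounded_composition_operator_def
  proof (intro conjI ballI exI[of _ "k powr (1 / p)"])
    show "0 \<le> k powr (1 / p)" by simp
  qed (use main in auto)
qed

end

theorem theorem3p4:
  fixes M :: "'a::complete_space measure"
    and p :: real
    and \<Omega> \<Omega>' :: "'a set"
    and \<phi> :: "'a \<Rightarrow> 'a"
  assumes "homogeneous_space M"
    and "1 < p"
    and "weak_Poincare M p"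
    and "domain_in \<Omega>" and "bounded \<Omega>"
    and "domain_in \<Omega>'" and "bounded \<Omega>'"
    and "\<exists>\<psi>. homeomorphism \<Omega> \<Omega>' \<phi> \<psi>"
    and "bi_measurable M \<Omega> \<Omega>' \<phi>"
  shows "bounded_composition_operator M p \<Omega> \<Omega>' \<phi> \<longleftrightarrow>
         \<phi> \<in> RS_class_loc M p \<Omega> \<Omega>' \<and> K_global M p \<Omega> \<Omega>' \<phi> < \<infinity>"
proof -
  obtain \<psi> where \<psi>: "homeomorphism \<Omega> \<Omega>' \<phi> \<psi>" using assms(8) by blast
  have dm: "doubling_metric_measure M" using assms(1) by (simp add: homogeneous_space_def)
  then obtain C where C: "1 \<le> C" "\<And>x r. 0 < r \<Longrightarrow> emeasure M (ball x (2 * r)) \<le> ennreal C * emeasure M (ball x r)"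
    unfolding doubling_metric_measure_def by blast
  interpret bimeasurable_homeomorphism M C p \<Omega> \<Omega>' \<phi> \<psi>
    by unfold_locales (use assms dm C \<psi> in \<open>auto simp: doubling_metric_measure_def domain_in_def\<close>)
  show ?thesis
    using map_regular_if_bounded_composition bounded_composition_if_map_regular assms(3) by blast
qed

end
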